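(* Let $N\ge2$, $0<\alpha<1$, let $\Omega\subset\mathbb{R}^N$ be a bounded domain with boundary $\Gamma$ of class $C^{2,\alpha}$, let $u$ be the solution of $\Delta u=N$ in $\Omega$, $u=0$ on $\Gamma$, and let $M=\max_{\overline\Omega}|\nabla u|$. Let $z$ be any (local) minimum point of $u$ in $\overline\Omega$, let $a\in\mathbb{R}$, $q(x)=\frac12(|x-z|^2-a)$, $h=q-u$, $\rho_i=\min_{x\in\Gamma}|x-z|$, $\rho_e=\max_{x\in\Gamma}|x-z|$, and let $\mu_0(\Omega)$ be computed with respect to $x_0=z$. There are constants $k_N,\alpha_N>0$ depending only on $N$ such that: (i) if $N=2$ or $3$, then $\rho_e-\rho_i\le C\,\|\nabla^2h\|_{L^2(\Omega)}$ with $C=k_N\,c\,\frac{d_\Omega^\gamma}{|\Omega|^{1/N}}\,\frac{1+\mu_0(\Omega)}{\mu_0(\Omega)}$; (ii) if $N\ge4$, then $\rho_e-\rho_i\le C\,\|\nabla^2h\|_{L^2(\Omega)}^{2/(N+2)}$ whenever $\|\nabla^2h\|_{L^2(\Omega)}<\varepsilon$, where $C=k_N\,\frac{M^{\frac{N}{N+2}}}{\mu_0(\Omega)^{\frac{2}{N+2}}\,|\Omega|^{1/N}}$ and $\varepsilon=\alpha_N\,M\,\mu_0(\Omega)\,r_i^{\frac{N+2}{2}}$.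
   Context: $\|\nabla^2h\|_{L^2(\Omega)}=(\int_\Omega|\nabla^2h|^2dx)^{1/2}$, $|\nabla^2h|^2$ being the sum of squares of the Hessian entries. $|\Omega|$ is the volume and $d_\Omega$ the diameter of $\Omega$. $r_i>0$ is a radius of the uniform interior sphere condition (for every $p\in\Gamma$ a ball of radius $r_i$ contained in $\Omega$ has closure meeting $\Gamma$ only at $p$). For $x_0\in\Omega$, $\mu_0(\Omega)=\inf\{\int_\Omega|\nabla v|^2dx:\ v\in W^{1,2}(\Omega),\ \Delta v=0,\ \int_\Omega v^2=1,\ v(x_0)=0\}>0$. For $N=2$, $\gamma$ is any fixed number in $(0,1)$; for $N=3$, $\gamma=1/2$; $c$ is a constant with $|v(x)-v(y)|\le c\,\|v\|_{W^{2,2}(\Omega)}|x-y|^\gamma$ for all $v\in W^{2,2}(\Omega)$ and $x,y\in\overline\Omega$. *)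

theory Defs
  imports "HOL-Analysis.Analysis"
begin

definition grad :: "(real^'n \<Rightarrow> real) \<Rightarrow> real^'n \<Rightarrow> real^'n" where
  "grad f x = (\<chi> i. frechet_derivative f (at x) (axis i 1))"

definition hess :: "(real^'n \<Rightarrow> real) \<Rightarrow> real^'n \<Rightarrow> real^'n^'n" where
  "hess f x = (\<chi> i j. frechet_derivative (\<lambda>y. grad f y $ j) (at x) (axis i 1))"

definition lap :: "(real^'n \<Rightarrow> real) \<Rightarrow> real^'n \<Rightarrow> real" where
  "lap f x = (\<Sum>i\<in>UNIV. hess f x $ i $ i)"

definition hess_sq :: "(real^'n \<Rightarrow> real) \<Rightarrow> real^'n \<Rightarrow> real" where
  "hess_sq f x = (\<Sum>i\<in>UNIV. \<Sum>j\<in>UNIV. (hess f x $ i $ j)\<^sup>2)"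

definition C2_on :: "(real^'n) set \<Rightarrow> (real^'n \<Rightarrow> real) \<Rightarrow> bool" where
  "C2_on S f \<longleftrightarrow> (\<forall>x\<in>S. f differentiable (at x) \<and>
      (\<forall>j. (\<lambda>y. grad f y $ j) differentiable (at x))) \<and> continuous_on S (hess f)"

definition C2alpha_on :: "real \<Rightarrow> (real^'n) set \<Rightarrow> (real^'n \<Rightarrow> real) \<Rightarrow> bool" where
  "C2alpha_on \<alpha> S f \<longleftrightarrow> C2_on S f \<and>
     (\<exists>L. \<forall>x\<in>S. \<forall>y\<in>S. \<forall>i j. \<bar>hess f x $ i $ j - hess f y $ i $ j\<bar> \<le> L * dist x y powr \<alpha>)"

text \<open>Boundary of class C^{2,alpha}: near each boundary point, Omega is the region above
  the graph of a C^{2,alpha} function over the hyperplane orthogonal to some unit vector e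
  (the function g is constant in direction e, i.e. a function of the orthogonal coordinates).\<close>
definition C2alpha_boundary :: "real \<Rightarrow> (real^'n) set \<Rightarrow> bool" where
  "C2alpha_boundary \<alpha> \<Omega> \<longleftrightarrow> (\<forall>p\<in>frontier \<Omega>. \<exists>r>0. \<exists>e g.
      norm e = 1 \<and> (\<forall>x t. g (x + t *\<^sub>R e) = g x) \<and> C2alpha_on \<alpha> (ball p r) g \<and>
      \<Omega> \<inter> ball p r = {x \<in> ball p r. x \<bullet> e > g x})"

definition hessL2 :: "(real^'n) set \<Rightarrow> (real^'n \<Rightarrow> real) \<Rightarrow> real" where
  "hessL2 \<Omega> f = sqrt (LINT x:\<Omega>|lborel. hess_sq f x)"

text \<open>mu_0(Omega) w.r.t. x0: harmonic functions in W^{1,2}(Omega) (harmonic functions are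
  smooth inside Omega, so membership in W^{1,2} means v and |grad v| are square integrable).\<close>
definition mu0 :: "(real^'n) set \<Rightarrow> real^'n \<Rightarrow> real" where
  "mu0 \<Omega> x0 = Inf {LINT x:\<Omega>|lborel. (norm (grad v x))\<^sup>2 | v.
      C2_on \<Omega> v \<and> (\<forall>x\<in>\<Omega>. lap v x = 0) \<and>
      set_integrable lborel \<Omega> (\<lambda>x. (v x)\<^sup>2) \<and>
      set_integrable lborel \<Omega> (\<lambda>x. (norm (grad v x))\<^sup>2) \<and>
      (LINT x:\<Omega>|lborel. (v x)\<^sup>2) = 1 \<and> v x0 = 0}"

text \<open>W^{2,2}(Omega) functions (represented classically: C^2 in Omega, continuous up to the
  boundary, with square integrable derivatives up to order 2) and their W^{2,2} norm.\<close>
definition W22 :: "(real^'n) set \<Rightarrow> (real^'n \<Rightarrow> real) \<Rightarrow> bool" where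
  "W22 \<Omega> v \<longleftrightarrow> C2_on \<Omega> v \<and> continuous_on (closure \<Omega>) v \<and>
      set_integrable lborel \<Omega> (\<lambda>x. (v x)\<^sup>2) \<and>
      set_integrable lborel \<Omega> (\<lambda>x. (norm (grad v x))\<^sup>2) \<and>
      set_integrable lborel \<Omega> (hess_sq v)"

definition W22_norm :: "(real^'n) set \<Rightarrow> (real^'n \<Rightarrow> real) \<Rightarrow> real" where
  "W22_norm \<Omega> v = sqrt (LINT x:\<Omega>|lborel. (v x)\<^sup>2 + (norm (grad v x))\<^sup>2 + hess_sq v x)"

definition interior_sphere_radius :: "(real^'n) set \<Rightarrow> real \<Rightarrow> bool" where
  "interior_sphere_radius \<Omega> r \<longleftrightarrow> r > 0 \<and>
     (\<forall>p\<in>frontier \<Omega>. \<exists>y. ball y r \<subseteq> \<Omega> \<and> cball y r \<inter> frontier \<Omega> = {p})"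

end

theory Submission
  imports Defs
begin

text \<open>The function \<open>h = q - u\<close> is harmonic, its gradient vanishes at \<open>z\<close>, and on the boundary
  \<open>2 h = |x - z|\<^sup>2 - a\<close>. Hence \<open>\<rho>\<^sub>e\<^sup>2 - \<rho>\<^sub>i\<^sup>2\<close> is twice a difference of boundary values of \<open>h\<close>.
  Applying the definition of \<open>\<mu>\<^sub>0\<close> to \<open>h - h(z)\<close> and to the partial derivatives of \<open>h\<close>
  bounds the \<open>W\<^sup>2\<^sup>,\<^sup>2\<close> norm of \<open>h - h(z)\<close> by the \<open>L\<^sup>2\<close> norm of the Hessian.
  In dimension 2 and 3 the embedding constant \<open>c\<close> then controls the oscillation of \<open>h\<close>. In
  higher dimension the boundary values are compared with values at distance \<open>\<sigma>\<close> from the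
  boundary, where the mean value property applies; the error is at most \<open>M \<sigma>\<close>, and \<open>\<sigma>\<close> is
  optimised.

  All integrals and suprema in the statement must be shown to be meaningful. Comparison with
  barriers in exterior balls gives \<open>|u| \<le> C d\<close>, where \<open>d\<close> is the distance to the boundary,
  and interior estimates then bound the gradient of \<open>u\<close>. For the Hessian, difference quotients
  of \<open>u\<close> in a direction tangential at a boundary point are \<open>O(d)\<close> on the boundary near that point;
  a superharmonic barrier turns this into \<open>O(d\<^sup>3\<^sup>/\<^sup>4)\<close> for the tangential derivative inside, so by
  interior estimates and \<open>\<Delta> u = N\<close> the Hessian is \<open>O(d\<^sup>-\<^sup>1\<^sup>/\<^sup>4)\<close>, which is square
  integrable. Finally \<open>\<mu>\<^sub>0 > 0\<close> holds because a harmonic function vanishing at \<open>z\<close> is bounded by its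
  energy on compact sets, and near the boundary by the energy and its values further inside.\<close>

section \<open>Functions with continuous second derivatives\<close>

text \<open>What shapes the proof is that \<open>u\<close> is only known to be C^2 inside and
  continuous up to the boundary, while the quantities of the theorem have silent default values: the
  integral of a non-integrable function is 0, and \<open>Sup\<close> or \<open>Inf\<close> of an
  unbounded or empty set says nothing. Were the Hessian not square integrable, \<open>hessL2\<close>
  would be 0. So regularity up to the boundary is proved, but only a bounded gradient and a Hessian
  in L^2, both from barriers.

  The theory of harmonic functions rests on one mean value formula, with the weight (1 - |x|^2)^2 on
  the unit ball. As x (1 - |x|^2)^2 is a multiple of the gradient of (1 - |x|^2)^3, no surface
  integrals occur: integration by parts with compact support suffices. Differentiating the formula
  in its centre yields gradient bounds and third derivatives.

  For N >= 4 the mean square bound at distance sigma from the boundary costs sigma^(-N/2) times the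
  Hessian norm over mu_0, and the strip costs M sigma. Equality of the two makes sigma the power
  2/(N+2) of the Hessian norm over M mu_0, which explains both exponents in the theorem.\<close>

lemma frechet_eq_grad:
  assumes "f differentiable (at x)"
  shows "(f has_derivative (\<lambda>v. grad f x \<bullet> v)) (at x)"
proof -
  have d: "(f has_derivative frechet_derivative f (at x)) (at x)"
    using assms frechet_derivative_works by blast
  then have lin: "linear (frechet_derivative f (at x))"
    by (rule has_derivative_linear)
  have "frechet_derivative f (at x) v = grad f x \<bullet> v" for v
  proof -
    have "v = (\<Sum>i\<in>UNIV. v $ i *\<^sub>R axis i 1)"
      by (simp add: vec_eq_iff axis_def if_distrib cong: if_cong)
    then have "frechet_derivative f (at x) v = frechet_derivative f (at x) (\<Sum>i\<in>UNIV. v $ i *\<^sub>R axis i 1)"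
      by metis
    also have "\<dots> = (\<Sum>i\<in>UNIV. v $ i * frechet_derivative f (at x) (axis i 1))"
      by (simp add: linear_sum[OF lin] linear_scale[OF lin])
    finally show ?thesis by (simp add: grad_def inner_vec_def mult.commute)
  qed
  then have "frechet_derivative f (at x) = (\<lambda>v. grad f x \<bullet> v)" by auto
  with d show ?thesis by simp
qed

lemma grad_unique:
  assumes "(f has_derivative (\<lambda>v. w \<bullet> v)) (at x)"
  shows "grad f x = w"
  unfolding grad_def frechet_derivative_at[OF assms, symmetric]
  by (simp add: vec_eq_iff inner_axis)

text \<open>Gradient and Hessian are explicit arguments, so that calculus rules compute them instead
  of evaluating \<open>frechet_derivative\<close>. \<open>H x\<close> is the Jacobian of
  \<open>F\<close>, hence the transpose of \<open>hess f x\<close>.\<close>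

definition has_C2 :: "(real^'n \<Rightarrow> real) \<Rightarrow> (real^'n \<Rightarrow> real^'n) \<Rightarrow> (real^'n \<Rightarrow> real^'n^'n) \<Rightarrow> (real^'n) set \<Rightarrow> bool"
  where "has_C2 f F H S \<longleftrightarrow> open S \<and> (\<forall>x\<in>S. (f has_derivative (\<lambda>v. F x \<bullet> v)) (at x)) \<and>
     (\<forall>x\<in>S. (F has_derivative (\<lambda>v. H x *v v)) (at x)) \<and> continuous_on S H"

lemma has_derivative_matvec:
  fixes F :: "real^'n \<Rightarrow> real^'n"
  shows "(F has_derivative (\<lambda>v. H *v v)) (at x) \<longleftrightarrow>
    (\<forall>j. ((\<lambda>y. F y $ j) has_derivative (\<lambda>v. H $ j \<bullet> v)) (at x))"
proof
  assume "(F has_derivative (\<lambda>v. H *v v)) (at x)"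
  then show "\<forall>j. ((\<lambda>y. F y $ j) has_derivative (\<lambda>v. H $ j \<bullet> v)) (at x)"
    using bounded_linear.has_derivative[OF bounded_linear_vec_nth, of F "\<lambda>v. H *v v"]
    by (simp add: matrix_vector_mult_def inner_vec_def)
next
  assume a: "\<forall>j. ((\<lambda>y. F y $ j) has_derivative (\<lambda>v. H $ j \<bullet> v)) (at x)"
  have "((\<lambda>y. F y \<bullet> b) has_derivative (\<lambda>v. (H *v v) \<bullet> b)) (at x)" if bB: "b \<in> Basis" for b
  proof -
    obtain j where b: "b = axis j (1::real)" using bB by (auto simp: Basis_vec_def)
    have "(H *v v) $ j = H $ j \<bullet> v" for v by (simp add: matrix_vector_mult_def inner_vec_def)
    then show ?thesis using a by (simp add: b inner_axis)
  qed
  then show "(F has_derivative (\<lambda>v. H *v v)) (at x)"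
    by (subst has_derivative_componentwise_within) auto
qed

lemma C2_on_has_C2:
  assumes "open S" "C2_on S f"
  shows "has_C2 f (grad f) (\<lambda>x. \<chi> i j. hess f x $ j $ i) S"
  unfolding has_C2_def
proof (intro conjI ballI)
  show "open S" by fact
  fix x assume x: "x \<in> S"
  show "(f has_derivative (\<lambda>v. grad f x \<bullet> v)) (at x)"
    using assms x frechet_eq_grad unfolding C2_on_def by blast
  have "((\<lambda>y. grad f y $ j) has_derivative (\<lambda>v. grad (\<lambda>y. grad f y $ j) x \<bullet> v)) (at x)" for j
    using assms x frechet_eq_grad unfolding C2_on_def by blast
  moreover have "(\<chi> i j. hess f x $ j $ i) $ j = grad (\<lambda>y. grad f y $ j) x" for j
    by (simp add: hess_def grad_def vec_eq_iff)
  ultimately show "(grad f has_derivative (\<lambda>v. (\<chi> i j. hess f x $ j $ i) *v v)) (at x)"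
    by (subst has_derivative_matvec) simp
next
  have "continuous_on S (hess f)" using assms unfolding C2_on_def by blast
  then show "continuous_on S (\<lambda>x. \<chi> i j. hess f x $ j $ i)"
    by (intro continuous_intros)
qed

lemma has_C2_grad: "has_C2 f F H S \<Longrightarrow> x \<in> S \<Longrightarrow> grad f x = F x"
  unfolding has_C2_def by (auto intro: grad_unique)

lemma has_C2_hess: "has_C2 f F H S \<Longrightarrow> x \<in> S \<Longrightarrow> hess f x $ i $ j = H x $ j $ i"
proof -
  assume a: "has_C2 f F H S" and x: "x \<in> S"
  have "((\<lambda>y. F y $ j) has_derivative (\<lambda>v. H x $ j \<bullet> v)) (at x)"
    using a x unfolding has_C2_def has_derivative_matvec by auto
  then have "((\<lambda>y. grad f y $ j) has_derivative (\<lambda>v. H x $ j \<bullet> v)) (at x)"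
    using a has_C2_grad[OF a]
    by (rule_tac has_derivative_transform_within_open[of _ _ _ _ S]) (auto simp: has_C2_def x)
  from grad_unique[OF this] show ?thesis
    by (simp add: hess_def grad_def vec_eq_iff)
qed

lemma has_C2_lap: "has_C2 f F H S \<Longrightarrow> x \<in> S \<Longrightarrow> lap f x = trace (H x)"
  by (simp add: lap_def trace_def has_C2_hess)

lemma norm_matrix_sq: "(norm (A::real^'n^'m))\<^sup>2 = (\<Sum>i\<in>UNIV. \<Sum>j\<in>UNIV. (A $ i $ j)\<^sup>2)"
  unfolding power2_norm_eq_inner inner_vec_def by (simp add: power2_eq_square)

lemma has_C2_hess_sq: "has_C2 f F H S \<Longrightarrow> x \<in> S \<Longrightarrow> hess_sq f x = (norm (H x))\<^sup>2"
  unfolding hess_sq_def norm_matrix_sq by (subst sum.swap) (simp add: has_C2_hess)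

lemma has_C2_C2_on:
  assumes a: "has_C2 f F H S"
  shows "C2_on S f"
  unfolding C2_on_def
proof (intro conjI ballI allI)
  have o: "open S" using a by (simp add: has_C2_def)
  fix x assume x: "x \<in> S"
  show "f differentiable (at x)"
    using a x unfolding has_C2_def differentiable_def by blast
  fix j
  have "((\<lambda>y. F y $ j) has_derivative (\<lambda>v. H x $ j \<bullet> v)) (at x)"
    using a x unfolding has_C2_def has_derivative_matvec by auto
  then have "((\<lambda>y. grad f y $ j) has_derivative (\<lambda>v. H x $ j \<bullet> v)) (at x)"
    using has_C2_grad[OF a] o
    by (rule_tac has_derivative_transform_within_open[of _ _ _ _ S]) (auto simp: x)
  then show "(\<lambda>y. grad f y $ j) differentiable (at x)"
    unfolding differentiable_def by blast
next
  have "continuous_on S (\<lambda>x. \<chi> i j. H x $ j $ i)"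
    using a unfolding has_C2_def by (intro continuous_intros) auto
  then show "continuous_on S (hess f)"
    by (rule continuous_on_eq) (simp add: vec_eq_iff has_C2_hess[OF a])
qed

lemma has_C2_mono: "has_C2 f F H S \<Longrightarrow> T \<subseteq> S \<Longrightarrow> open T \<Longrightarrow> has_C2 f F H T"
  unfolding has_C2_def by (auto intro: continuous_on_subset)

lemma has_C2_continuous: "has_C2 f F H S \<Longrightarrow> continuous_on S f"
  unfolding has_C2_def by (meson differentiable_def differentiable_imp_continuous_on differentiable_on_def has_derivative_at_withinI)

lemma has_C2_continuous_grad: "has_C2 f F H S \<Longrightarrow> continuous_on S F"
  unfolding has_C2_def by (meson differentiable_def differentiable_imp_continuous_on differentiable_on_def has_derivative_at_withinI)

lemma has_C2_add:
  assumes "has_C2 f F H S" "has_C2 g G K S"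
  shows "has_C2 (\<lambda>x. f x + g x) (\<lambda>x. F x + G x) (\<lambda>x. H x + K x) S"
  using assms unfolding has_C2_def
  by (auto intro!: derivative_eq_intros continuous_intros simp: inner_add_left matrix_vector_mult_add_rdistrib)

lemma has_C2_cmult:
  assumes "has_C2 f F H S"
  shows "has_C2 (\<lambda>x. c * f x) (\<lambda>x. c *\<^sub>R F x) (\<lambda>x. c *\<^sub>R H x) S"
  using assms unfolding has_C2_def
  by (auto intro!: derivative_eq_intros continuous_intros simp: scaleR_matrix_vector_assoc)

lemma has_C2_minus:
  assumes "has_C2 f F H S"
  shows "has_C2 (\<lambda>x. - f x) (\<lambda>x. - F x) (\<lambda>x. - H x) S"
  using has_C2_cmult[OF assms, of "-1"] by simp

lemma has_C2_diff:
  assumes "has_C2 f F H S" "has_C2 g G K S"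
  shows "has_C2 (\<lambda>x. f x - g x) (\<lambda>x. F x - G x) (\<lambda>x. H x - K x) S"
  using has_C2_add[OF assms(1) has_C2_minus[OF assms(2)]] by simp

lemma has_C2_affine: "open S \<Longrightarrow> has_C2 (\<lambda>x. c + w \<bullet> x) (\<lambda>x. w) (\<lambda>x. 0) S"
  unfolding has_C2_def by (auto intro!: derivative_eq_intros)

lemma has_C2_const: "open S \<Longrightarrow> has_C2 (\<lambda>x. c) (\<lambda>x. 0) (\<lambda>x. 0) S"
  using has_C2_affine[of S c 0] by simp

lemma has_C2_quadratic: "open S \<Longrightarrow> has_C2 (\<lambda>x. (dist x p)\<^sup>2 / 2) (\<lambda>x. x - p) (\<lambda>x. mat 1) S"
  unfolding has_C2_def dist_norm power2_norm_eq_inner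
  by (auto intro!: derivative_eq_intros simp: inner_commute algebra_simps fun_eq_iff diff_divide_distrib)

lemma has_C2_shift:
  assumes "has_C2 f F H S"
  shows "has_C2 (\<lambda>x. f (x + a)) (\<lambda>x. F (x + a)) (\<lambda>x. H (x + a)) ((\<lambda>x. x + a) -` S)"
proof -
  have o: "open S" using assms by (simp add: has_C2_def)
  have o': "open ((\<lambda>x. x + a) -` S)"
    by (intro open_vimage o continuous_intros)
  have d: "((\<lambda>y. y + a) has_derivative (\<lambda>v. v)) (at x)" for x
    by (auto intro!: derivative_eq_intros)
  have c: "continuous_on ((\<lambda>x. x + a) -` S) (\<lambda>x. H (x + a))"
    using assms unfolding has_C2_def
    by (auto intro!: continuous_on_compose2[of S H] continuous_intros)
  have "((\<lambda>x. f (x + a)) has_derivative (\<bullet>) (F (x + a))) (at x)"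
    and "((\<lambda>x. F (x + a)) has_derivative (*v) (H (x + a))) (at x)" if "x + a \<in> S" for x
    using assms that unfolding has_C2_def
    by (auto intro!: has_derivative_compose[OF d, of f] has_derivative_compose[OF d, of F])
  with o' c show ?thesis unfolding has_C2_def by auto
qed

lemma trace_simps [simp]:
  "trace (A + B) = trace A + trace (B::real^'n^'n)"
  "trace (A - B) = trace A - trace (B::real^'n^'n)"
  "trace (- A) = - trace (A::real^'n^'n)"
  "trace (c *\<^sub>R A) = c * trace (A::real^'n^'n)"
  "trace (0::real^'n^'n) = 0" "trace (mat 1 :: real^'n^'n) = CARD('n)"
  by (simp_all add: trace_def sum.distrib sum_subtractf sum_negf sum_distrib_left mat_def)

section \<open>Symmetry of second derivatives\<close>

text \<open>Two mean value theorems: one along \<open>a\<close> for the increment of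
  \<open>f\<close> in direction \<open>b\<close>, one along \<open>b\<close> for the component of
  the gradient along \<open>a\<close>.\<close>

lemma has_C2_double_difference:
  assumes C2: "has_C2 f F H S" and sub: "\<And>s t. 0 \<le> s \<Longrightarrow> s \<le> \<epsilon> \<Longrightarrow> 0 \<le> t \<Longrightarrow> t \<le> \<epsilon> \<Longrightarrow> x + s *\<^sub>R a + t *\<^sub>R b \<in> S"
    and e: "\<epsilon> > 0"
  shows "\<exists>s t. 0 < s \<and> s < \<epsilon> \<and> 0 < t \<and> t < \<epsilon> \<and>
     f (x + \<epsilon> *\<^sub>R a + \<epsilon> *\<^sub>R b) - f (x + \<epsilon> *\<^sub>R a) - f (x + \<epsilon> *\<^sub>R b) + f x
       = \<epsilon>\<^sup>2 * ((H (x + s *\<^sub>R a + t *\<^sub>R b) *v b) \<bullet> a)"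
proof -
  define \<phi> where "\<phi> s = f (x + s *\<^sub>R a + \<epsilon> *\<^sub>R b) - f (x + s *\<^sub>R a)" for s
  have d: "(f has_derivative (\<lambda>v. F y \<bullet> v)) (at y)" if "y \<in> S" for y
    using C2 that unfolding has_C2_def by auto
  have d2: "(F has_derivative (\<lambda>v. H y *v v)) (at y)" if "y \<in> S" for y
    using C2 that unfolding has_C2_def by auto
  have "(\<phi> has_derivative (\<lambda>r. r * ((F (x + s *\<^sub>R a + \<epsilon> *\<^sub>R b) - F (x + s *\<^sub>R a)) \<bullet> a))) (at s)"
    if "0 \<le> s" "s \<le> \<epsilon>" for s
  proof -
    have 1: "((\<lambda>s. x + s *\<^sub>R a + \<epsilon> *\<^sub>R b) has_derivative (\<lambda>r. r *\<^sub>R a)) (at s)"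
      and 2: "((\<lambda>s. x + s *\<^sub>R a) has_derivative (\<lambda>r. r *\<^sub>R a)) (at s)"
      by (auto intro!: derivative_eq_intros)
    show ?thesis unfolding \<phi>_def
      using has_derivative_diff[OF has_derivative_compose[OF 1 d] has_derivative_compose[OF 2 d]]
        sub[of s \<epsilon>] sub[of s 0] that e
      by (auto simp: inner_diff_left algebra_simps)
  qed
  then have "\<exists>s\<in>{0<..<\<epsilon>}. \<phi> \<epsilon> - \<phi> 0 = (\<epsilon> - 0) * ((F (x + s *\<^sub>R a + \<epsilon> *\<^sub>R b) - F (x + s *\<^sub>R a)) \<bullet> a)"
    by (intro mvt_simple e) (auto intro: has_derivative_at_withinI)
  then obtain s where s: "0 < s" "s < \<epsilon>" and 1: "\<phi> \<epsilon> - \<phi> 0 = \<epsilon> * ((F (x + s *\<^sub>R a + \<epsilon> *\<^sub>R b) - F (x + s *\<^sub>R a)) \<bullet> a)"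
    by auto
  define \<psi> where "\<psi> t = F (x + s *\<^sub>R a + t *\<^sub>R b) \<bullet> a" for t
  have "(\<psi> has_derivative (\<lambda>r. r * ((H (x + s *\<^sub>R a + t *\<^sub>R b) *v b) \<bullet> a))) (at t)"
    if "0 \<le> t" "t \<le> \<epsilon>" for t
  proof -
    have 1: "((\<lambda>t. x + s *\<^sub>R a + t *\<^sub>R b) has_derivative (\<lambda>r. r *\<^sub>R b)) (at t)"
      by (auto intro!: derivative_eq_intros)
    show ?thesis unfolding \<psi>_def
      using has_derivative_inner_left[OF has_derivative_compose[OF 1 d2], of a] sub[of s t] that s
      by (auto simp: matrix_vector_mult_scaleR)
  qed
  then have "\<exists>t\<in>{0<..<\<epsilon>}. \<psi> \<epsilon> - \<psi> 0 = (\<epsilon> - 0) * ((H (x + s *\<^sub>R a + t *\<^sub>R b) *v b) \<bullet> a)"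
    by (intro mvt_simple e) (auto intro: has_derivative_at_withinI)
  then obtain t where t: "0 < t" "t < \<epsilon>" and 2: "\<psi> \<epsilon> - \<psi> 0 = \<epsilon> * ((H (x + s *\<^sub>R a + t *\<^sub>R b) *v b) \<bullet> a)"
    by auto
  show ?thesis
    using s t 1 2 by (intro exI[of _ s] exI[of _ t])
      (auto simp: \<phi>_def \<psi>_def inner_diff_left power2_eq_square algebra_simps)
qed

text \<open>The second difference over a parallelogram does not depend on the order of its sides, so
  the two mixed derivatives agree at points arbitrarily near \<open>x\<close>; continuity of
  \<open>H\<close> brings this to \<open>x\<close> itself.\<close>

lemma has_C2_symmetric:
  assumes C2: "has_C2 f F H S" and x: "x \<in> S"
  shows "(H x *v b) \<bullet> a = (H x *v a) \<bullet> b"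
proof (rule ccontr)
  define K where "K c d y = (H y *v c) \<bullet> d" for c d y
  have cont: "isCont (K c d) x" for c d
  proof -
    have "continuous_on S H" "open S" using C2 by (auto simp: has_C2_def)
    then have "isCont H x" using x by (simp add: continuous_on_eq_continuous_at)
    moreover have "K c d = (\<lambda>y. \<Sum>i\<in>UNIV. (\<Sum>j\<in>UNIV. H y $ i $ j * c $ j) * d $ i)"
      by (simp add: K_def fun_eq_iff matrix_vector_mult_def inner_vec_def)
    ultimately show ?thesis by (auto intro!: continuous_intros)
  qed
  assume "(H x *v b) \<bullet> a \<noteq> (H x *v a) \<bullet> b"
  then have "\<bar>K b a x - K a b x\<bar> / 2 > 0" by (simp add: K_def)
  then obtain r1 r2 where r: "r1 > 0" "\<And>y. dist y x < r1 \<Longrightarrow> \<bar>K b a y - K b a x\<bar> < \<bar>K b a x - K a b x\<bar> / 2"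
     "r2 > 0" "\<And>y. dist y x < r2 \<Longrightarrow> \<bar>K a b y - K a b x\<bar> < \<bar>K b a x - K a b x\<bar> / 2"
    using cont[of b a] cont[of a b] unfolding continuous_at_eps_delta dist_real_def by metis
  obtain r3 where r3: "r3 > 0" "ball x r3 \<subseteq> S"
    using C2 x unfolding has_C2_def open_contains_ball by blast
  define r where "r = min r1 (min r2 r3)"
  \<comment> \<open>Keeps the whole parallelogram within r/2 of \<open>x\<close>; the summand 1
    covers the case that both vectors vanish.\<close>
  define \<epsilon> where "\<epsilon> = r / (2 * (norm a + norm b + 1))"
  have rp: "r > 0" using r r3 by (simp add: r_def)
  then have e: "\<epsilon> > 0" unfolding \<epsilon>_def by (intro divide_pos_pos) (auto intro: add_nonneg_pos)
  have ball: "dist (x + s *\<^sub>R a + t *\<^sub>R b) x < r" if "0 \<le> s" "s \<le> \<epsilon>" "0 \<le> t" "t \<le> \<epsilon>" for s t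
  proof -
    have "dist (x + s *\<^sub>R a + t *\<^sub>R b) x = norm (s *\<^sub>R a + t *\<^sub>R b)" by (simp add: dist_norm)
    also have "\<dots> \<le> s * norm a + t * norm b" using that by (metis abs_of_nonneg norm_scaleR norm_triangle_ineq)
    also have "\<dots> \<le> \<epsilon> * norm a + \<epsilon> * norm b" using that by (intro add_mono mult_right_mono) auto
    also have "\<dots> \<le> \<epsilon> * (norm a + norm b + 1)" using e by (simp add: algebra_simps)
    also have "\<dots> = r / 2" unfolding \<epsilon>_def
      using norm_ge_zero[of a] norm_ge_zero[of b] by (simp add: field_simps add_nonneg_eq_0_iff)
    finally show ?thesis using rp by simp
  qed
  then have sub: "x + s *\<^sub>R a + t *\<^sub>R b \<in> S" if "0 \<le> s" "s \<le> \<epsilon>" "0 \<le> t" "t \<le> \<epsilon>" for s t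
    using r3(2) that by (force simp: r_def dist_commute)
  obtain s t where 1: "0 < s" "s < \<epsilon>" "0 < t" "t < \<epsilon>"
     "f (x + \<epsilon> *\<^sub>R a + \<epsilon> *\<^sub>R b) - f (x + \<epsilon> *\<^sub>R a) - f (x + \<epsilon> *\<^sub>R b) + f x
       = \<epsilon>\<^sup>2 * K b a (x + s *\<^sub>R a + t *\<^sub>R b)"
    using has_C2_double_difference[OF C2 sub e] unfolding K_def by blast
  have sub': "x + s *\<^sub>R b + t *\<^sub>R a \<in> S" if "0 \<le> s" "s \<le> \<epsilon>" "0 \<le> t" "t \<le> \<epsilon>" for s t
    using sub[of t s] that by (simp add: algebra_simps)
  obtain s' t' where 2: "0 < s'" "s' < \<epsilon>" "0 < t'" "t' < \<epsilon>"
     "f (x + \<epsilon> *\<^sub>R b + \<epsilon> *\<^sub>R a) - f (x + \<epsilon> *\<^sub>R b) - f (x + \<epsilon> *\<^sub>R a) + f x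
       = \<epsilon>\<^sup>2 * K a b (x + s' *\<^sub>R b + t' *\<^sub>R a)"
    using has_C2_double_difference[OF C2 sub' e] unfolding K_def by blast
  have "\<epsilon>\<^sup>2 * K b a (x + s *\<^sub>R a + t *\<^sub>R b) = \<epsilon>\<^sup>2 * K a b (x + s' *\<^sub>R b + t' *\<^sub>R a)"
    using 1(5) 2(5) by (simp add: algebra_simps)
  then have eq: "K b a (x + s *\<^sub>R a + t *\<^sub>R b) = K a b (x + t' *\<^sub>R a + s' *\<^sub>R b)"
    using e by (simp add: algebra_simps)
  have "\<bar>K b a (x + s *\<^sub>R a + t *\<^sub>R b) - K b a x\<bar> < \<bar>K b a x - K a b x\<bar> / 2"
    using ball[of s t] 1 by (intro r) (auto simp: r_def)
  moreover have "\<bar>K a b (x + t' *\<^sub>R a + s' *\<^sub>R b) - K a b x\<bar> < \<bar>K b a x - K a b x\<bar> / 2"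
    using ball[of t' s'] 2 by (intro r) (auto simp: r_def)
  ultimately show False using eq by (smt (verit) field_sum_of_halves)
qed

section \<open>Integrals against compactly supported kernels\<close>

text \<open>Differentiation and continuity under the integral are applied to integrals over boxes;
  this is a box containing the ball of radius \<open>R\<close>.\<close>

abbreviation sbox :: "real \<Rightarrow> 'a::euclidean_space set" where
  "sbox R \<equiv> cbox (- (R *\<^sub>R One)) (R *\<^sub>R One)"

lemma mem_sbox: "x \<in> sbox R" if "norm x \<le> R"
proof -
  have "\<bar>x \<bullet> b\<bar> \<le> R" if "b \<in> Basis" for b
    using Basis_le_norm[OF that, of x] \<open>norm x \<le> R\<close> by linarith
  then show ?thesis by (auto simp: mem_box abs_le_iff) (metis minus_le_iff)
qed

lemma compact_support_integral:
  fixes f :: "'a::euclidean_space \<Rightarrow> 'b::euclidean_space"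
  assumes c: "continuous_on UNIV f" and z: "\<And>x. norm x > R \<Longrightarrow> f x = 0"
  shows "integrable lborel f" "integral (sbox R) f = integral\<^sup>L lborel f"
proof -
  have "integrable lborel (\<lambda>x. indicator (cball 0 R) x *\<^sub>R f x)"
    by (intro borel_integrable_compact) (auto intro: continuous_on_subset[OF c])
  moreover have "(\<lambda>x. indicator (cball 0 R) x *\<^sub>R f x) = f"
    using z by (auto simp: fun_eq_iff indicator_def)
  ultimately show i: "integrable lborel f" by simp
  have "integral (sbox R) f = integral UNIV (\<lambda>x. if x \<in> sbox R then f x else 0)"
    by (rule Henstock_Kurzweil_Integration.integral_restrict_UNIV [symmetric])
  also have "(\<lambda>x. if x \<in> sbox R then f x else 0) = f"
  proof
    fix x
    show "(if x \<in> sbox R then f x else 0) = f x"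
      using z[of x] mem_sbox[of x R] by (cases "norm x \<le> R") auto
  qed
  finally show "integral (sbox R) f = integral\<^sup>L lborel f"
    using has_integral_integral_lborel[OF i] by (simp add: integral_unique)
qed

text \<open>Vanishing also on the unit sphere, so that the product with a function known only on the
  closed unit ball is continuous on the whole space.\<close>

definition kernel :: "('a::euclidean_space \<Rightarrow> real) \<Rightarrow> bool" where
  "kernel k \<longleftrightarrow> continuous_on UNIV k \<and> (\<forall>x. norm x \<ge> 1 \<longrightarrow> k x = 0)"

text \<open>The product and the zero function are pasted along the sphere, where both vanish.
  Outside the closed ball the values of \<open>g\<close> are irrelevant because they are multiplied
  by 0.\<close>

lemma continuous_on_kernel_times:
  fixes g :: "'p::topological_space \<times> 'a::euclidean_space \<Rightarrow> 'b::real_normed_vector"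
  assumes k: "kernel k" and g: "continuous_on (U \<times> cball 0 1) g"
  shows "continuous_on (U \<times> UNIV) (\<lambda>p. k (snd p) *\<^sub>R g p)"
proof -
  let ?S = "U \<times> cball (0::'a) 1" and ?T = "U \<times> {x::'a. norm x \<ge> 1}"
  have un: "U \<times> UNIV = ?S \<union> ?T" by auto
  have cl: "closedin (top_of_set (U \<times> UNIV)) (U \<times> C)" if "closed C" for C :: "'a set"
    using closedin_closed_Int[of "snd -` C" "U \<times> UNIV"] that
    by (auto simp: closed_vimage_snd vimage_snd Times_Int_Times closed_Times)
  have cl1: "closed {x::'a. norm x \<ge> 1}" by (intro closed_Collect_le continuous_intros)
  have ck: "continuous_on A k" for A
    using k continuous_on_subset unfolding kernel_def by blast
  have "continuous_on (?S \<union> ?T) (\<lambda>p. if norm (snd p) \<le> 1 then k (snd p) *\<^sub>R g p else 0)"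
  proof (rule continuous_on_cases_local)
    show "closedin (top_of_set (?S \<union> ?T)) ?S" "closedin (top_of_set (?S \<union> ?T)) ?T"
      unfolding un[symmetric] by (intro cl closed_cball cl1)+
    show "continuous_on ?S (\<lambda>p. k (snd p) *\<^sub>R g p)"
      by (intro continuous_intros g continuous_on_compose2[OF ck[of UNIV]]) auto
    show "continuous_on ?T (\<lambda>p. 0)" by simp
  qed (use k in \<open>auto simp: kernel_def\<close>)
  moreover have "(\<lambda>p. if norm (snd p) \<le> 1 then k (snd p) *\<^sub>R g p else 0) = (\<lambda>p. k (snd p) *\<^sub>R g p)"
    using k by (auto simp: fun_eq_iff kernel_def)
  ultimately show ?thesis by (simp only: un)
qed

lemma continuous_on_kernel_times1:
  fixes g :: "'a::euclidean_space \<Rightarrow> 'b::real_normed_vector"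
  assumes k: "kernel k" and g: "continuous_on (cball 0 1) g"
  shows "continuous_on UNIV (\<lambda>x. k x *\<^sub>R g x)"
proof -
  have "continuous_on ({0::real} \<times> UNIV) (\<lambda>p. k (snd p) *\<^sub>R g (snd p))"
    by (intro continuous_on_kernel_times[OF k] continuous_on_compose2[OF g] continuous_intros) auto
  then have "continuous_on UNIV ((\<lambda>p. k (snd p) *\<^sub>R g (snd p)) \<circ> Pair (0::real))"
    by (rule continuous_on_compose[OF continuous_on_Pair[OF continuous_on_const continuous_on_id]
          continuous_on_subset]) auto
  then show ?thesis by (simp add: o_def)
qed

lemma kernel_integrable:
  fixes g :: "'a::euclidean_space \<Rightarrow> 'b::euclidean_space"
  assumes k: "kernel k" and g: "continuous_on (cball 0 1) g"
  shows "integrable lborel (\<lambda>x. k x *\<^sub>R g x)"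
    "integral (sbox 1) (\<lambda>x. k x *\<^sub>R g x) = (LINT x|lborel. k x *\<^sub>R g x)"
  using compact_support_integral[OF continuous_on_kernel_times1[OF assms], of 1] k
  unfolding kernel_def by auto

lemma continuous_on_kernel_integral:
  fixes g :: "'p::topological_space \<Rightarrow> 'a::euclidean_space \<Rightarrow> 'b::euclidean_space"
  assumes k: "kernel k" and g: "continuous_on (U \<times> cball 0 1) (\<lambda>(p, x). g p x)"
  shows "continuous_on U (\<lambda>p. LINT x|lborel. k x *\<^sub>R g p x)"
proof -
  have c1: "continuous_on (cball 0 1) (g p)" if "p \<in> U" for p
  proof -
    have "continuous_on (cball 0 1) (\<lambda>x. (\<lambda>(p, x). g p x) (p, x))"
      by (rule continuous_on_compose2[OF g continuous_on_Pair[OF continuous_on_const continuous_on_id]])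
        (use that in auto)
    then show ?thesis by simp
  qed
  have eq: "(LINT x|lborel. k x *\<^sub>R g p x) = integral (sbox 1) (\<lambda>x. k x *\<^sub>R g p x)" if "p \<in> U" for p
    by (rule kernel_integrable(2)[OF k c1[OF that], symmetric])
  have "continuous_on U (\<lambda>p. integral (sbox 1) (\<lambda>x. k x *\<^sub>R g p x))"
  proof (rule integral_continuous_on_param)
    have "continuous_on (U \<times> sbox 1) (\<lambda>p. k (snd p) *\<^sub>R (case p of (p, x) \<Rightarrow> g p x))"
      by (rule continuous_on_subset[OF continuous_on_kernel_times[OF k g]]) auto
    then show "continuous_on (U \<times> sbox 1) (\<lambda>(p, x). k x *\<^sub>R g p x)"
      by (simp add: case_prod_beta)
  qed
  then show ?thesis by (rule continuous_on_eq) (simp add: eq)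
qed

text \<open>Leibniz rule on the box, carried over to \<open>lborel\<close>. Derivatives are taken
  within a convex set so that the same lemma serves a closed interval of radii and a ball of
  centres.\<close>

lemma kernel_integral_derivative:
  fixes g :: "'p::euclidean_space \<Rightarrow> 'a::euclidean_space \<Rightarrow> real"
  assumes k: "kernel k"
    and d: "\<And>p x. p \<in> U \<Longrightarrow> norm x \<le> 1 \<Longrightarrow> ((\<lambda>p. g p x) has_derivative (\<lambda>v. D p x \<bullet> v)) (at p within U)"
    and g: "\<And>p. p \<in> U \<Longrightarrow> continuous_on (cball 0 1) (g p)"
    and D: "continuous_on (U \<times> cball 0 1) (\<lambda>(p, x). D p x)"
    and U: "convex U" "p0 \<in> U"
  shows "((\<lambda>p. LINT x|lborel. k x * g p x) has_derivative
           (\<lambda>v. (LINT x|lborel. k x *\<^sub>R D p0 x) \<bullet> v)) (at p0 within U)"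
proof -
  let ?fx = "\<lambda>p x. blinfun_inner_right (k x *\<^sub>R D p x)"
  have c: "continuous_on (U \<times> UNIV) (\<lambda>(p, x). k x *\<^sub>R D p x)"
    using continuous_on_kernel_times[OF k D] by (simp add: case_prod_beta)
  have "((\<lambda>p. integral (sbox 1) (\<lambda>x. k x * g p x)) has_derivative
      blinfun_apply (integral (sbox 1) (?fx p0))) (at p0 within U)"
  proof (rule leibniz_rule[OF _ _ _ U(2) U(1)])
    fix p and x :: 'a assume p: "p \<in> U"
    show "((\<lambda>p. k x * g p x) has_derivative blinfun_apply (?fx p x)) (at p within U)"
    proof (cases "norm x \<le> 1")
      case True
      have "blinfun_apply (?fx p x) = (\<lambda>v. k x * (D p x \<bullet> v))" by auto
      then show ?thesis using has_derivative_mult_right[OF d[OF p True], of "k x"] by simp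
    next
      case False
      then have "k x = 0" using k by (simp add: kernel_def)
      then have "blinfun_apply (?fx p x) = (\<lambda>v. 0)" by auto
      with \<open>k x = 0\<close> show ?thesis by simp
    qed
  next
    fix p assume "p \<in> U"
    then show "(\<lambda>x. k x * g p x) integrable_on sbox 1"
      using continuous_on_kernel_times1[OF k g[of p]]
      by (auto intro!: integrable_continuous elim: continuous_on_subset)
  next
    show "continuous_on (U \<times> sbox 1) (\<lambda>(p, x). ?fx p x)"
    proof -
      have "continuous_on (U \<times> sbox 1) (\<lambda>p. blinfun_inner_right (case p of (p, x) \<Rightarrow> k x *\<^sub>R D p x))"
        by (rule bounded_linear.continuous_on[OF bounded_linear_blinfun_inner_right continuous_on_subset[OF c]]) auto
      then show ?thesis by (simp add: case_prod_beta)
    qed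
  qed
  moreover have cD: "continuous_on (cball 0 1) (D p0)"
  proof -
    have "continuous_on (cball 0 1) (\<lambda>x. (\<lambda>(p, x). D p x) (p0, x))"
      by (rule continuous_on_compose2[OF D continuous_on_Pair[OF continuous_on_const continuous_on_id]])
        (use U in auto)
    then show ?thesis by simp
  qed
  moreover have "integral (sbox 1) (?fx p0) = blinfun_inner_right (integral (sbox 1) (\<lambda>x. k x *\<^sub>R D p0 x))"
    using integral_linear[OF integrable_continuous bounded_linear_blinfun_inner_right]
      continuous_on_subset[OF continuous_on_kernel_times1[OF k cD]]
    by (fastforce simp: o_def)
  moreover have "(LINT x|lborel. k x * g p x) = integral (sbox 1) (\<lambda>x. k x * g p x)" if "p \<in> U" for p
    using kernel_integrable(2)[OF k g[OF that]] by simp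
  ultimately show ?thesis
    using kernel_integrable(2)[OF k cD] U(2)
    by (auto intro: has_derivative_transform)
qed

section \<open>Integration by parts and scaling\<close>

text \<open>By translation invariance the integral of F(x + t v) does not depend on
  \<open>t\<close>; differentiating at t = 0 under the integral gives the integral of the
  directional derivative.\<close>

lemma integral_partial_zero:
  fixes F :: "'a::euclidean_space \<Rightarrow> real"
  assumes d: "\<And>x. (F has_derivative (\<lambda>v. G x \<bullet> v)) (at x)" and c: "continuous_on UNIV G"
    and z: "\<And>x. norm x \<ge> 1 \<Longrightarrow> F x = 0"
  shows "(LINT x|lborel. G x \<bullet> v) = 0"
proof -
  \<comment> \<open>Shifts by at most this multiple of \<open>v\<close> have length at most 1, so
    every translate is supported in the ball of radius 2.\<close>
  define \<delta> where "\<delta> = 1 / (norm v + 1)"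
  have dp: "\<delta> > 0" by (simp add: \<delta>_def add_nonneg_pos)
  have dv: "\<delta> * norm v \<le> 1" by (simp add: \<delta>_def divide_le_eq add_nonneg_pos)
  let ?U = "{-\<delta>..\<delta>}"
  have cF: "continuous_on UNIV F"
    using d by (metis differentiable_def differentiable_imp_continuous_on differentiable_on_def has_derivative_at_withinI)
  have cs: "continuous_on UNIV (\<lambda>x. F (x + t *\<^sub>R v))" for t
    by (intro continuous_on_compose2[OF cF] continuous_intros) auto
  have zs: "F (x + t *\<^sub>R v) = 0" if "t \<in> ?U" "norm x > 2" for t x
  proof (rule z)
    have "norm (t *\<^sub>R v) \<le> \<delta> * norm v" using that by (auto intro: mult_right_mono)
    then have "norm (t *\<^sub>R v) \<le> 1" using dv by linarith
    moreover have "norm x \<le> norm (x + t *\<^sub>R v) + norm (t *\<^sub>R v)"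
      by (metis add_diff_cancel_right' norm_triangle_ineq4)
    ultimately show "norm (x + t *\<^sub>R v) \<ge> 1" using that by linarith
  qed
  have A: "((\<lambda>t. integral (sbox 2) (\<lambda>x. F (x + t *\<^sub>R v))) has_field_derivative
      integral (sbox 2) (\<lambda>x. G x \<bullet> v)) (at 0 within ?U)"
  proof (rule leibniz_rule_field_derivative[where fx = "\<lambda>t x. G (x + t *\<^sub>R v) \<bullet> v" and ?x0.0 = "0::real" and U = ?U, unfolded scaleR_zero_left add_0_right])
    fix t x
    have 1: "((\<lambda>t. x + t *\<^sub>R v) has_derivative (\<lambda>r. r *\<^sub>R v)) (at t within ?U)"
      by (auto intro!: derivative_eq_intros)
    moreover have "(\<lambda>r. G (x + t *\<^sub>R v) \<bullet> (r *\<^sub>R v)) = (*) (G (x + t *\<^sub>R v) \<bullet> v)"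
      by (auto simp: fun_eq_iff)
    ultimately show "((\<lambda>t. F (x + t *\<^sub>R v)) has_field_derivative G (x + t *\<^sub>R v) \<bullet> v) (at t within ?U)"
      using has_derivative_compose[OF 1 d] unfolding has_field_derivative_def by simp
    show "(\<lambda>x. F (x + t *\<^sub>R v)) integrable_on sbox 2"
      by (intro integrable_continuous continuous_on_subset[OF cs]) auto
  next
    show "continuous_on (?U \<times> sbox 2) (\<lambda>(t, x). G (x + t *\<^sub>R v) \<bullet> v)"
      unfolding case_prod_beta by (intro continuous_intros continuous_on_compose2[OF c]) auto
  qed (use dp in auto)
  have B: "integral (sbox 2) (\<lambda>x. F (x + t *\<^sub>R v)) = integral\<^sup>L lborel F" if "t \<in> ?U" for t
  proof -
    have "integral (sbox 2) (\<lambda>x. F (x + t *\<^sub>R v)) = (LINT x|lborel. F (t *\<^sub>R v + x))"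
      using compact_support_integral(2)[OF cs zs[OF that]] by (simp add: add.commute)
    also have "\<dots> = integral\<^sup>L (distr lborel borel ((+) (t *\<^sub>R v))) F"
      using cF by (subst integral_distr) (auto intro: borel_measurable_continuous_onI)
    finally show ?thesis by (simp add: lborel_distr_plus)
  qed
  have "((\<lambda>t. integral\<^sup>L lborel F) has_field_derivative
      integral (sbox 2) (\<lambda>x. G x \<bullet> v)) (at 0 within ?U)"
    unfolding has_field_derivative_def
    by (rule has_derivative_transform[OF _ B[symmetric] A[unfolded has_field_derivative_def]])
      (use dp in simp_all)
  moreover have "((\<lambda>t. integral\<^sup>L lborel F) has_field_derivative 0) (at 0 within ?U)" by simp
  moreover have "at 0 within ?U = at (0::real)"
    using dp by (intro at_within_interior) auto
  ultimately have "integral (sbox 2) (\<lambda>x. G x \<bullet> v) = 0"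
    by (metis DERIV_unique)
  \<comment> \<open>Near such a point \<open>F\<close> is identically zero, hence so is its
    derivative, and the box integral is the full integral.\<close>
  moreover have "G x \<bullet> v = 0" if "norm x > 1" for x
  proof -
    have "open {x::'a. norm x > 1}" by (intro open_Collect_less continuous_intros)
    then have "((\<lambda>x. 0) has_derivative (\<lambda>v. G x \<bullet> v)) (at x)"
      by (rule has_derivative_transform_within_open[OF d]) (use that z in auto)
    then have "(\<lambda>v. G x \<bullet> v) = (\<lambda>v. 0)"
      by (intro has_derivative_unique) (auto intro!: derivative_eq_intros)
    then show ?thesis by meson
  qed
  ultimately show ?thesis
    using compact_support_integral(2)[of "\<lambda>x. G x \<bullet> v" 2] continuous_on_inner[OF c continuous_on_const[of _ v]]
    by auto
qed

lemma lborel_integral_affine: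
  fixes f :: "'a::euclidean_space \<Rightarrow> real"
  assumes "r > 0" "f \<in> borel_measurable borel"
  shows "integral\<^sup>L lborel f = r ^ DIM('a) * (LINT x|lborel. f (t + r *\<^sub>R x))"
proof -
  have "integral\<^sup>L lborel f = integral\<^sup>L (density (distr lborel borel (\<lambda>x. t + r *\<^sub>R x)) (\<lambda>_. ennreal (\<bar>r\<bar>^DIM('a)))) f"
    using lborel_affine[of r t] assms by simp
  also have "\<dots> = (LINT x|lborel. \<bar>r\<bar>^DIM('a) * f (t + r *\<^sub>R x))"
    using assms by (simp add: integral_density integral_distr)
  finally show ?thesis using assms by simp
qed

section \<open>Harmonic functions\<close>

definition harmonic :: "(real^'n \<Rightarrow> real) \<Rightarrow> (real^'n \<Rightarrow> real^'n) \<Rightarrow> (real^'n \<Rightarrow> real^'n^'n) \<Rightarrow> (real^'n) set \<Rightarrow> bool"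
  where "harmonic h F H S \<longleftrightarrow> has_C2 h F H S \<and> (\<forall>x\<in>S. trace (H x) = 0)"

text \<open>The gradient of a power of this cap is a multiple of \<open>x\<close> times the next
  lower power, so radial derivatives can be integrated by parts within one family of
  weights.\<close>

definition cutoff :: "'a::euclidean_space \<Rightarrow> real" where
  "cutoff x = max 0 (1 - x \<bullet> x)"

lemma cutoff_nonneg [simp]: "0 \<le> cutoff x" by (simp add: cutoff_def)

lemma cutoff_le_1: "cutoff x \<le> 1" by (simp add: cutoff_def)

lemma cutoff_eq_0: "norm x \<ge> 1 \<Longrightarrow> cutoff x = 0"
  using power_mono[of 1 "norm x" 2] by (simp add: cutoff_def power2_norm_eq_inner)

lemma continuous_on_cutoff: "continuous_on A cutoff"
  unfolding cutoff_def by (intro continuous_intros)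

lemma kernel_cutoff_power: "kernel (\<lambda>x. cutoff x ^ Suc n)"
  unfolding kernel_def by (auto intro!: continuous_intros continuous_on_cutoff simp: cutoff_eq_0)

lemma kernel_cutoff_linear: "kernel (\<lambda>x. c * cutoff x ^ Suc n * (x \<bullet> v))"
  unfolding kernel_def by (auto intro!: continuous_intros continuous_on_cutoff simp: cutoff_eq_0)

text \<open>Exponents from 2 on make the positive part differentiable at its corner; hence the shift
  \<open>n + 2\<close>.\<close>

lemma pos_part_power_derivative:
  "((\<lambda>t::real. max 0 t ^ (n + 2)) has_field_derivative (real n + 2) * max 0 t ^ (n + 1)) (at t)"
proof -
  consider "t > 0" | "t < 0" | "t = 0" by linarith
  then show ?thesis
  proof cases
    case 1
    have "((\<lambda>t::real. t ^ (n + 2)) has_field_derivative (real n + 2) * t ^ (n + 1)) (at t)"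
      by (rule derivative_eq_intros | simp)+
    then show ?thesis using 1
      by (rule_tac has_field_derivative_transform_within_open[of _ _ _ "{0<..}"]) auto
  next
    case 2
    have "((\<lambda>t::real. 0) has_field_derivative 0) (at t)" by simp
    then show ?thesis using 2
      by (rule_tac has_field_derivative_transform_within_open[of "\<lambda>_. 0" _ _ "{..<0}"]) (auto simp: max_def)
  next
    case 3
    have "((\<lambda>h::real. max 0 h ^ (n + 2) / h) \<longlongrightarrow> 0) (at 0)"
    proof (rule Lim_null_comparison)
      show "\<forall>\<^sub>F h::real in at 0. norm (max 0 h ^ (n + 2) / h) \<le> \<bar>h\<bar> ^ (n + 1)"
        by (rule always_eventually) (auto simp: max_def power_add mult_nonpos_nonneg)
      have "((\<lambda>h::real. \<bar>h\<bar> ^ (n + 1)) \<longlongrightarrow> \<bar>0\<bar> ^ (n + 1)) (at 0)"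
        by (intro tendsto_intros)
      then show "((\<lambda>h::real. \<bar>h\<bar> ^ (n + 1)) \<longlongrightarrow> 0) (at 0)" by simp
    qed
    then show ?thesis using 3 by (simp add: DERIV_def)
  qed
qed

lemma cutoff_power_derivative:
  "((\<lambda>x. cutoff x ^ (n + 2)) has_derivative
     (\<lambda>v. (- (2 * (real n + 2)) * cutoff x ^ (n + 1)) * (x \<bullet> v))) (at x)"
proof -
  have "((\<lambda>x. 1 - x \<bullet> x) has_derivative (\<lambda>v. - 2 * (x \<bullet> v))) (at x)"
    by (auto intro!: derivative_eq_intros simp: inner_commute)
  from DERIV_compose_FDERIV[OF pos_part_power_derivative this]
  show ?thesis unfolding cutoff_def by (simp add: algebra_simps)
qed

text \<open>\<open>integral_partial_zero\<close> applied to the product of \<open>f\<close> with a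
  power of the cutoff. The boundary term is absent because the cutoff vanishes there.\<close>

lemma cutoff_integration_by_parts:
  fixes f :: "real^'n \<Rightarrow> real"
  assumes d: "\<And>x. norm x \<le> 1 \<Longrightarrow> (f has_derivative (\<lambda>v. Df x \<bullet> v)) (at x)"
    and c: "continuous_on (cball 0 1) Df"
  shows "(LINT x|lborel. cutoff x ^ (n + 2) * (Df x \<bullet> v)) =
         (LINT x|lborel. 2 * (real n + 2) * cutoff x ^ (n + 1) * (x \<bullet> v) * f x)"
proof -
  have cf: "continuous_on (cball 0 1) f"
    using d by (meson differentiable_def differentiable_imp_continuous_on differentiable_on_def
        has_derivative_at_withinI mem_cball_0)
  \<comment> \<open>The gradient of the product, written as cutoff powers times functions that are
    continuous on the closed unit ball, which makes it continuous everywhere.\<close>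
  define G where "G x = cutoff x ^ (n + 2) *\<^sub>R Df x + cutoff x ^ (n + 1) *\<^sub>R ((- (2 * (real n + 2)) * f x) *\<^sub>R x)" for x
  have "(LINT x|lborel. G x \<bullet> v) = 0"
  proof (rule integral_partial_zero[where F = "\<lambda>x. cutoff x ^ (n + 2) * f x"])
    fix x :: "real^'n"
    show "((\<lambda>x. cutoff x ^ (n + 2) * f x) has_derivative (\<lambda>w. G x \<bullet> w)) (at x)"
    proof (cases "norm x \<le> 1")
      case True
      show ?thesis
        using has_derivative_mult[OF cutoff_power_derivative[of n x] d[OF True]]
        by (auto simp: G_def inner_add_left algebra_simps)
    next
      case False
      have "open {x::real^'n. norm x > 1}" by (intro open_Collect_less continuous_intros)
      then have "((\<lambda>x. cutoff x ^ (n + 2) * f x) has_derivative (\<lambda>w. 0)) (at x)"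
        using False by (rule_tac has_derivative_transform_within_open[of "\<lambda>_. 0" _ _ _ "{x. norm x > 1}"])
          (auto simp: cutoff_eq_0)
      moreover have "G x = 0" using False by (simp add: G_def cutoff_eq_0)
      ultimately show ?thesis by simp
    qed
  next
    have "continuous_on UNIV (\<lambda>x. cutoff x ^ Suc (Suc n) *\<^sub>R Df x + cutoff x ^ Suc n *\<^sub>R ((- (2 * (real n + 2)) * f x) *\<^sub>R x))"
      by (intro continuous_on_add continuous_on_kernel_times1 kernel_cutoff_power c continuous_intros cf)
    then show "continuous_on UNIV G" by (simp add: G_def[abs_def])
  qed (simp add: cutoff_eq_0)
  moreover have "G x \<bullet> v = cutoff x ^ Suc (Suc n) *\<^sub>R (Df x \<bullet> v) - cutoff x ^ Suc n *\<^sub>R (2 * (real n + 2) * (x \<bullet> v) * f x)" for x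
    by (simp add: G_def inner_add_left) (simp add: algebra_simps)
  moreover have "integrable lborel (\<lambda>x. cutoff x ^ Suc (Suc n) *\<^sub>R (Df x \<bullet> v))"
    "integrable lborel (\<lambda>x. cutoff x ^ Suc n *\<^sub>R (2 * (real n + 2) * (x \<bullet> v) * f x))"
    by (intro kernel_integrable kernel_cutoff_power continuous_intros c cf)+
  ultimately show ?thesis by (simp add: algebra_simps)
qed

lemma translate_dilate_derivative:
  assumes d: "(f has_derivative f') (at (y + r *\<^sub>R x))"
  shows "((\<lambda>y. f (y + r *\<^sub>R x)) has_derivative f') (at y)"
    and "((\<lambda>x. f (y + r *\<^sub>R x)) has_derivative (\<lambda>v. f' (r *\<^sub>R v))) (at x)"
    and "((\<lambda>r. f (y + r *\<^sub>R x)) has_derivative (\<lambda>s. f' (s *\<^sub>R x))) (at r)"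
proof -
  have "((\<lambda>y. y + r *\<^sub>R x) has_derivative (\<lambda>v. v)) (at y)"
    "((\<lambda>x. y + r *\<^sub>R x) has_derivative (\<lambda>v. r *\<^sub>R v)) (at x)"
    "((\<lambda>r. y + r *\<^sub>R x) has_derivative (\<lambda>s. s *\<^sub>R x)) (at r)"
    by (auto intro!: derivative_eq_intros)
  from this[THEN has_derivative_compose, of f f'] d
  show "((\<lambda>y. f (y + r *\<^sub>R x)) has_derivative f') (at y)"
    and "((\<lambda>x. f (y + r *\<^sub>R x)) has_derivative (\<lambda>v. f' (r *\<^sub>R v))) (at x)"
    and "((\<lambda>r. f (y + r *\<^sub>R x)) has_derivative (\<lambda>s. f' (s *\<^sub>R x))) (at r)" by auto
qed

lemma dilate_mem:
  assumes "cball y r \<subseteq> S" "0 \<le> s" "s \<le> r" "norm x \<le> 1"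
  shows "y + s *\<^sub>R x \<in> S"
proof -
  have "s * norm x \<le> r * 1" using assms by (intro mult_mono) auto
  then have "y + s *\<^sub>R x \<in> cball y r" using assms by (simp add: dist_norm)
  then show ?thesis using assms by blast
qed

section \<open>Mean values and regularity of harmonic functions\<close>

text \<open>The weighted average over the ball of radius \<open>s\<close> has zero derivative in
  \<open>s\<close>, so it equals its value at s = 0. Starting at radius 0 avoids any limit.\<close>

lemma harmonic_mean_value:
  fixes h :: "real^'n \<Rightarrow> real"
  assumes har: "harmonic h F H S" and b: "cball y r \<subseteq> S" and r: "0 \<le> r"
  shows "(LINT x|lborel. (cutoff x)\<^sup>2 * h (y + r *\<^sub>R x)) = (LINT x|lborel. (cutoff (x::real^'n))\<^sup>2) * h y"
proof -
  have C2: "has_C2 h F H S" using har by (simp add: harmonic_def)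
  have d: "(h has_derivative (\<lambda>v. F x \<bullet> v)) (at x)" "(F has_derivative (\<lambda>v. H x *v v)) (at x)" if "x \<in> S" for x
    using C2 that by (auto simp: has_C2_def)
  have cH: "continuous_on S H" using C2 by (simp add: has_C2_def)
  note cF = has_C2_continuous_grad[OF C2] and ch = has_C2_continuous[OF C2]
  let ?U = "{0..r}"
  have k2: "kernel (\<lambda>x::real^'n. (cutoff x)\<^sup>2)"
    using kernel_cutoff_power[of 1] by (simp add: numeral_2_eq_2)
  have mem: "y + s *\<^sub>R x \<in> S" if "s \<in> ?U" "norm x \<le> 1" for s x
    using dilate_mem[OF b, of s x] that by auto
  define \<phi> where "\<phi> s = (LINT x|lborel. (cutoff x)\<^sup>2 * h (y + s *\<^sub>R x))" for s
  \<comment> \<open>This is the derivative in \<open>s\<close>. Since 6 x cutoff^2 is minus the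
    gradient of cutoff^3, integrating by parts in each coordinate turns it into a multiple of the
    average of the Laplacian.\<close>
  have zero: "(LINT x|lborel. (cutoff x)\<^sup>2 *\<^sub>R (F (y + s *\<^sub>R x) \<bullet> x)) = 0" if s: "s \<in> ?U" for s
  proof -
    have m: "y + s *\<^sub>R x \<in> S" if "x \<in> cball 0 1" for x using mem[OF s] that by simp
    have cFj: "continuous_on (cball 0 1) (\<lambda>x. F (y + s *\<^sub>R x) $ j)" for j
      by (intro continuous_on_component continuous_on_compose2[OF cF] continuous_intros) (use m in auto)
    have cHj: "continuous_on (cball 0 1) (\<lambda>x. s *\<^sub>R H (y + s *\<^sub>R x) $ j)" for j
      by (intro continuous_on_component continuous_on_compose2[OF cH] continuous_intros) (use m in auto)
    have ibp: "(LINT x|lborel. cutoff x ^ (1 + 2) * ((s *\<^sub>R H (y + s *\<^sub>R x) $ j) \<bullet> axis j 1)) =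
         (LINT x|lborel. 2 * (real 1 + 2) * cutoff x ^ (1 + 1) * (x \<bullet> axis j 1) * F (y + s *\<^sub>R x) $ j)" for j
    proof (rule cutoff_integration_by_parts[OF _ cHj])
      fix x :: "real^'n" assume "norm x \<le> 1"
      then have "((\<lambda>z. F z $ j) has_derivative (\<lambda>v. H (y + s *\<^sub>R x) $ j \<bullet> v)) (at (y + s *\<^sub>R x))"
        using d(2)[of "y + s *\<^sub>R x"] m[of x] by (auto simp: has_derivative_matvec)
      from translate_dilate_derivative(2)[OF this]
      show "((\<lambda>x. F (y + s *\<^sub>R x) $ j) has_derivative (\<lambda>v. (s *\<^sub>R H (y + s *\<^sub>R x) $ j) \<bullet> v)) (at x)"
        by simp
    qed
    have i1: "integrable lborel (\<lambda>x. cutoff x ^ Suc 2 *\<^sub>R ((s *\<^sub>R H (y + s *\<^sub>R x) $ j) \<bullet> axis j 1))" for j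
      by (intro kernel_integrable kernel_cutoff_power continuous_on_inner cHj continuous_on_const)
    have i2: "integrable lborel (\<lambda>x. cutoff x ^ Suc 1 *\<^sub>R ((x \<bullet> axis j 1) * F (y + s *\<^sub>R x) $ j))" for j
      by (intro kernel_integrable kernel_cutoff_power continuous_on_mult continuous_intros cFj)
    have "0 = (LINT x|lborel. (\<Sum>j\<in>UNIV. cutoff x ^ Suc 2 *\<^sub>R ((s *\<^sub>R H (y + s *\<^sub>R x) $ j) \<bullet> axis j 1)))"
    proof -
      have "(\<Sum>j\<in>UNIV. cutoff x ^ Suc 2 *\<^sub>R ((s *\<^sub>R H (y + s *\<^sub>R x) $ j) \<bullet> axis j 1)) = 0" for x :: "real^'n"
      proof (cases "norm x \<le> 1")
        case True
        then have "(\<Sum>j\<in>UNIV. H (y + s *\<^sub>R x) $ j $ j) = 0"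
          using har m[of x] by (auto simp: harmonic_def trace_def)
        then show ?thesis by (simp add: inner_axis flip: sum_distrib_left)
      qed (simp add: cutoff_eq_0)
      then show ?thesis by (metis (mono_tags, lifting) Bochner_Integration.integral_cong integral_zero)
    qed
    also have "\<dots> = (\<Sum>j\<in>UNIV. (LINT x|lborel. cutoff x ^ Suc 2 *\<^sub>R ((s *\<^sub>R H (y + s *\<^sub>R x) $ j) \<bullet> axis j 1)))"
      by (intro Bochner_Integration.integral_sum i1)
    also have "\<dots> = (\<Sum>j\<in>UNIV. 6 * (LINT x|lborel. cutoff x ^ Suc 1 *\<^sub>R ((x \<bullet> axis j 1) * F (y + s *\<^sub>R x) $ j)))"
    proof (rule sum.cong[OF refl])
      fix j
      show "(LINT x|lborel. cutoff x ^ Suc 2 *\<^sub>R ((s *\<^sub>R H (y + s *\<^sub>R x) $ j) \<bullet> axis j 1))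
        = 6 * (LINT x|lborel. cutoff x ^ Suc 1 *\<^sub>R ((x \<bullet> axis j 1) * F (y + s *\<^sub>R x) $ j))"
        using ibp[of j] by (simp add: numeral_3_eq_3 numeral_2_eq_2 mult.assoc flip: integral_mult_right_zero)
    qed
    also have "\<dots> = 6 * (LINT x|lborel. (\<Sum>j\<in>UNIV. cutoff x ^ Suc 1 *\<^sub>R ((x \<bullet> axis j 1) * F (y + s *\<^sub>R x) $ j)))"
      by (subst Bochner_Integration.integral_sum[OF i2]) (simp add: sum_distrib_left)
    also have "(\<lambda>x. \<Sum>j\<in>UNIV. cutoff x ^ Suc 1 *\<^sub>R ((x \<bullet> axis j 1) * F (y + s *\<^sub>R x) $ j)) =
        (\<lambda>x. (cutoff x)\<^sup>2 *\<^sub>R (F (y + s *\<^sub>R x) \<bullet> x))"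
      by (simp add: fun_eq_iff inner_axis flip: sum_distrib_left)
        (simp add: inner_vec_def power2_eq_square mult.commute)
    finally show ?thesis by simp
  qed
  have "(\<phi> has_derivative (\<lambda>v. 0)) (at s within ?U)" if s: "s \<in> ?U" for s
  proof -
    have "(\<phi> has_derivative (\<lambda>v. (LINT x|lborel. (cutoff x)\<^sup>2 *\<^sub>R (F (y + s *\<^sub>R x) \<bullet> x)) \<bullet> v)) (at s within ?U)"
      unfolding \<phi>_def
    proof (rule kernel_integral_derivative[OF k2, where D = "\<lambda>s x. F (y + s *\<^sub>R x) \<bullet> x"])
      fix s and x :: "real^'n" assume s: "s \<in> ?U" and x: "norm x \<le> 1"
      from translate_dilate_derivative(3)[OF d(1)[OF mem[OF s x]]]
      show "((\<lambda>s. h (y + s *\<^sub>R x)) has_derivative (\<lambda>v. (F (y + s *\<^sub>R x) \<bullet> x) \<bullet> v)) (at s within ?U)"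
        by (auto intro: has_derivative_at_withinI simp: mult.commute)
    next
      fix s assume "s \<in> ?U"
      then show "continuous_on (cball 0 1) (\<lambda>x. h (y + s *\<^sub>R x))"
        by (intro continuous_on_compose2[OF ch] continuous_intros) (use mem in auto)
    next
      show "continuous_on (?U \<times> cball 0 1) (\<lambda>(s, x). F (y + s *\<^sub>R x) \<bullet> x)"
        unfolding case_prod_beta
        by (intro continuous_on_inner continuous_on_compose2[OF cF] continuous_intros) (use mem in auto)
    qed (use s in auto)
    then show ?thesis by (simp add: zero[OF s, simplified])
  qed
  then have "\<exists>c. \<forall>s\<in>?U. \<phi> s = c"
    by (intro has_derivative_zero_constant) auto
  then have "\<phi> r = \<phi> 0" using r by auto
  then show ?thesis by (simp add: \<phi>_def)
qed


text \<open>Normalising factor of the weighted mean value; it takes the place of the volume of the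
  unit ball.\<close>

definition bump_mass :: "'n::finite itself \<Rightarrow> real" where
  "bump_mass _ = (LINT x|lborel. (cutoff (x::real^'n))\<^sup>2)"

text \<open>Arises when the derivative of cutoff^2 leaves one power of the cutoff in the gradient
  formula.\<close>

definition cone_mass :: "'n::finite itself \<Rightarrow> real" where
  "cone_mass _ = (LINT x|lborel. cutoff (x::real^'n))"

lemma kernel_bump: "kernel (\<lambda>x. (cutoff x)\<^sup>2)"
  using kernel_cutoff_power[of 1] by (simp add: numeral_2_eq_2)

lemma kernel_pos_mass:
  fixes k :: "'a::euclidean_space \<Rightarrow> real"
  assumes "kernel k" "\<And>x. k x \<ge> 0" "k 0 > 0"
  shows "(LINT x|lborel. k x) > 0"
proof -
  have c: "continuous_on (sbox 1) k" using assms unfolding kernel_def by (auto intro: continuous_on_subset)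
  have eq: "integral (sbox 1) k = (LINT x|lborel. k x)"
    using kernel_integrable(2)[OF assms(1), of "\<lambda>_. 1::real"] by simp
  have b: "box (- (1 *\<^sub>R One)) (1 *\<^sub>R One) \<noteq> ({}::'a set)"
    by (auto simp: box_ne_empty)
  have 0: "(0::'a) \<in> sbox 1" by (rule mem_sbox) simp
  have "integral (sbox 1) k \<noteq> 0"
    using integral_cbox_eq_0_iff[OF c b] assms 0 by fastforce
  moreover have "integral (sbox 1) k \<ge> 0"
    by (rule Henstock_Kurzweil_Integration.integral_nonneg) (use c assms in \<open>auto intro: integrable_continuous\<close>)
  ultimately show ?thesis using eq by simp
qed

lemma bump_mass_pos: "bump_mass TYPE('n::finite) > 0"
  unfolding bump_mass_def by (rule kernel_pos_mass[OF kernel_bump]) (auto simp: cutoff_def)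

lemma cone_mass_pos: "cone_mass TYPE('n::finite) > 0"
  unfolding cone_mass_def using kernel_cutoff_power[of 0]
  by (intro kernel_pos_mass) (auto simp: cutoff_def)

text \<open>Gives the centre of an average room to move, as is needed to differentiate in the
  centre.\<close>

lemma enlarge_cball:
  fixes S :: "(real^'n) set"
  assumes "cball y r \<subseteq> S" "open S" "0 \<le> r"
  obtains \<delta> where "\<delta> > 0" "\<And>y'. y' \<in> ball y \<delta> \<Longrightarrow> cball y' r \<subseteq> S"
proof -
  obtain \<delta> where d: "\<delta> > 0" "(\<Union>x\<in>cball y r. cball x \<delta>) \<subseteq> S"
    by (rule compact_subset_open_imp_cball_epsilon_subset[OF compact_cball assms(2,1)])
  have "cball y' r \<subseteq> S" if y': "y' \<in> ball y \<delta>" for y'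
  proof
    fix x assume x: "x \<in> cball y' r"
    have "x - (y' - y) \<in> cball y r" using x by (simp add: dist_norm algebra_simps)
    moreover have "x \<in> cball (x - (y' - y)) \<delta>" using y' by (simp add: dist_norm norm_minus_commute)
    ultimately show "x \<in> S" using d by blast
  qed
  then show ?thesis using that d by blast
qed

lemma kernel_average_derivative:
  fixes f :: "real^'n \<Rightarrow> real"
  assumes k: "kernel k" and d: "\<And>x. x \<in> S \<Longrightarrow> (f has_derivative (\<lambda>v. F x \<bullet> v)) (at x)"
    and cF: "continuous_on S F" and S: "open S" and b: "cball y r \<subseteq> S" and r: "0 \<le> r"
  shows "((\<lambda>y. LINT x|lborel. k x * f (y + r *\<^sub>R x)) has_derivative
     (\<lambda>v. (LINT x|lborel. k x *\<^sub>R F (y + r *\<^sub>R x)) \<bullet> v)) (at y)"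
proof -
  obtain \<delta> where de: "\<delta> > 0" "\<And>y'. y' \<in> ball y \<delta> \<Longrightarrow> cball y' r \<subseteq> S"
    by (rule enlarge_cball[OF b S r], erule that, assumption)
  have mem: "y' + r *\<^sub>R x \<in> S" if "y' \<in> ball y \<delta>" "norm x \<le> 1" for y' x
    by (rule dilate_mem[OF de(2)]) (use that r in simp_all)
  have cf: "continuous_on S f"
    by (rule has_derivative_continuous_on[OF has_derivative_at_withinI[OF d]])
  have "((\<lambda>y. LINT x|lborel. k x * f (y + r *\<^sub>R x)) has_derivative
     (\<lambda>v. (LINT x|lborel. k x *\<^sub>R F (y + r *\<^sub>R x)) \<bullet> v)) (at y within ball y \<delta>)"
  proof (rule kernel_integral_derivative[OF k, where D = "\<lambda>y x. F (y + r *\<^sub>R x)"])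
    fix y' x assume "y' \<in> ball y \<delta>" "norm (x::real^'n) \<le> 1"
    from translate_dilate_derivative(1)[OF d[OF mem[OF this]]]
    show "((\<lambda>p. f (p + r *\<^sub>R x)) has_derivative (\<bullet>) (F (y' + r *\<^sub>R x))) (at y' within ball y \<delta>)"
      by (rule has_derivative_at_withinI)
  next
    fix y' assume "y' \<in> ball y \<delta>"
    then show "continuous_on (cball 0 1) (\<lambda>x. f (y' + r *\<^sub>R x))"
      by (intro continuous_on_compose2[OF cf] continuous_intros) (use mem in auto)
  next
    show "continuous_on (ball y \<delta> \<times> cball 0 1) (\<lambda>(y, x). F (y + r *\<^sub>R x))"
      unfolding case_prod_beta
      by (intro continuous_on_compose2[OF cF] continuous_intros) (use mem in auto)
  qed (use de(1) in simp_all)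
  then show ?thesis using de(1) by (simp add: at_within_open[of y "ball y \<delta>"])
qed

text \<open>The mean value identity holds for all nearby centres and may be differentiated;
  integration by parts then moves the derivative from \<open>h\<close> to the weight. No derivative
  of \<open>h\<close> is left on the right, so bounds on \<open>h\<close> bound its gradient and the
  formula can be differentiated again. The factor \<open>r\<close> comes from the dilation.\<close>

lemma harmonic_gradient_formula:
  fixes h :: "real^'n \<Rightarrow> real"
  assumes har: "harmonic h F H S" and b: "cball y r \<subseteq> S" and r: "0 < r"
  shows "r * bump_mass TYPE('n) * (F y \<bullet> v) = (LINT x|lborel. 4 * cutoff x * (x \<bullet> v) * h (y + r *\<^sub>R x))"
proof -
  have C2: "has_C2 h F H S" using har by (simp add: harmonic_def)
  have S: "open S" using C2 by (simp add: has_C2_def)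
  have d: "(h has_derivative (\<lambda>v. F x \<bullet> v)) (at x)" if "x \<in> S" for x
    using C2 that by (auto simp: has_C2_def)
  note cF = has_C2_continuous_grad[OF C2] and ch = has_C2_continuous[OF C2]
  have mem: "y + r *\<^sub>R x \<in> S" if "norm x \<le> 1" for x
    using dilate_mem[OF b, of r x] that r by auto
  obtain \<delta> where de: "\<delta> > 0" "\<And>y'. y' \<in> ball y \<delta> \<Longrightarrow> cball y' r \<subseteq> S"
    by (rule enlarge_cball[OF b S less_imp_le[OF r]], erule that, assumption)
  have "((\<lambda>y. LINT x|lborel. (cutoff x)\<^sup>2 * h (y + r *\<^sub>R x)) has_derivative
     (\<lambda>v. (LINT x|lborel. (cutoff x)\<^sup>2 *\<^sub>R F (y + r *\<^sub>R x)) \<bullet> v)) (at y)"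
    by (rule kernel_average_derivative[OF kernel_bump d cF S b]) (use r in auto)
  moreover have "((\<lambda>y. LINT x|lborel. (cutoff x)\<^sup>2 * h (y + r *\<^sub>R x)) has_derivative
     (\<lambda>v. bump_mass TYPE('n) * (F y \<bullet> v))) (at y)"
  proof (rule has_derivative_transform_within_open[of "\<lambda>y. bump_mass TYPE('n) * h y" _ _ _ "ball y \<delta>"])
    show "((\<lambda>y. bump_mass TYPE('n) * h y) has_derivative (\<lambda>v. bump_mass TYPE('n) * (F y \<bullet> v))) (at y)"
      by (intro has_derivative_mult_right d) (use b r in auto)
    show "bump_mass TYPE('n) * h x = (LINT xa|lborel. (cutoff xa)\<^sup>2 * h (x + r *\<^sub>R xa))"
      if "x \<in> ball y \<delta>" for x
      using harmonic_mean_value[OF har de(2)[OF that]] r by (simp add: bump_mass_def)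
  qed (use de(1) in simp_all)
  ultimately have "(\<lambda>v. (LINT x|lborel. (cutoff x)\<^sup>2 *\<^sub>R F (y + r *\<^sub>R x)) \<bullet> v) = (\<lambda>v. bump_mass TYPE('n) * (F y \<bullet> v))"
    by (rule has_derivative_unique)
  from fun_cong[OF this, of v]
  have eq: "bump_mass TYPE('n) * (F y \<bullet> v) = (LINT x|lborel. (cutoff x)\<^sup>2 *\<^sub>R F (y + r *\<^sub>R x)) \<bullet> v"
    by simp
  have cFr: "continuous_on (cball 0 1) (\<lambda>x. F (y + r *\<^sub>R x))"
    by (intro continuous_on_compose2[OF cF] continuous_intros) (use mem in auto)
  have "r * bump_mass TYPE('n) * (F y \<bullet> v) = r * ((LINT x|lborel. (cutoff x)\<^sup>2 *\<^sub>R F (y + r *\<^sub>R x)) \<bullet> v)"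
    by (simp only: mult.assoc eq)
  also have "(LINT x|lborel. (cutoff x)\<^sup>2 *\<^sub>R F (y + r *\<^sub>R x)) \<bullet> v
      = (LINT x|lborel. ((cutoff x)\<^sup>2 *\<^sub>R F (y + r *\<^sub>R x)) \<bullet> v)"
    by (rule integral_bounded_linear[OF bounded_linear_inner_left kernel_integrable(1)[OF kernel_bump cFr], symmetric])
  also have "r * \<dots> = (LINT x|lborel. r * (((cutoff x)\<^sup>2 *\<^sub>R F (y + r *\<^sub>R x)) \<bullet> v))"
    by (rule integral_mult_right_zero[symmetric])
  also have "\<dots> = (LINT x|lborel. cutoff x ^ (0 + 2) * ((r *\<^sub>R F (y + r *\<^sub>R x)) \<bullet> v))"
    by (rule Bochner_Integration.integral_cong) (simp_all only: inner_scaleR_left mult.left_commute add_0)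
  also have "\<dots> = (LINT x|lborel. 2 * (real 0 + 2) * cutoff x ^ (0 + 1) * (x \<bullet> v) * h (y + r *\<^sub>R x))"
  proof (rule cutoff_integration_by_parts)
    fix x :: "real^'n" assume "norm x \<le> 1"
    from translate_dilate_derivative(2)[OF d[OF mem[OF this]]]
    show "((\<lambda>x. h (y + r *\<^sub>R x)) has_derivative (\<lambda>v. (r *\<^sub>R F (y + r *\<^sub>R x)) \<bullet> v)) (at x)"
      by (simp only: inner_scaleR_left inner_scaleR_right)
  qed (intro continuous_intros cFr)
  finally show ?thesis by (simp only: of_nat_0 add_0 power_one_right) simp
qed

text \<open>The assumptions provide no third derivatives. The gradient formula writes
  \<open>F x \<bullet> v\<close> locally as an average of \<open>h\<close>; differentiating twice
  under the integral replaces \<open>h\<close> by \<open>F\<close> and then by \<open>H\<close>, and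
  an average of trace-free matrices is trace free.\<close>

lemma harmonic_partial:
  fixes h :: "real^'n \<Rightarrow> real"
  assumes har: "harmonic h F H S"
  shows "\<exists>K. harmonic (\<lambda>x. F x \<bullet> v) (\<lambda>x. H x *v v) K S"
proof -
  have C2: "has_C2 h F H S" using har by (simp add: harmonic_def)
  have S: "open S" and cH: "continuous_on S H" using C2 by (auto simp: has_C2_def)
  have d: "(h has_derivative (\<lambda>v. F x \<bullet> v)) (at x)" "(F has_derivative (\<lambda>v. H x *v v)) (at x)" if "x \<in> S" for x
    using C2 that by (auto simp: has_C2_def)
  note cF = has_C2_continuous_grad[OF C2] and ch = has_C2_continuous[OF C2]
  \<comment> \<open>Defined without a radius: the local averages below depend on the chosen
    \<open>r\<close>, and a canonical \<open>K\<close> is what glues them into one function on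
    \<open>S\<close>.\<close>
  define K where "K x = matrix (frechet_derivative (\<lambda>x. H x *v v) (at x))" for x
  define k :: "real^'n \<Rightarrow> real" where "k x = 4 * cutoff x * (x \<bullet> v)" for x
  have kk: "kernel k" using kernel_cutoff_linear[of 4 0 v] by (simp add: k_def[abs_def])
  have Fv: "((\<lambda>x. F x \<bullet> v) has_derivative (\<lambda>u. (H x *v v) \<bullet> u)) (at x)" if x: "x \<in> S" for x
  proof -
    have "((\<lambda>x. F x \<bullet> v) has_derivative (\<lambda>u. (H x *v u) \<bullet> v)) (at x)"
      by (intro has_derivative_inner_left d x)
    then show ?thesis by (simp add: has_C2_symmetric[OF C2 x, of _ v])
  qed
  have local: "\<exists>\<delta>>0. ball y0 \<delta> \<subseteq> S \<and> continuous_on (ball y0 \<delta>) K \<and> (\<forall>y\<in>ball y0 \<delta>.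
      ((\<lambda>x. H x *v v) has_derivative (\<lambda>u. K y *v u)) (at y) \<and> trace (K y) = 0)"
    if y0: "y0 \<in> S" for y0
  proof -
    obtain r where r: "r > 0" "cball y0 r \<subseteq> S" using S y0 open_contains_cball by blast
    obtain \<delta>' where de': "\<delta>' > 0" "\<And>y'. y' \<in> ball y0 \<delta>' \<Longrightarrow> cball y' r \<subseteq> S"
      by (rule enlarge_cball[OF r(2) S less_imp_le[OF r(1)]], erule that, assumption)
    define \<delta> where "\<delta> = min \<delta>' r"
    have "ball y0 \<delta> \<subseteq> cball y0 r" by (auto simp: \<delta>_def)
    then have de: "\<delta> > 0" "\<And>y'. y' \<in> ball y0 \<delta> \<Longrightarrow> cball y' r \<subseteq> S" "ball y0 \<delta> \<subseteq> S"
      using de' r(1) order_trans[OF _ r(2)] by (auto simp: \<delta>_def)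
    have mem: "y + r *\<^sub>R x \<in> S" if "y \<in> ball y0 \<delta>" "norm x \<le> 1" for y x
      by (rule dilate_mem[OF de(2)]) (use that r in simp_all)
    define C where "C = 1 / (r * bump_mass TYPE('n))"
    have form: "F y \<bullet> v = C * (LINT x|lborel. k x * h (y + r *\<^sub>R x))" if "y \<in> ball y0 \<delta>" for y
      using harmonic_gradient_formula[OF har de(2)[OF that] r(1), of v] bump_mass_pos[where 'n='n] r
      by (simp add: C_def k_def field_simps)
    have Hv: "H y *v v = C *\<^sub>R (LINT x|lborel. k x *\<^sub>R F (y + r *\<^sub>R x))" if y: "y \<in> ball y0 \<delta>" for y
    proof -
      have "((\<lambda>y. C * (LINT x|lborel. k x * h (y + r *\<^sub>R x))) has_derivative
         (\<lambda>u. C * ((LINT x|lborel. k x *\<^sub>R F (y + r *\<^sub>R x)) \<bullet> u))) (at y)"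
        by (intro has_derivative_mult_right kernel_average_derivative[OF kk d(1) cF S de(2)[OF y]]) (use r in auto)
      then have "((\<lambda>x. F x \<bullet> v) has_derivative (\<lambda>u. C * ((LINT x|lborel. k x *\<^sub>R F (y + r *\<^sub>R x)) \<bullet> u))) (at y)"
        by (rule has_derivative_transform_within_open[of _ _ _ _ "ball y0 \<delta>"]) (use y form in auto)
      then have "((\<lambda>x. F x \<bullet> v) has_derivative (\<lambda>u. (C *\<^sub>R (LINT x|lborel. k x *\<^sub>R F (y + r *\<^sub>R x))) \<bullet> u)) (at y)"
        by simp
      note g1 = grad_unique[OF this]
      have yS: "y \<in> S" using y de(3) by blast
      show ?thesis by (rule trans[OF grad_unique[OF Fv[OF yS], symmetric] g1])
    qed
    define L where "L y = C *\<^sub>R (LINT x|lborel. k x *\<^sub>R H (y + r *\<^sub>R x))" for y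
    have cHr: "continuous_on (cball 0 1) (\<lambda>x. H (y + r *\<^sub>R x))" if "y \<in> ball y0 \<delta>" for y
      by (intro continuous_on_compose2[OF cH] continuous_intros) (use that mem in auto)
    have cFr: "continuous_on (cball 0 1) (\<lambda>x. F (y + r *\<^sub>R x))" if "y \<in> ball y0 \<delta>" for y
      by (intro continuous_on_compose2[OF cF] continuous_intros) (use that mem in auto)
    have iH: "integrable lborel (\<lambda>x. k x *\<^sub>R H (y + r *\<^sub>R x))" if "y \<in> ball y0 \<delta>" for y
      by (rule kernel_integrable(1)[OF kk cHr[OF that]])
    have iF: "integrable lborel (\<lambda>x. k x *\<^sub>R F (y + r *\<^sub>R x))" if "y \<in> ball y0 \<delta>" for y
      by (rule kernel_integrable(1)[OF kk cFr[OF that]])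
    have DL: "((\<lambda>x. H x *v v) has_derivative (\<lambda>u. L y *v u)) (at y)" if y: "y \<in> ball y0 \<delta>" for y
      unfolding has_derivative_matvec
    proof
      fix j
      have "((\<lambda>y. C * (LINT x|lborel. k x * F (y + r *\<^sub>R x) $ j)) has_derivative
         (\<lambda>u. C * ((LINT x|lborel. k x *\<^sub>R H (y + r *\<^sub>R x) $ j) \<bullet> u))) (at y)"
      proof (intro has_derivative_mult_right kernel_average_derivative[OF kk _ _ S de(2)[OF y]])
        show "((\<lambda>x. F x $ j) has_derivative (\<lambda>u. H x $ j \<bullet> u)) (at x)" if "x \<in> S" for x
          using d(2)[OF that] by (simp add: has_derivative_matvec)
        show "continuous_on S (\<lambda>x. H x $ j)" by (intro continuous_intros cH)
      qed (use r in auto)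
      moreover have "C * ((LINT x|lborel. k x *\<^sub>R H (y + r *\<^sub>R x) $ j) \<bullet> u) = L y $ j \<bullet> u" for u
        using integral_bounded_linear[OF bounded_linear_vec_nth iH[OF y], of j]
        by (simp add: L_def)
      ultimately have "((\<lambda>y. C * (LINT x|lborel. k x * F (y + r *\<^sub>R x) $ j)) has_derivative (\<lambda>u. L y $ j \<bullet> u)) (at y)"
        by simp
      then show "((\<lambda>x. (H x *v v) $ j) has_derivative (\<lambda>u. L y $ j \<bullet> u)) (at y)"
      proof (rule has_derivative_transform_within_open[of _ _ _ _ "ball y0 \<delta>"])
        fix y assume y: "y \<in> ball y0 \<delta>"
        show "C * (LINT x|lborel. k x * F (y + r *\<^sub>R x) $ j) = (H y *v v) $ j"
          using integral_bounded_linear[OF bounded_linear_vec_nth iF[OF y], of j]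
          by (simp add: Hv[OF y])
      qed (use y in auto)
    qed
    have KL: "K y = L y" if "y \<in> ball y0 \<delta>" for y
      unfolding K_def frechet_derivative_at[OF DL[OF that], symmetric] by simp
    have "continuous_on (ball y0 \<delta>) L"
      unfolding L_def
    proof (intro continuous_intros continuous_on_kernel_integral[OF kk])
      show "continuous_on (ball y0 \<delta> \<times> cball 0 1) (\<lambda>(y, x). H (y + r *\<^sub>R x))"
        unfolding case_prod_beta
        by (intro continuous_on_compose2[OF cH] continuous_intros) (use mem in auto)
    qed
    then have "continuous_on (ball y0 \<delta>) K" by (rule continuous_on_eq) (simp add: KL)
    moreover have "trace (L y) = 0" if y: "y \<in> ball y0 \<delta>" for y
    proof -
      have bl: "bounded_linear (trace :: real^'n^'n \<Rightarrow> real)"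
        unfolding linear_conv_bounded_linear[symmetric] by (rule linearI) auto
      have "trace (LINT x|lborel. k x *\<^sub>R H (y + r *\<^sub>R x)) = (LINT x|lborel. k x * trace (H (y + r *\<^sub>R x)))"
        using integral_bounded_linear[OF bl iH[OF y]] by simp
      also have "\<dots> = (LINT x|(lborel :: (real^'n) measure). 0)"
      proof (rule Bochner_Integration.integral_cong[OF refl])
        fix x
        show "k x * trace (H (y + r *\<^sub>R x)) = 0"
          using har mem[OF y, of x] kk by (cases "norm x \<le> 1") (auto simp: harmonic_def kernel_def)
      qed
      finally show ?thesis by (simp add: L_def)
    qed
    ultimately show ?thesis using de DL KL by (intro exI[of _ \<delta>]) auto
  qed
  have "continuous_on S K"
  proof (rule continuous_at_imp_continuous_on, rule ballI)
    fix y assume y: "y \<in> S"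
    obtain \<delta> where "\<delta> > 0" "continuous_on (ball y \<delta>) K" using local[OF y] by blast
    then show "isCont K y" by (simp add: continuous_on_eq_continuous_at)
  qed
  then have "harmonic (\<lambda>x. F x \<bullet> v) (\<lambda>x. H x *v v) K S"
    unfolding harmonic_def has_C2_def
  proof (intro conjI ballI S Fv)
    fix x assume "x \<in> S"
    from local[OF this] show "((\<lambda>x. H x *v v) has_derivative (*v) (K x)) (at x)" "trace (K x) = 0"
      by auto
  qed
  then show ?thesis by blast
qed

definition grad_const :: "'n::finite itself \<Rightarrow> real" where
  "grad_const _ = 4 * cone_mass TYPE('n) / bump_mass TYPE('n)"

lemma grad_const_pos: "grad_const TYPE('n::finite) > 0"
  by (simp add: grad_const_def bump_mass_pos cone_mass_pos)

section \<open>Interior estimates\<close>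

text \<open>The gradient formula tested with \<open>F y\<close> itself; one factor |F y| then
  cancels.\<close>

lemma harmonic_gradient_bound:
  fixes h :: "real^'n \<Rightarrow> real"
  assumes har: "harmonic h F H S" and b: "cball y r \<subseteq> S" and r: "0 < r"
    and B: "\<And>x. x \<in> cball y r \<Longrightarrow> \<bar>h x\<bar> \<le> B"
  shows "norm (F y) \<le> grad_const TYPE('n) * B / r"
proof (cases "F y = 0")
  case True
  have "B \<ge> 0" using B[of y] r by (metis abs_ge_zero centre_in_cball less_eq_real_def order_trans)
  then show ?thesis using True r grad_const_pos[where 'n='n] by simp
next
  case False
  have ch: "continuous_on S h" using har has_C2_continuous by (auto simp: harmonic_def)
  have mem: "y + r *\<^sub>R x \<in> cball y r" if "norm x \<le> 1" for x
    using dilate_mem[OF subset_refl, of r r x] that r by auto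
  have k1: "kernel (cutoff :: real^'n \<Rightarrow> real)"
    using kernel_cutoff_power[where ?'a="real^'n", of 0] by simp
  have ci: "integrable lborel (cutoff :: real^'n \<Rightarrow> real)"
    using kernel_integrable(1)[OF k1, of "\<lambda>_. 1::real"] by simp
  have "r * bump_mass TYPE('n) * (F y \<bullet> F y) = (LINT x|lborel. 4 * cutoff x * (x \<bullet> F y) * h (y + r *\<^sub>R x))"
    by (rule harmonic_gradient_formula[OF har b r])
  also have "\<dots> \<le> (LINT x|lborel. (4 * norm (F y) * B) * cutoff (x::real^'n))"
  proof (rule Bochner_Integration.integral_mono)
    have "continuous_on (cball 0 1) (\<lambda>x. 4 * (x \<bullet> F y) * h (y + r *\<^sub>R x))"
      by (intro continuous_intros continuous_on_compose2[OF ch]) (use mem b in auto)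
    from kernel_integrable(1)[OF k1 this]
    show "integrable lborel (\<lambda>x. 4 * cutoff x * (x \<bullet> F y) * h (y + r *\<^sub>R x))"
      by (simp add: mult_ac)
    show "integrable lborel (\<lambda>x. (4 * norm (F y) * B) * cutoff (x::real^'n))"
      by (intro integrable_mult_right ci)
    fix x :: "real^'n"
    show "4 * cutoff x * (x \<bullet> F y) * h (y + r *\<^sub>R x) \<le> (4 * norm (F y) * B) * cutoff x"
    proof (cases "norm x \<le> 1")
      case True
      have "\<bar>x \<bullet> F y\<bar> \<le> norm x * norm (F y)" by (rule Cauchy_Schwarz_ineq2)
      also have "\<dots> \<le> 1 * norm (F y)" using True by (intro mult_right_mono) auto
      finally have "\<bar>x \<bullet> F y\<bar> * \<bar>h (y + r *\<^sub>R x)\<bar> \<le> norm (F y) * B"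
        using B[OF mem[OF True]] by (intro mult_mono) auto
      then have "(x \<bullet> F y) * h (y + r *\<^sub>R x) \<le> norm (F y) * B"
        by (metis abs_le_D1 abs_mult)
      then have "4 * cutoff x * ((x \<bullet> F y) * h (y + r *\<^sub>R x)) \<le> 4 * cutoff x * (norm (F y) * B)"
        by (intro mult_left_mono) auto
      then show ?thesis by (simp add: mult_ac)
    qed (simp add: cutoff_eq_0)
  qed
  also have "\<dots> = 4 * norm (F y) * B * cone_mass TYPE('n)" by (simp add: cone_mass_def)
  finally have "norm (F y) * (r * bump_mass TYPE('n) * norm (F y)) \<le> norm (F y) * (4 * B * cone_mass TYPE('n))"
    by (simp add: power2_norm_eq_inner[symmetric] power2_eq_square mult_ac)
  then have "r * bump_mass TYPE('n) * norm (F y) \<le> 4 * B * cone_mass TYPE('n)"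
    using False by simp
  then show ?thesis using r bump_mass_pos[where 'n='n]
    by (simp add: grad_const_def field_simps)
qed

text \<open>Jensen's inequality in the form that the weighted integral of (h - h y)^2 is
  nonnegative, with the mean value evaluating the cross term. Then the weight is at most 1 and the
  ball is rescaled.\<close>

lemma harmonic_mean_square:
  fixes h :: "real^'n \<Rightarrow> real"
  assumes har: "harmonic h F H S" and b: "cball y r \<subseteq> S" and r: "0 < r"
    and int: "set_integrable lborel S (\<lambda>x. (h x)\<^sup>2)"
  shows "bump_mass TYPE('n) * r ^ CARD('n) * (h y)\<^sup>2 \<le> (LINT x:S|lborel. (h x)\<^sup>2)"
proof -
  have ch: "continuous_on S h" using har has_C2_continuous by (auto simp: harmonic_def)
  have mem: "y + r *\<^sub>R x \<in> cball y r" if "norm x \<le> 1" for x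
    using dilate_mem[OF subset_refl, of r r x] that r by auto
  have chr: "continuous_on (cball 0 1) (\<lambda>x. h (y + r *\<^sub>R x))"
    by (intro continuous_on_compose2[OF ch] continuous_intros) (use mem b in force)
  define m where "m = bump_mass TYPE('n)"
  let ?w = "\<lambda>x::real^'n. (cutoff x)\<^sup>2"
  have i0: "integrable lborel ?w"
    using kernel_integrable(1)[OF kernel_bump, of "\<lambda>_. 1::real"] by simp
  have i1: "integrable lborel (\<lambda>x. ?w x * h (y + r *\<^sub>R x))"
    using kernel_integrable(1)[OF kernel_bump chr] by simp
  have i2: "integrable lborel (\<lambda>x. ?w x * (h (y + r *\<^sub>R x))\<^sup>2)"
    using kernel_integrable(1)[OF kernel_bump continuous_on_power[OF chr]] by simp
  have mv: "(LINT x|lborel. ?w x * h (y + r *\<^sub>R x)) = m * h y"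
    using harmonic_mean_value[OF har b] r by (simp add: m_def bump_mass_def)
  have "0 \<le> (LINT x|lborel. ?w x * (h (y + r *\<^sub>R x) - h y)\<^sup>2)"
    by (intro Bochner_Integration.integral_nonneg) auto
  also have "(\<lambda>x. ?w x * (h (y + r *\<^sub>R x) - h y)\<^sup>2) = (\<lambda>x. ?w x * (h (y + r *\<^sub>R x))\<^sup>2 - (2 * h y) * (?w x * h (y + r *\<^sub>R x)) + (h y)\<^sup>2 * ?w x)"
    by (auto simp: fun_eq_iff power2_eq_square algebra_simps)
  also have "(LINT x|lborel. ?w x * (h (y + r *\<^sub>R x))\<^sup>2 - (2 * h y) * (?w x * h (y + r *\<^sub>R x)) + (h y)\<^sup>2 * ?w x)
     = (LINT x|lborel. ?w x * (h (y + r *\<^sub>R x))\<^sup>2) - (2 * h y) * (m * h y) + (h y)\<^sup>2 * m"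
    using i0 i1 i2 by (simp add: mv) (simp add: m_def bump_mass_def)
  finally have 1: "m * (h y)\<^sup>2 \<le> (LINT x|lborel. ?w x * (h (y + r *\<^sub>R x))\<^sup>2)"
    by (simp add: power2_eq_square algebra_simps)
  let ?g = "\<lambda>x. indicator (cball y r) x * (h x)\<^sup>2"
  have ig: "integrable lborel ?g"
    using borel_integrable_compact[OF compact_cball, of y r "\<lambda>x. (h x)\<^sup>2"] continuous_on_subset[OF ch b]
    by (auto intro: continuous_intros)
  have igr: "integrable lborel (\<lambda>x. ?g (y + r *\<^sub>R x))"
  proof -
    have "(\<lambda>x. ?g (y + r *\<^sub>R x)) = (\<lambda>x. indicator (cball 0 1) x *\<^sub>R (h (y + r *\<^sub>R x))\<^sup>2)"
      using r by (auto simp: fun_eq_iff indicator_def dist_norm)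
    then show ?thesis using borel_integrable_compact[OF compact_cball continuous_on_power[OF chr]] by simp
  qed
  have "(LINT x|lborel. ?w x * (h (y + r *\<^sub>R x))\<^sup>2) \<le> (LINT x|lborel. ?g (y + r *\<^sub>R x))"
  proof (rule Bochner_Integration.integral_mono[OF i2 igr])
    fix x :: "real^'n"
    show "?w x * (h (y + r *\<^sub>R x))\<^sup>2 \<le> ?g (y + r *\<^sub>R x)"
    proof (cases "norm x \<le> 1")
      case True
      have "?w x \<le> 1" using cutoff_le_1[of x] by (simp add: power_le_one)
      then show ?thesis using mem[OF True] by (simp add: mult_left_le_one_le)
    qed (simp add: cutoff_eq_0)
  qed
  with 1 have "r ^ CARD('n) * (m * (h y)\<^sup>2) \<le> r ^ CARD('n) * (LINT x|lborel. ?g (y + r *\<^sub>R x))"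
    using r by (intro mult_left_mono) auto
  also have "\<dots> = integral\<^sup>L lborel ?g"
    using lborel_integral_affine[OF r, of ?g y] borel_measurable_integrable[OF ig] by simp
  also have "\<dots> \<le> (LINT x:S|lborel. (h x)\<^sup>2)"
    unfolding set_lebesgue_integral_def
  proof (rule Bochner_Integration.integral_mono[OF ig])
    show "integrable lborel (\<lambda>x. indicator S x *\<^sub>R (h x)\<^sup>2)"
      using int by (simp add: set_integrable_def)
    show "?g x \<le> indicator S x *\<^sub>R (h x)\<^sup>2" for x
      using b by (cases "x \<in> cball y r") (auto simp: indicator_def)
  qed
  finally show ?thesis by (simp add: m_def mult_ac)
qed

section \<open>The maximum principle and boundary charts\<close>

text \<open>Second derivative test along each axis: were a diagonal entry positive, the partial
  derivative, which is 0 at \<open>x\<close>, would become positive just beyond, and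
  \<open>f\<close> would exceed its maximum.\<close>

lemma interior_maximum:
  fixes f :: "real^'n \<Rightarrow> real"
  assumes C2: "has_C2 f F H S" and x: "x \<in> S" and m: "\<And>y. y \<in> S \<Longrightarrow> f y \<le> f x"
  shows "F x = 0" "trace (H x) \<le> 0"
proof -
  have S: "open S" and d: "\<And>x. x \<in> S \<Longrightarrow> (f has_derivative (\<lambda>v. F x \<bullet> v)) (at x)"
    "\<And>x. x \<in> S \<Longrightarrow> (F has_derivative (\<lambda>v. H x *v v)) (at x)"
    using C2 by (auto simp: has_C2_def)
  have "(\<lambda>v. F x \<bullet> v) = (\<lambda>v. 0)"
    by (rule differential_zero_maxmin[OF x S d(1)[OF x]]) (use m in auto)
  from fun_cong[OF this, of "F x"] show F0: "F x = 0" by simp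
  have "H x $ i $ i \<le> 0" for i
  proof (rule ccontr)
    assume "\<not> H x $ i $ i \<le> 0"
    then have pos: "H x $ i $ i > 0" by simp
    have "((\<lambda>y. F y $ i) has_derivative (\<lambda>v. H x $ i \<bullet> v)) (at (x + 0 *\<^sub>R axis i 1))"
      using d(2)[OF x] by (simp add: has_derivative_matvec)
    from translate_dilate_derivative(3)[OF this]
    have "((\<lambda>t. F (x + t *\<^sub>R axis i 1) $ i) has_field_derivative H x $ i $ i) (at 0)"
      unfolding has_field_derivative_def by (rule has_derivative_eq_rhs) (simp add: fun_eq_iff inner_axis)
    from DERIV_pos_inc_right[OF this pos] obtain \<delta> where de: "\<delta> > 0"
      "\<And>t. t > 0 \<Longrightarrow> t < \<delta> \<Longrightarrow> F (x + t *\<^sub>R axis i 1) $ i > 0" using F0 by auto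
    obtain r where r: "r > 0" "cball x r \<subseteq> S" using S x open_contains_cball by blast
    define \<eta> where "\<eta> = min (\<delta> / 2) r"
    have e: "\<eta> > 0" "\<eta> < \<delta>" "\<eta> \<le> r" using de r by (auto simp: \<eta>_def)
    have mem: "x + t *\<^sub>R axis i 1 \<in> S" if "0 \<le> t" "t \<le> \<eta>" for t
      by (rule dilate_mem[OF r(2)]) (use that e in auto)
    have "\<exists>t\<in>{0<..<\<eta>}. f (x + \<eta> *\<^sub>R axis i 1) - f (x + 0 *\<^sub>R axis i 1) = F (x + t *\<^sub>R axis i 1) \<bullet> ((\<eta> - 0) *\<^sub>R axis i 1)"
    proof (rule mvt_simple[OF e(1)])
      fix t assume "0 \<le> t" "t \<le> \<eta>"
      then show "((\<lambda>t. f (x + t *\<^sub>R axis i 1)) has_derivative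
          (\<lambda>s. F (x + t *\<^sub>R axis i 1) \<bullet> (s *\<^sub>R axis i 1))) (at t within {0..\<eta>})"
        by (intro has_derivative_at_withinI[OF translate_dilate_derivative(3)[OF d(1)[OF mem]]])
    qed
    then obtain t where t: "0 < t" "t < \<eta>"
      "f (x + \<eta> *\<^sub>R axis i 1) - f x = F (x + t *\<^sub>R axis i 1) \<bullet> (\<eta> *\<^sub>R axis i 1)" by auto
    have "F (x + t *\<^sub>R axis i 1) $ i > 0" using t e by (intro de) auto
    then have "F (x + t *\<^sub>R axis i 1) \<bullet> (\<eta> *\<^sub>R axis i 1) > 0" using e by (simp add: inner_axis)
    then have "f (x + \<eta> *\<^sub>R axis i 1) > f x" using t by simp
    moreover have "f (x + \<eta> *\<^sub>R axis i 1) \<le> f x" using m mem e by simp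
    ultimately show False by simp
  qed
  then show "trace (H x) \<le> 0" by (simp add: trace_def sum_nonpos)
qed

text \<open>A small multiple of |x|^2 makes the trace strictly positive, which excludes an interior
  maximum. With factor e / R^2 this changes values by at most \<open>e\<close>.\<close>

lemma max_principle:
  fixes v :: "real^'n \<Rightarrow> real"
  assumes C2: "has_C2 v V H D" and bd: "bounded D" and tr: "\<And>x. x \<in> D \<Longrightarrow> trace (H x) \<ge> 0"
    and c: "continuous_on (closure D) v" and fr: "\<And>x. x \<in> frontier D \<Longrightarrow> v x \<le> 0"
    and x: "x \<in> closure D"
  shows "v x \<le> 0"
proof -
  have D: "open D" using C2 by (simp add: has_C2_def)
  obtain R where R: "R > 0" "\<And>x. x \<in> closure D \<Longrightarrow> norm x \<le> R"
    using bounded_closure[OF bd] unfolding bounded_pos by blast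
  have "v x \<le> 0 + e" if e: "e > 0" for e
  proof -
    define \<epsilon> where "\<epsilon> = e / R\<^sup>2"
    have ep: "\<epsilon> > 0" using e R by (simp add: \<epsilon>_def)
    define w where "w x = v x + \<epsilon> * ((dist x 0)\<^sup>2 / 2)" for x
    have C2w: "has_C2 w (\<lambda>x. V x + \<epsilon> *\<^sub>R (x - 0)) (\<lambda>x. H x + \<epsilon> *\<^sub>R mat 1) D"
      unfolding w_def by (intro has_C2_add C2 has_C2_cmult has_C2_quadratic D)
    have cw: "continuous_on (closure D) w" unfolding w_def by (intro continuous_intros c) auto
    obtain m where m: "m \<in> closure D" "\<And>y. y \<in> closure D \<Longrightarrow> w y \<le> w m"
      using continuous_attains_sup[OF _ _ cw] bd x by (metis compact_closure empty_iff)
    have "m \<notin> D"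
    proof
      assume mD: "m \<in> D"
      have "trace (H m + \<epsilon> *\<^sub>R mat 1) \<le> 0"
        by (rule interior_maximum(2)[OF C2w mD]) (use m closure_subset in blast)
      moreover have "trace (H m + \<epsilon> *\<^sub>R mat 1) > 0"
        using tr[OF mD] ep by (simp add: add_nonneg_pos)
      ultimately show False by simp
    qed
    then have "v m \<le> 0" using m D by (intro fr) (simp add: frontier_def interior_open)
    have "v x \<le> w x" using ep by (simp add: w_def)
    also have "\<dots> \<le> w m" by (rule m(2)[OF x])
    also have "\<dots> \<le> \<epsilon> * ((norm m)\<^sup>2 / 2)" using \<open>v m \<le> 0\<close> by (simp add: w_def)
    also have "\<dots> \<le> \<epsilon> * R\<^sup>2"
    proof -
      have "(norm m)\<^sup>2 \<le> R\<^sup>2" using R(2)[OF m(1)] by (intro power_mono) auto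
      then have "(norm m)\<^sup>2 / 2 \<le> R\<^sup>2" using zero_le_power2[of R] by linarith
      then show ?thesis using ep by (intro mult_left_mono) auto
    qed
    also have "\<dots> = e" using R by (simp add: \<epsilon>_def)
    finally show ?thesis by simp
  qed
  then show ?thesis by (rule field_le_epsilon)
qed

section \<open>Second derivatives of products and compositions\<close>

definition tensor :: "real^'n \<Rightarrow> real^'n \<Rightarrow> real^'n^'n" where
  "tensor a b = (\<chi> i j. a $ i * b $ j)"

lemma tensor_mult_vec: "tensor a b *v v = (b \<bullet> v) *\<^sub>R a"
  by (simp add: tensor_def matrix_vector_mult_def vec_eq_iff inner_vec_def sum_distrib_right sum_distrib_left mult_ac)

lemma trace_tensor [simp]: "trace (tensor a b) = a \<bullet> b"
  by (simp add: tensor_def trace_def inner_vec_def)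

lemma continuous_on_tensor [continuous_intros]:
  "continuous_on S f \<Longrightarrow> continuous_on S g \<Longrightarrow> continuous_on S (\<lambda>x. tensor (f x) (g x))"
  unfolding tensor_def by (intro continuous_intros)

lemma has_C2_mult:
  assumes f: "has_C2 f F H S" and g: "has_C2 g G K S"
  shows "has_C2 (\<lambda>x. f x * g x) (\<lambda>x. f x *\<^sub>R G x + g x *\<^sub>R F x)
    (\<lambda>x. f x *\<^sub>R K x + g x *\<^sub>R H x + tensor (G x) (F x) + tensor (F x) (G x)) S"
  unfolding has_C2_def
proof (intro conjI ballI)
  note cont = has_C2_continuous[OF f] has_C2_continuous[OF g] has_C2_continuous_grad[OF f] has_C2_continuous_grad[OF g]
  show "open S" using f by (simp add: has_C2_def)
  show "continuous_on S (\<lambda>x. f x *\<^sub>R K x + g x *\<^sub>R H x + tensor (G x) (F x) + tensor (F x) (G x))"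
    using f g by (intro continuous_intros cont) (auto simp: has_C2_def)
  fix x assume x: "x \<in> S"
  have d: "(f has_derivative (\<lambda>v. F x \<bullet> v)) (at x)" "(F has_derivative (\<lambda>v. H x *v v)) (at x)"
    "(g has_derivative (\<lambda>v. G x \<bullet> v)) (at x)" "(G has_derivative (\<lambda>v. K x *v v)) (at x)"
    using f g x by (auto simp: has_C2_def)
  show "((\<lambda>x. f x * g x) has_derivative (\<bullet>) (f x *\<^sub>R G x + g x *\<^sub>R F x)) (at x)"
    by (rule has_derivative_eq_rhs[OF has_derivative_mult[OF d(1,3)]]) (simp add: fun_eq_iff inner_add_left)
  have "((\<lambda>x. f x *\<^sub>R G x + g x *\<^sub>R F x) has_derivative
     (\<lambda>v. (f x *\<^sub>R (K x *v v) + (F x \<bullet> v) *\<^sub>R G x) + (g x *\<^sub>R (H x *v v) + (G x \<bullet> v) *\<^sub>R F x))) (at x)"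
    by (intro has_derivative_add has_derivative_scaleR d)
  then show "((\<lambda>x. f x *\<^sub>R G x + g x *\<^sub>R F x) has_derivative
     (*v) (f x *\<^sub>R K x + g x *\<^sub>R H x + tensor (G x) (F x) + tensor (F x) (G x))) (at x)"
    by (rule has_derivative_eq_rhs)
      (simp add: fun_eq_iff matrix_vector_mult_add_rdistrib tensor_mult_vec flip: scaleR_matrix_vector_assoc)
qed

lemma has_C2_compose:
  assumes f: "has_C2 f F H S"
    and d1: "\<And>x. x \<in> S \<Longrightarrow> (\<phi> has_field_derivative \<phi>' (f x)) (at (f x))"
    and d2: "\<And>x. x \<in> S \<Longrightarrow> (\<phi>' has_field_derivative \<phi>'' (f x)) (at (f x))"
    and c: "continuous_on S (\<lambda>x. \<phi>'' (f x))"
  shows "has_C2 (\<lambda>x. \<phi> (f x)) (\<lambda>x. \<phi>' (f x) *\<^sub>R F x)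
    (\<lambda>x. \<phi>' (f x) *\<^sub>R H x + \<phi>'' (f x) *\<^sub>R tensor (F x) (F x)) S"
  unfolding has_C2_def
proof (intro conjI ballI)
  show "open S" using f by (simp add: has_C2_def)
  have df: "(f has_derivative (\<lambda>v. F x \<bullet> v)) (at x)" "(F has_derivative (\<lambda>v. H x *v v)) (at x)" if "x \<in> S" for x
    using f that by (auto simp: has_C2_def)
  have dc: "((\<lambda>x. \<phi>' (f x)) has_derivative (\<lambda>v. \<phi>'' (f x) * (F x \<bullet> v))) (at x)" if "x \<in> S" for x
    using DERIV_compose_FDERIV[OF d2 df(1)] that by (simp add: mult.commute)
  have "continuous_on S (\<lambda>x. \<phi>' (f x))"
    by (rule has_derivative_continuous_on[OF has_derivative_at_withinI[OF dc]])
  then show "continuous_on S (\<lambda>x. \<phi>' (f x) *\<^sub>R H x + \<phi>'' (f x) *\<^sub>R tensor (F x) (F x))"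
    using f by (intro continuous_intros c has_C2_continuous_grad[OF f]) (auto simp: has_C2_def)
  fix x assume x: "x \<in> S"
  show "((\<lambda>x. \<phi> (f x)) has_derivative (\<bullet>) (\<phi>' (f x) *\<^sub>R F x)) (at x)"
    by (rule has_derivative_eq_rhs[OF DERIV_compose_FDERIV[OF d1[OF x] df(1)[OF x]]]) (simp add: fun_eq_iff)
  have "((\<lambda>x. \<phi>' (f x) *\<^sub>R F x) has_derivative
      (\<lambda>v. \<phi>' (f x) *\<^sub>R (H x *v v) + (\<phi>'' (f x) * (F x \<bullet> v)) *\<^sub>R F x)) (at x)"
    by (intro has_derivative_scaleR dc df x)
  then show "((\<lambda>x. \<phi>' (f x) *\<^sub>R F x) has_derivative
      (*v) (\<phi>' (f x) *\<^sub>R H x + \<phi>'' (f x) *\<^sub>R tensor (F x) (F x))) (at x)"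
    by (rule has_derivative_eq_rhs)
      (simp add: fun_eq_iff matrix_vector_mult_add_rdistrib tensor_mult_vec flip: scaleR_matrix_vector_assoc)
qed

text \<open>\<open>norm\<close> on matrices is the Hilbert-Schmidt norm, so this is Cauchy-Schwarz
  row by row.\<close>

lemma norm_matrix_vec_le: "norm (A *v x) \<le> norm (A::real^'n^'m) * norm x"
proof -
  have comp: "(A *v x) $ i = A $ i \<bullet> x" for i
    by (simp add: matrix_vector_mult_def inner_vec_def)
  have "(norm (A *v x))\<^sup>2 = (\<Sum>i\<in>UNIV. (A *v x) $ i * (A *v x) $ i)"
    unfolding power2_norm_eq_inner inner_vec_def by simp
  also have "\<dots> = (\<Sum>i\<in>UNIV. (A $ i \<bullet> x)\<^sup>2)" by (simp only: comp power2_eq_square)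
  also have "\<dots> \<le> (\<Sum>i\<in>UNIV. (norm (A $ i))\<^sup>2 * (norm x)\<^sup>2)"
    by (intro sum_mono) (metis Cauchy_Schwarz_ineq power2_norm_eq_inner)
  also have "\<dots> = (\<Sum>i\<in>UNIV. (norm (A $ i))\<^sup>2) * (norm x)\<^sup>2" by (rule sum_distrib_right[symmetric])
  also have "(\<Sum>i\<in>UNIV. (norm (A $ i))\<^sup>2) = (norm A)\<^sup>2"
    unfolding power2_norm_eq_inner inner_vec_def[of A] ..
  also have "(norm A)\<^sup>2 * (norm x)\<^sup>2 = (norm A * norm x)\<^sup>2" by (rule power_mult_distrib[symmetric])
  finally show ?thesis by (rule power2_le_imp_le) simp
qed

lemma gradient_bound_on_ball:
  fixes f :: "real^'n \<Rightarrow> real"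
  assumes d: "\<And>x. x \<in> ball c r \<Longrightarrow> (f has_derivative (\<lambda>v. F x \<bullet> v)) (at x)"
    and b: "\<And>x. x \<in> ball c r \<Longrightarrow> norm (F x) \<le> M" and xy: "x \<in> ball c r" "y \<in> ball c r"
  shows "\<bar>f x - f y\<bar> \<le> M * dist x y"
proof -
  have "norm (f x - f y) \<le> M * norm (x - y)"
  proof (rule differentiable_bound[OF convex_ball _ _ xy])
    fix w assume w: "w \<in> ball c r"
    show "(f has_derivative (\<lambda>v. F w \<bullet> v)) (at w within ball c r)"
      using d[OF w] by (rule has_derivative_at_withinI)
    show "onorm (\<lambda>v. F w \<bullet> v) \<le> M"
    proof (rule onorm_le)
      fix v
      have "norm (F w \<bullet> v) \<le> norm (F w) * norm v" by (simp add: Cauchy_Schwarz_ineq2)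
      also have "\<dots> \<le> M * norm v" using b[OF w] by (intro mult_right_mono) auto
      finally show "norm (F w \<bullet> v) \<le> M * norm v" .
    qed
  qed
  then show ?thesis by (simp add: dist_norm)
qed

text \<open>A boundary chart with constant \<open>K\<close>: near \<open>p\<close> the set \<open>\<Omega>\<close> lies above the graph of a
  \<open>C\<^sup>1\<^sup>,\<^sup>1\<close> function \<open>g\<close> with gradient \<open>G\<close>; \<open>x \<bullet> e - g x\<close> is the height above the graph.\<close>

definition chart :: "(real^'n) set \<Rightarrow> real^'n \<Rightarrow> real \<Rightarrow> real^'n \<Rightarrow> (real^'n \<Rightarrow> real) \<Rightarrow> (real^'n \<Rightarrow> real^'n) \<Rightarrow> real \<Rightarrow> bool"
  where "chart \<Omega> p r e g G K \<longleftrightarrow> r > 0 \<and> K \<ge> 1 \<and> norm e = 1 \<and> (\<forall>x t. g (x + t *\<^sub>R e) = g x) \<and>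
    \<Omega> \<inter> ball p r = {x \<in> ball p r. x \<bullet> e > g x} \<and>
    (\<forall>x\<in>ball p r. G x \<bullet> e = 0 \<and> norm (G x) \<le> K) \<and>
    (\<forall>x\<in>ball p r. \<forall>y\<in>ball p r. norm (G x - G y) \<le> K * dist x y \<and> \<bar>g x - g y\<bar> \<le> K * dist x y \<and>
       \<bar>g y - g x - G x \<bullet> (y - x)\<bar> \<le> K * (dist x y)\<^sup>2)"

text \<open>The Hoelder condition bounds the Hessian of \<open>g\<close> on the whole open ball,
  which its continuity alone would not do. The Lipschitz bound for the gradient and the quadratic
  Taylor remainder follow by mean value inequalities.\<close>

lemma C2alpha_boundary_chart:
  fixes \<Omega> :: "(real^'n) set"
  assumes b: "C2alpha_boundary \<alpha> \<Omega>" and p: "p \<in> frontier \<Omega>" and al: "\<alpha> > 0"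
  shows "\<exists>r e g G K. chart \<Omega> p r e g G K"
proof -
  obtain r e g where r: "r > 0" and e: "norm e = 1" "\<And>x t. g (x + t *\<^sub>R e) = g x"
    and g: "C2alpha_on \<alpha> (ball p r) g" and eq: "\<Omega> \<inter> ball p r = {x \<in> ball p r. x \<bullet> e > g x}"
    using b p unfolding C2alpha_boundary_def by blast
  define G where "G = grad g"
  define H where "H x = (\<chi> i j. hess g x $ j $ i)" for x
  have C2: "has_C2 g G H (ball p r)"
    unfolding G_def H_def using g by (intro C2_on_has_C2) (auto simp: C2alpha_on_def)
  obtain L where L: "\<And>x y i j. x \<in> ball p r \<Longrightarrow> y \<in> ball p r \<Longrightarrow> \<bar>hess g x $ i $ j - hess g y $ i $ j\<bar> \<le> L * dist x y powr \<alpha>"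
    using g unfolding C2alpha_on_def by blast
  define B where "B = (\<Sum>i\<in>(UNIV::'n set). \<Sum>j\<in>(UNIV::'n set). (\<bar>hess g p $ j $ i\<bar> + \<bar>L\<bar> * r powr \<alpha>)\<^sup>2)"
  have Hb: "norm (H x) \<le> sqrt B" if x: "x \<in> ball p r" for x
  proof -
    have "\<bar>hess g x $ j $ i\<bar> \<le> \<bar>hess g p $ j $ i\<bar> + \<bar>L\<bar> * r powr \<alpha>" for i j
    proof -
      have "\<bar>hess g x $ j $ i - hess g p $ j $ i\<bar> \<le> L * dist x p powr \<alpha>"
        using L[OF x, of p j i] r by simp
      also have "\<dots> \<le> \<bar>L\<bar> * r powr \<alpha>"
        using x al by (intro mult_mono powr_mono2) (auto simp: dist_commute)
      finally show ?thesis by linarith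
    qed
    then have "(norm (H x))\<^sup>2 \<le> B"
      unfolding norm_matrix_sq B_def H_def
      by (intro sum_mono) (simp, metis abs_ge_zero power2_abs power_mono)
    then show ?thesis using real_le_rsqrt by blast
  qed
  have d: "(g has_derivative (\<lambda>v. G x \<bullet> v)) (at x)" "(G has_derivative (\<lambda>v. H x *v v)) (at x)" if "x \<in> ball p r" for x
    using C2 that unfolding has_C2_def by auto
  have B0: "sqrt B \<ge> 0" by (simp add: B_def sum_nonneg)
  have GL: "norm (G x - G y) \<le> sqrt B * norm (x - y)" if "x \<in> ball p r" "y \<in> ball p r" for x y
  proof (rule differentiable_bound[OF convex_ball _ _ that(1) that(2)])
    fix x assume x: "x \<in> ball p r"
    show "(G has_derivative (\<lambda>v. H x *v v)) (at x within ball p r)"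
      using d(2)[OF x] by (rule has_derivative_at_withinI)
    show "onorm (\<lambda>v. H x *v v) \<le> sqrt B"
    proof (rule onorm_le)
      fix v show "norm (H x *v v) \<le> sqrt B * norm v"
        using norm_matrix_vec_le[of "H x" v] mult_right_mono[OF Hb[OF x], of "norm v"] by simp
    qed
  qed
  \<comment> \<open>One constant above all the bounds required of a chart, and at least 1 so that it
    can be divided by.\<close>
  define K where "K = 1 + sqrt B + norm (G p) + sqrt B * r"
  have K: "K \<ge> 1" "sqrt B \<le> K" using B0 r by (auto simp: K_def)
  have Gb: "norm (G x) \<le> K" if x: "x \<in> ball p r" for x
  proof -
    have "norm (G x) \<le> norm (G p) + norm (G x - G p)" by (metis norm_triangle_sub)
    also have "norm (G x - G p) \<le> sqrt B * norm (x - p)" using GL[OF x] r by simp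
    also have "\<dots> \<le> sqrt B * r" using x B0 by (intro mult_left_mono) (auto simp: dist_norm norm_minus_commute)
    finally show ?thesis using B0 unfolding K_def by linarith
  qed
  have Ge: "G x \<bullet> e = 0" if x: "x \<in> ball p r" for x
  proof -
    have "(g has_derivative (\<lambda>v. G x \<bullet> v)) (at (x + 0 *\<^sub>R e))" using d(1)[OF x] by simp
    from translate_dilate_derivative(3)[OF this]
    have "((\<lambda>r. g x) has_derivative (\<lambda>s. G x \<bullet> (s *\<^sub>R e))) (at (0::real))" by (simp add: e(2))
    then have "(\<lambda>s. G x \<bullet> (s *\<^sub>R e)) = (\<lambda>s::real. 0)"
      by (intro has_derivative_unique) auto
    from fun_cong[OF this, of 1] show ?thesis by simp
  qed
  have gT: "\<bar>g y - g x - G x \<bullet> (y - x)\<bar> \<le> K * (dist x y)\<^sup>2" if x: "x \<in> ball p r" and y: "y \<in> ball p r" for x y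
  proof -
    have seg: "closed_segment x y \<subseteq> ball p r"
      using x y by (simp add: closed_segment_subset)
    have "norm ((g y - G x \<bullet> y) - (g x - G x \<bullet> x)) \<le> (sqrt B * norm (y - x)) * norm (y - x)"
    proof (rule differentiable_bound[of "closed_segment x y" "\<lambda>z. g z - G x \<bullet> z" "\<lambda>z v. (G z - G x) \<bullet> v"])
      fix z assume z: "z \<in> closed_segment x y"
      have "((\<lambda>z. g z - G x \<bullet> z) has_derivative (\<lambda>v. G z \<bullet> v - G x \<bullet> v)) (at z)"
        using seg z by (intro has_derivative_diff d has_derivative_inner_right has_derivative_ident) auto
      then show "((\<lambda>z. g z - G x \<bullet> z) has_derivative (\<lambda>v. (G z - G x) \<bullet> v)) (at z within closed_segment x y)"
        by (simp add: inner_diff_left has_derivative_at_withinI)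
      show "onorm (\<lambda>v. (G z - G x) \<bullet> v) \<le> sqrt B * norm (y - x)"
      proof (rule onorm_le)
        fix v
        have "norm ((G z - G x) \<bullet> v) \<le> norm (G z - G x) * norm v" by (simp add: Cauchy_Schwarz_ineq2)
        also have "norm (G z - G x) \<le> sqrt B * norm (z - x)" using GL[of z x] seg z x by auto
        also have "norm (z - x) \<le> norm (y - x)"
          using segment_bound(1)[OF z] by (simp add: norm_minus_commute)
        finally show "norm ((G z - G x) \<bullet> v) \<le> sqrt B * norm (y - x) * norm v"
          using B0 by (simp add: mult_left_mono mult_right_mono)
      qed
    qed auto
    also have "\<dots> = sqrt B * (dist x y)\<^sup>2" by (simp add: dist_norm norm_minus_commute power2_eq_square)
    also have "\<dots> \<le> K * (dist x y)\<^sup>2" using K by (intro mult_right_mono) auto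
    finally show ?thesis by (simp add: inner_diff_right algebra_simps)
  qed
  have gL: "\<bar>g x - g y\<bar> \<le> K * dist x y" if "x \<in> ball p r" "y \<in> ball p r" for x y
    by (rule gradient_bound_on_ball[OF d(1) Gb that])
  have GK: "norm (G x - G y) \<le> K * dist x y" if "x \<in> ball p r" "y \<in> ball p r" for x y
    using GL[OF that] mult_right_mono[OF K(2), of "norm (x - y)"] by (simp add: dist_norm)
  have "chart \<Omega> p r e g G K"
    unfolding chart_def by (intro conjI ballI allI r K(1) e eq Ge Gb GK gL gT)
  then show ?thesis by blast
qed

lemma chart_cont:
  assumes "chart \<Omega> p r e g G K"
  shows "continuous_on (ball p r) g"
proof (rule lipschitz_on_continuous_on)
  have "\<forall>x\<in>ball p r. \<forall>y\<in>ball p r. \<bar>g x - g y\<bar> \<le> K * dist x y" "K \<ge> 1"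
    using assms unfolding chart_def by blast+
  then show "K-lipschitz_on (ball p r) g"
    unfolding lipschitz_on_def by (simp add: dist_real_def)
qed

text \<open>The height \<open>x \<bullet> e - g x\<close> is continuous and grows at unit speed
  along \<open>e\<close>, since \<open>g\<close> is constant in that direction. So points of height
  0 are limits of points of the domain, and points of negative height are not.\<close>

lemma chart_frontier:
  assumes ch: "chart \<Omega> p r e g G K" and o: "open \<Omega>" and x: "x \<in> ball p r"
  shows "x \<in> \<Omega> \<longleftrightarrow> x \<bullet> e > g x" "x \<in> closure \<Omega> \<longleftrightarrow> x \<bullet> e \<ge> g x" "x \<in> frontier \<Omega> \<longleftrightarrow> x \<bullet> e = g x"
proof -
  have c: "r > 0" "norm e = 1" "\<And>x t. g (x + t *\<^sub>R e) = g x" "\<Omega> \<inter> ball p r = {x \<in> ball p r. x \<bullet> e > g x}"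
    using ch unfolding chart_def by blast+
  have 1: "x \<in> \<Omega> \<longleftrightarrow> x \<bullet> e > g x" if "x \<in> ball p r" for x using c(4) that by blast
  have 2: "x \<in> closure \<Omega> \<longleftrightarrow> x \<bullet> e \<ge> g x"
  proof
    assume a: "x \<in> closure \<Omega>"
    show "x \<bullet> e \<ge> g x"
    proof (rule ccontr)
      assume "\<not> x \<bullet> e \<ge> g x"
      then have lt: "g x - x \<bullet> e > 0" by simp
      have "isCont g x" using chart_cont[OF ch] x by (simp add: continuous_on_eq_continuous_at)
      then have "isCont (\<lambda>y. g y - y \<bullet> e) x" by (intro continuous_intros)
      then obtain \<delta> where de: "\<delta> > 0" "\<And>y. dist y x < \<delta> \<Longrightarrow> \<bar>(g y - y \<bullet> e) - (g x - x \<bullet> e)\<bar> < g x - x \<bullet> e"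
        using lt unfolding continuous_at_eps_delta dist_real_def by meson
      have "min \<delta> (r - dist p x) > 0" using de x by simp
      then obtain y where y: "y \<in> \<Omega>" "dist y x < min \<delta> (r - dist p x)"
        using a unfolding closure_approachable by blast
      then have "y \<in> ball p r" using dist_triangle[of p y x] by (simp add: dist_commute)
      then have "y \<bullet> e > g y" using 1 y by blast
      then show False using de(2)[of y] y by (simp add: abs_if split: if_splits)
    qed
  next
    assume a: "x \<bullet> e \<ge> g x"
    show "x \<in> closure \<Omega>"
      unfolding closure_approachable
    proof (intro allI impI)
      fix \<epsilon> :: real assume ep: "\<epsilon> > 0"
      define t where "t = min (\<epsilon> / 2) ((r - dist p x) / 2)"
      have t: "t > 0" "t < \<epsilon>" "t < r - dist p x" using ep x by (auto simp: t_def min_def field_simps)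
      have dt: "dist (x + t *\<^sub>R e) x = t" using t c by (simp add: dist_norm)
      then have b: "x + t *\<^sub>R e \<in> ball p r"
        using dist_triangle[of p "x + t *\<^sub>R e" x] t by (simp add: dist_commute)
      have "(x + t *\<^sub>R e) \<bullet> e = x \<bullet> e + t"
        using c(2) by (simp add: inner_add_left power2_norm_eq_inner[symmetric])
      then have "x + t *\<^sub>R e \<in> \<Omega>" using 1[OF b] a t c(3) by simp
      then show "\<exists>y\<in>\<Omega>. dist y x < \<epsilon>" using dt t by (metis)
    qed
  qed
  show "x \<in> \<Omega> \<longleftrightarrow> x \<bullet> e > g x" using 1[OF x] .
  show "x \<in> closure \<Omega> \<longleftrightarrow> x \<bullet> e \<ge> g x" by (rule 2)
  show "x \<in> frontier \<Omega> \<longleftrightarrow> x \<bullet> e = g x"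
    using 1[OF x] 2 o by (auto simp: frontier_def interior_open)
qed

section \<open>Boundary growth and gradient bound\<close>

text \<open>The local claim is asked for all smaller radii, so that it survives taking the minimum
  over a finite subcover.\<close>

lemma compact_uniform:
  fixes S :: "'a::metric_space set"
  assumes "compact S"
    and loc: "\<And>p. p \<in> S \<Longrightarrow> \<exists>R>0. \<exists>\<rho>>0. \<forall>q\<in>S \<inter> ball p \<rho>. \<forall>R'. 0 < R' \<and> R' \<le> R \<longrightarrow> P q R'"
  shows "\<exists>R>(0::real). \<forall>q\<in>S. P q R"
proof -
  obtain R \<rho> where R: "\<And>p. p \<in> S \<Longrightarrow> R p > 0 \<and> \<rho> p > 0 \<and> (\<forall>q\<in>S \<inter> ball p (\<rho> p). \<forall>R'. 0 < R' \<and> R' \<le> R p \<longrightarrow> P q R')"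
    using loc by metis
  have "S \<subseteq> (\<Union>p\<in>S. ball p (\<rho> p))" using R by force
  then obtain D where D: "D \<subseteq> S" "finite D" "S \<subseteq> (\<Union>p\<in>D. ball p (\<rho> p))"
    using compactE_image[OF assms(1), of S "\<lambda>p. ball p (\<rho> p)"] by auto
  define R0 where "R0 = Min (insert 1 (R ` D))"
  have R0: "R0 > 0" "\<And>p. p \<in> D \<Longrightarrow> R0 \<le> R p"
    using D R by (auto simp: R0_def)
  have "P q R0" if "q \<in> S" for q
  proof -
    obtain p where p: "p \<in> D" "q \<in> ball p (\<rho> p)" using D(3) \<open>q \<in> S\<close> by blast
    then show ?thesis using R[of p] D(1) R0 \<open>q \<in> S\<close> by blast
  qed
  then show ?thesis using R0 by blast
qed

text \<open>Near \<open>q\<close> the domain lies above a downward paraboloid of curvature governed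
  by \<open>K\<close>. A point of the ball on the outer normal would satisfy 2 R (x - q) . (e - G q)
  < - |x - q|^2, which contradicts the paraboloid bound as soon as 2 R K <= 1.\<close>

lemma chart_exterior_ball:
  fixes \<Omega> :: "(real^'n) set"
  assumes ch: "chart \<Omega> p r e g G K" and o: "open \<Omega>" and q: "q \<in> frontier \<Omega>" "q \<in> ball p (r / 2)"
    and R: "R > 0" "R \<le> r / 4" "R \<le> 1 / (2 * K)"
  shows "\<exists>c. dist q c = R \<and> ball c R \<inter> \<Omega> = {}"
proof -
  have c: "r > 0" "K \<ge> 1" "norm e = 1"
    and G: "\<forall>x\<in>ball p r. G x \<bullet> e = 0 \<and> norm (G x) \<le> K"
    and T: "\<forall>x\<in>ball p r. \<forall>y\<in>ball p r. \<bar>g y - g x - G x \<bullet> (y - x)\<bar> \<le> K * (dist x y)\<^sup>2"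
    using ch unfolding chart_def by blast+
  have qb: "q \<in> ball p r" using q c by auto
  \<comment> \<open>Length of the normal \<open>e - G q\<close>. Since \<open>G q\<close> is
    orthogonal to \<open>e\<close>, its component along \<open>e\<close> is 1, so the length is at
    least 1.\<close>
  define a where "a = norm (e - G q)"
  have "(e - G q) \<bullet> e = 1"
    using G[rule_format, OF qb] c by (simp add: inner_diff_left power2_norm_eq_inner[symmetric])
  then have a1: "a \<ge> 1"
    using norm_cauchy_schwarz[of "e - G q" e] c by (simp add: a_def)
  define n where "n = (1 / a) *\<^sub>R (e - G q)"
  have n1: "norm n = 1" using a1 by (auto simp: n_def a_def)
  let ?c = "q - R *\<^sub>R n"
  have d: "dist q ?c = R" using R n1 by (simp add: dist_norm)
  have "x \<notin> \<Omega>" if x: "x \<in> ball ?c R" for x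
  proof
    assume xO: "x \<in> \<Omega>"
    have dxq: "dist q x < 2 * R" using x d dist_triangle[of q x ?c] by simp
    have "dist p x \<le> dist p q + dist q x" by (rule dist_triangle)
    also have "\<dots> < r / 2 + 2 * R" using q dxq by (intro add_strict_mono) auto
    also have "\<dots> \<le> r" using R by simp
    finally have xb: "x \<in> ball p r" by simp
    have xe: "x \<bullet> e > g x" using chart_frontier(1)[OF ch o xb] xO by simp
    have qe: "q \<bullet> e = g q" using chart_frontier(3)[OF ch o qb] q by simp
    have t: "\<bar>g x - g q - G q \<bullet> (x - q)\<bar> \<le> K * (dist q x)\<^sup>2" using T qb xb by blast
    have low: "(x - q) \<bullet> (e - G q) > - K * (dist q x)\<^sup>2"
      using xe qe t by (simp add: inner_diff_left inner_diff_right inner_commute abs_le_iff)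
    have "(norm (x - q + R *\<^sub>R n))\<^sup>2 < R\<^sup>2"
      using x by (intro power_strict_mono) (auto simp: dist_norm norm_minus_commute algebra_simps)
    moreover have "(norm (x - q + R *\<^sub>R n))\<^sup>2 = (dist q x)\<^sup>2 + 2 * R * ((x - q) \<bullet> n) + R\<^sup>2"
    proof -
      have "(norm (y + R *\<^sub>R n))\<^sup>2 = (norm y)\<^sup>2 + 2 * R * (y \<bullet> n) + R\<^sup>2 * (norm n)\<^sup>2" for y
        unfolding power2_norm_eq_inner
        by (simp add: inner_add_left inner_add_right inner_commute power2_eq_square[of R] algebra_simps)
      then show ?thesis using n1 by (simp add: dist_norm norm_minus_commute)
    qed
    ultimately have "2 * R * ((x - q) \<bullet> n) < - (dist q x)\<^sup>2" by simp
    moreover have "(x - q) \<bullet> (e - G q) = a * ((x - q) \<bullet> n)" using a1 by (simp add: n_def)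
    ultimately have "2 * R * ((x - q) \<bullet> (e - G q)) < a * (- (dist q x)\<^sup>2)"
      using mult_strict_left_mono[of "2 * R * ((x - q) \<bullet> n)" "- (dist q x)\<^sup>2" a] a1 by (simp add: mult_ac)
    also have "\<dots> \<le> 1 * (- (dist q x)\<^sup>2)" using a1 by (intro mult_right_mono_neg) auto
    finally have 1: "2 * R * ((x - q) \<bullet> (e - G q)) < - (dist q x)\<^sup>2" by simp
    have "2 * R * ((x - q) \<bullet> (e - G q)) > 2 * R * (- K * (dist q x)\<^sup>2)"
      using low R by (intro mult_strict_left_mono) auto
    moreover have "2 * R * (K * (dist q x)\<^sup>2) \<le> 1 * (dist q x)\<^sup>2"
    proof -
      have "2 * R * K \<le> 1" using R(3) c by (simp add: field_simps)
      then have "(2 * R * K) * (dist q x)\<^sup>2 \<le> 1 * (dist q x)\<^sup>2" by (intro mult_right_mono) auto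
      then show ?thesis by (simp add: mult.assoc)
    qed
    ultimately show False using 1 by linarith
  qed
  then show ?thesis using d by blast
qed

section \<open>The torsion function: sign, boundary growth, gradient bound\<close>

locale torsion =
  fixes \<Omega> :: "(real^'n) set" and \<alpha> :: real and u :: "real^'n \<Rightarrow> real"
  assumes open_dom: "open \<Omega>" and connected_dom: "connected \<Omega>" and bounded_dom: "bounded \<Omega>"
    and nonempty_dom: "\<Omega> \<noteq> {}" and alpha_pos: "0 < \<alpha>" and boundary: "C2alpha_boundary \<alpha> \<Omega>"
    and C2u: "C2_on \<Omega> u" and continuous_u: "continuous_on (closure \<Omega>) u"
    and laplace_u: "\<And>x. x \<in> \<Omega> \<Longrightarrow> lap u x = real CARD('n)"
    and boundary_u: "\<And>x. x \<in> frontier \<Omega> \<Longrightarrow> u x = 0"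
begin

definition U where "U = grad u"
definition HU where "HU x = (\<chi> i j. hess u x $ j $ i)"

lemma has_C2_u: "has_C2 u U HU \<Omega>"
  unfolding U_def HU_def[abs_def] by (intro C2_on_has_C2 open_dom C2u)

lemma trace_u: "x \<in> \<Omega> \<Longrightarrow> trace (HU x) = real CARD('n)"
  using has_C2_lap[OF has_C2_u] laplace_u by simp

lemma frontier_nonempty: "frontier \<Omega> \<noteq> {}"
  using nonempty_dom bounded_dom not_bounded_UNIV by (auto simp: frontier_eq_empty)

lemma compact_frontier_dom: "compact (frontier \<Omega>)"
  using bounded_dom by (rule compact_frontier_bounded)

lemma closure_dom_cases: "x \<in> closure \<Omega> \<Longrightarrow> x \<in> \<Omega> \<or> x \<in> frontier \<Omega>"
  using open_dom by (auto simp: frontier_def interior_open)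

lemma frontier_disjoint: "x \<in> frontier \<Omega> \<Longrightarrow> x \<notin> \<Omega>"
  using open_dom by (auto simp: frontier_def interior_open)

abbreviation bdist where "bdist x \<equiv> infdist x (frontier \<Omega>)"

lemma ball_bdist: "x \<in> \<Omega> \<Longrightarrow> r \<le> bdist x \<Longrightarrow> ball x r \<subseteq> \<Omega>"
proof (rule ccontr)
  assume x: "x \<in> \<Omega>" and r: "r \<le> bdist x" and "\<not> ball x r \<subseteq> \<Omega>"
  then obtain y0 where "y0 \<in> ball x r" "y0 \<notin> \<Omega>" by blast
  then have "x \<in> ball x r" by (metis centre_in_ball dist_not_less_zero mem_ball not_le order_le_less_trans zero_le_dist)
  then have "ball x r \<inter> frontier \<Omega> \<noteq> {}"
    using x \<open>y0 \<in> ball x r\<close> \<open>y0 \<notin> \<Omega>\<close> by (intro connected_Int_frontier convex_connected convex_ball) blast+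
  then obtain y where "y \<in> frontier \<Omega>" "dist x y < r" by auto
  then show False using infdist_le[of y "frontier \<Omega>" x] r by simp
qed

lemma bdist_pos: "x \<in> \<Omega> \<Longrightarrow> bdist x > 0"
  using in_closed_iff_infdist_zero[of "frontier \<Omega>" x] frontier_nonempty frontier_disjoint
    infdist_nonneg[of x "frontier \<Omega>"] by fastforce

lemma cball_bdist: "x \<in> \<Omega> \<Longrightarrow> r < bdist x \<Longrightarrow> cball x r \<subseteq> \<Omega>"
  using ball_bdist[of x "bdist x"] by auto

lemma bdist_attained: "\<exists>p\<in>frontier \<Omega>. bdist x = dist x p"
  using infdist_attains_inf[of "frontier \<Omega>" x] frontier_nonempty by auto

lemma u_nonpos: "x \<in> closure \<Omega> \<Longrightarrow> u x \<le> 0"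
  by (rule max_principle[OF has_C2_u bounded_dom]) (auto simp: trace_u continuous_u boundary_u)

text \<open>An interior zero would be a maximum, where the Laplacian cannot be positive; the second
  derivative test replaces a strong maximum principle.\<close>

lemma u_neg: "x \<in> \<Omega> \<Longrightarrow> u x < 0"
proof (rule ccontr)
  assume x: "x \<in> \<Omega>" and "\<not> u x < 0"
  then have "u x = 0" using u_nonpos[of x] closure_subset by fastforce
  then have "trace (HU x) \<le> 0"
    using u_nonpos closure_subset by (intro interior_maximum(2)[OF has_C2_u x]) fastforce
  then show False using trace_u[OF x] by simp
qed

lemma exterior_ball: "\<exists>R>0. \<forall>q\<in>frontier \<Omega>. \<exists>c. dist q c = R \<and> ball c R \<inter> \<Omega> = {}"
proof (rule compact_uniform[OF compact_frontier_dom])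
  fix p assume "p \<in> frontier \<Omega>"
  then obtain r e g G K where ch: "chart \<Omega> p r e g G K"
    using C2alpha_boundary_chart[OF boundary _ alpha_pos] by blast
  then have rK: "r > 0" "K \<ge> 1" by (simp_all add: chart_def)
  have "\<forall>q\<in>frontier \<Omega> \<inter> ball p (r / 2). \<forall>R'. 0 < R' \<and> R' \<le> min (r / 4) (1 / (2 * K)) \<longrightarrow>
      (\<exists>c. dist q c = R' \<and> ball c R' \<inter> \<Omega> = {})"
    using chart_exterior_ball[OF ch open_dom] by simp
  moreover have "min (r / 4) (1 / (2 * K)) > 0" "r / 2 > 0" using rK by simp_all
  ultimately show "\<exists>R>0. \<exists>\<rho>>0. \<forall>q\<in>frontier \<Omega> \<inter> ball p \<rho>. \<forall>R'. 0 < R' \<and> R' \<le> R \<longrightarrow>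
      (\<exists>c. dist q c = R' \<and> ball c R' \<inter> \<Omega> = {})" by blast
qed

text \<open>The barrier is an increasing concave function of the squared distance to the centre of
  an exterior ball. It is nonnegative on the closure, vanishes at the touching point and has
  Laplacian at most -N, so it dominates \<open>- u\<close>; it grows at most linearly away from the
  touching point.\<close>

lemma boundary_growth: "\<exists>C>0. \<forall>x\<in>closure \<Omega>. \<bar>u x\<bar> \<le> C * bdist x"
proof -
  obtain R where R: "R > 0" "\<And>q. q \<in> frontier \<Omega> \<Longrightarrow> \<exists>c. dist q c = R \<and> ball c R \<inter> \<Omega> = {}"
    using exterior_ball by blast
  obtain B where B: "B > 0" "\<And>x. x \<in> closure \<Omega> \<Longrightarrow> norm x \<le> B"
    using bounded_closure[OF bounded_dom] unfolding bounded_pos by blast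
  let ?N = "real CARD('n)"
  \<comment> \<open>\<open>A\<close> makes A s >= N outside the exterior ball, where
    \<open>s\<close> is the squared distance to its centre; then the concave exponential outweighs
    the dimension term. \<open>D\<close> bounds the distance on the closure, and \<open>c\<close> is
    the factor that brings the Laplacian down to -N there.\<close>
  define A where "A = ?N / R\<^sup>2"
  define D where "D = 2 * B + R"
  define c where "c = exp (A * D\<^sup>2) / (2 * A)"
  have N: "?N \<ge> 1" by (simp add: Suc_leI)
  have A: "A > 0" using R N by (simp add: A_def)
  have D: "D > 0" using R B by (simp add: D_def)
  have c: "c > 0" using A by (simp add: c_def)
  have main: "\<bar>u x\<bar> \<le> 2 * c * A * D * dist x p" if x: "x \<in> closure \<Omega>" and p: "p \<in> frontier \<Omega>" for x p
  proof -
    obtain q where q: "dist p q = R" "ball q R \<inter> \<Omega> = {}" using R(2)[OF p] by blast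
    have pc: "p \<in> closure \<Omega>" using p by (simp add: frontier_def)
    have far: "dist y q \<ge> R" if "y \<in> closure \<Omega>" for y
    proof -
      have "\<Omega> \<subseteq> - ball q R" using q by auto
      then have "closure \<Omega> \<subseteq> - ball q R" by (intro closure_minimal) auto
      then show ?thesis using that by (auto simp: dist_commute)
    qed
    have near: "dist y q \<le> D" if "y \<in> closure \<Omega>" for y
    proof -
      have "dist y q \<le> dist y p + dist p q" by (rule dist_triangle)
      also have "dist y p \<le> norm y + norm p" by (simp add: dist_norm norm_triangle_ineq4)
      finally show ?thesis using B(2)[OF that] B(2)[OF pc] q by (simp add: D_def)
    qed
    define s where "s y = 2 * ((dist y q)\<^sup>2 / 2)" for y
    define \<phi> where "\<phi> t = c * (1 - exp (- A * (t - R\<^sup>2)))" for t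
    define \<phi>' where "\<phi>' t = c * A * exp (- A * (t - R\<^sup>2))" for t
    define \<phi>'' where "\<phi>'' t = - c * A\<^sup>2 * exp (- A * (t - R\<^sup>2))" for t
    have s: "has_C2 s (\<lambda>y. 2 *\<^sub>R (y - q)) (\<lambda>y. 2 *\<^sub>R mat 1) \<Omega>"
      unfolding s_def by (intro has_C2_cmult has_C2_quadratic open_dom)
    have d1: "(\<phi> has_field_derivative \<phi>' t) (at t)" for t
      unfolding \<phi>_def \<phi>'_def by (auto intro!: derivative_eq_intros)
    have d2: "(\<phi>' has_field_derivative \<phi>'' t) (at t)" for t
      unfolding \<phi>'_def \<phi>''_def by (auto intro!: derivative_eq_intros simp: power2_eq_square)
    have cs: "continuous_on X s" for X unfolding s_def by (intro continuous_intros) auto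
    have c\<phi>: "continuous_on X (\<lambda>y. \<phi> (s y))" "continuous_on X (\<lambda>y. \<phi>'' (s y))" for X
      unfolding \<phi>_def \<phi>''_def by (intro continuous_intros cs)+
    have b: "has_C2 (\<lambda>y. \<phi> (s y)) (\<lambda>y. \<phi>' (s y) *\<^sub>R 2 *\<^sub>R (y - q))
        (\<lambda>y. \<phi>' (s y) *\<^sub>R 2 *\<^sub>R mat 1 + \<phi>'' (s y) *\<^sub>R tensor (2 *\<^sub>R (y - q)) (2 *\<^sub>R (y - q))) \<Omega>"
      by (intro has_C2_compose[OF s] d1 d2 c\<phi>)
    have sy: "s y = (y - q) \<bullet> (y - q)" for y
      by (simp add: s_def dist_norm power2_norm_eq_inner)
    have tr: "\<phi>' (s y) * (2 * ?N) + \<phi>'' (s y) * (4 * s y) \<le> - ?N" if y: "y \<in> \<Omega>" for y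
    proof -
      have yc: "y \<in> closure \<Omega>" using y closure_subset by blast
      have s1: "s y \<ge> R\<^sup>2" "s y \<le> D\<^sup>2"
        using far[OF yc] near[OF yc] R by (auto simp: s_def intro!: power_mono)
      have e: "exp (- A * (s y - R\<^sup>2)) \<ge> exp (- (A * D\<^sup>2))"
      proof -
        have "A * (s y - R\<^sup>2) \<le> A * D\<^sup>2"
          using s1 A by (intro mult_left_mono) (auto intro: order_trans[of _ "s y"])
        then show ?thesis by simp
      qed
      have As: "A * s y \<ge> ?N"
      proof -
        have "A * s y \<ge> A * R\<^sup>2" using s1 A by (intro mult_left_mono) auto
        then show ?thesis using R by (simp add: A_def)
      qed
      have "\<phi>' (s y) * (2 * ?N) + \<phi>'' (s y) * (4 * s y)
          = - (c * A * exp (- A * (s y - R\<^sup>2))) * (4 * (A * s y) - 2 * ?N)"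
        by (simp add: \<phi>'_def \<phi>''_def power2_eq_square algebra_simps)
      also have "\<dots> \<le> - (c * A * exp (- A * (s y - R\<^sup>2))) * (2 * ?N)"
        using As c A by (intro mult_left_mono_neg) auto
      also have "\<dots> \<le> - (c * A * exp (- (A * D\<^sup>2))) * (2 * ?N)"
        using e c A by (intro mult_right_mono) auto
      also have "c * A * exp (- (A * D\<^sup>2)) = 1 / 2"
        using A by (simp add: c_def exp_minus)
      finally show ?thesis by simp
    qed
    have "- u y - \<phi> (s y) \<le> 0" if "y \<in> closure \<Omega>" for y
    proof (rule max_principle[OF has_C2_diff[OF has_C2_minus[OF has_C2_u] b] bounded_dom _ _ _ that])
      fix y assume y: "y \<in> \<Omega>"
      show "0 \<le> trace (- HU y - (\<phi>' (s y) *\<^sub>R 2 *\<^sub>R mat 1 + \<phi>'' (s y) *\<^sub>R tensor (2 *\<^sub>R (y - q)) (2 *\<^sub>R (y - q))))"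
        using tr[OF y] by (simp add: trace_u[OF y] sy)
    next
      show "continuous_on (closure \<Omega>) (\<lambda>y. - u y - \<phi> (s y))"
        by (intro continuous_intros continuous_u c\<phi>)
    next
      fix y assume y: "y \<in> frontier \<Omega>"
      then have "dist y q \<ge> R" using far by (simp add: frontier_def)
      then have "R\<^sup>2 \<le> s y" using R by (auto simp: s_def intro!: power_mono)
      then have "\<phi> (s y) \<ge> 0" using A c by (simp add: \<phi>_def)
      then show "- u y - \<phi> (s y) \<le> 0" using boundary_u[OF y] by simp
    qed
    from this[OF x] have "\<bar>u x\<bar> \<le> \<phi> (s x)" using u_nonpos[OF x] by simp
    \<comment> \<open>By 1 - exp(-t) <= t the barrier becomes linear in s - R^2, which is at most a
      constant times the distance to \<open>p\<close>.\<close>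
    also have "\<dots> \<le> c * (A * (s x - R\<^sup>2))"
      unfolding \<phi>_def using exp_ge_add_one_self[of "- A * (s x - R\<^sup>2)"] c by (intro mult_left_mono) auto
    also have "s x - R\<^sup>2 = (dist x q - R) * (dist x q + R)"
      by (simp add: s_def power2_eq_square algebra_simps)
    also have "\<dots> \<le> dist x p * (2 * D)"
    proof (rule mult_mono)
      show "dist x q - R \<le> dist x p" using dist_triangle[of x q p] q by simp
      show "dist x q + R \<le> 2 * D" using near[OF x] B by (simp add: D_def)
    qed (use R in auto)
    finally show ?thesis using A c by (simp add: mult_ac)
  qed
  have "\<bar>u x\<bar> \<le> 2 * c * A * D * bdist x" if x: "x \<in> closure \<Omega>" for x
    using bdist_attained[of x] main[OF x] by force
  moreover have "2 * c * A * D > 0" using c A D by simp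
  ultimately show ?thesis by blast
qed

text \<open>On the ball of half the boundary distance \<open>d\<close>, \<open>u\<close> is O(d) by
  the growth bound; the interior gradient estimate divides by \<open>d\<close>, and the bound is
  uniform up to the boundary.\<close>

lemma gradient_bounded: "\<exists>M>0. \<forall>x\<in>\<Omega>. norm (U x) \<le> M"
proof -
  obtain C where C: "C > 0" "\<And>x. x \<in> closure \<Omega> \<Longrightarrow> \<bar>u x\<bar> \<le> C * bdist x" using boundary_growth by blast
  obtain B where B: "B > 0" "\<And>x. x \<in> closure \<Omega> \<Longrightarrow> norm x \<le> B"
    using bounded_closure[OF bounded_dom] unfolding bounded_pos by blast
  let ?c = "grad_const TYPE('n)"
  have "norm (U x) \<le> ?c * (4 * C + 2 * B)" if x: "x \<in> \<Omega>" for x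
  proof -
    define d where "d = bdist x"
    have d: "d > 0" using bdist_pos[OF x] by (simp add: d_def)
    have xc: "x \<in> closure \<Omega>" using x closure_subset by blast
    have dB: "d \<le> 2 * B"
    proof -
      obtain p where p: "p \<in> frontier \<Omega>" "d = dist x p" using bdist_attained[of x] d_def by blast
      have "dist x p \<le> norm x + norm p" by (simp add: dist_norm norm_triangle_ineq4)
      then show ?thesis using B(2)[OF xc] B(2)[of p] p by (simp add: frontier_def)
    qed
    have sub: "cball x (d / 2) \<subseteq> \<Omega>" using cball_bdist[OF x, of "d / 2"] d by (simp add: d_def)
    \<comment> \<open>The paraboloid is centred at \<open>x\<close>: subtracting it makes
      \<open>u\<close> harmonic without changing its gradient at \<open>x\<close>.\<close>
    have har: "harmonic (\<lambda>y. u y - (dist y x)\<^sup>2 / 2) (\<lambda>y. U y - (y - x)) (\<lambda>y. HU y - mat 1) \<Omega>"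
      unfolding harmonic_def
      using has_C2_diff[OF has_C2_u has_C2_quadratic[OF open_dom]] trace_u by simp
    have "norm (U x - (x - x)) \<le> ?c * (C * (2 * d) + d * B) / (d / 2)"
    proof (rule harmonic_gradient_bound[OF har sub])
      fix y assume y: "y \<in> cball x (d / 2)"
      then have yc: "y \<in> closure \<Omega>" using sub closure_subset by blast
      have "bdist y \<le> bdist x + dist x y"
        by (metis add.commute dist_commute infdist_triangle)
      then have "bdist y \<le> 2 * d" using y d by (simp add: d_def)
      then have "\<bar>u y\<bar> \<le> C * (2 * d)" using C(2)[OF yc] C(1) mult_left_mono order_trans by (metis less_eq_real_def)
      moreover have "(dist y x)\<^sup>2 / 2 \<le> d * B"
      proof -
        have "(dist y x)\<^sup>2 \<le> d\<^sup>2" using y d by (intro power_mono) (auto simp: dist_commute)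
        also have "\<dots> \<le> d * (2 * B)" using dB d by (simp add: power2_eq_square)
        finally show ?thesis by simp
      qed
      moreover have "\<bar>u y - (dist y x)\<^sup>2 / 2\<bar> \<le> \<bar>u y\<bar> + (dist y x)\<^sup>2 / 2"
        using abs_triangle_ineq4[of "u y" "(dist y x)\<^sup>2 / 2"] by simp
      ultimately show "\<bar>u y - (dist y x)\<^sup>2 / 2\<bar> \<le> C * (2 * d) + d * B" by linarith
    qed (use d in auto)
    also have "\<dots> = ?c * (4 * C + 2 * B)" using d by (simp add: field_simps)
    finally show ?thesis by simp
  qed
  moreover have "?c * (4 * C + 2 * B) > 0" using grad_const_pos[where 'n='n] B C by simp
  ultimately show ?thesis by blast
qed

text \<open>The domain need not be convex, so the gradient bound covers only pairs closer together
  than the distance of \<open>x\<close> to the boundary. For all others both values are bounded by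
  the growth estimate, since both points lie within a multiple of \<open>dist x y\<close> of the
  boundary.\<close>

lemma u_lipschitz: "\<exists>L>0. \<forall>x\<in>closure \<Omega>. \<forall>y\<in>closure \<Omega>. \<bar>u x - u y\<bar> \<le> L * dist x y"
proof -
  obtain C where C: "C > 0" "\<And>x. x \<in> closure \<Omega> \<Longrightarrow> \<bar>u x\<bar> \<le> C * bdist x" using boundary_growth by blast
  obtain M where M: "M > 0" "\<And>x. x \<in> \<Omega> \<Longrightarrow> norm (U x) \<le> M" using gradient_bounded by blast
  define L where "L = 3 * C + M"
  have "\<bar>u x - u y\<bar> \<le> L * dist x y" if xy: "x \<in> closure \<Omega>" "y \<in> closure \<Omega>" for x y
  proof (cases "dist x y < bdist x")
    case True
    then have "x \<notin> frontier \<Omega>" by (metis infdist_zero not_less zero_le_dist)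
    then have x: "x \<in> \<Omega>" using closure_dom_cases xy by blast
    let ?B = "ball x (bdist x)"
    have sub: "?B \<subseteq> \<Omega>" using ball_bdist[OF x] by simp
    have "\<bar>u x - u y\<bar> \<le> M * dist x y"
    proof (rule gradient_bound_on_ball)
      show "x \<in> ?B" "y \<in> ?B" using bdist_pos[OF x] True by auto
      fix w assume "w \<in> ?B"
      then have w: "w \<in> \<Omega>" using sub by blast
      show "(u has_derivative (\<bullet>) (U w)) (at w)" using has_C2_u w by (simp add: has_C2_def)
      show "norm (U w) \<le> M" by (rule M(2)[OF w])
    qed
    also have "\<dots> \<le> L * dist x y" using C by (intro mult_right_mono) (auto simp: L_def)
    finally show ?thesis .
  next
    case False
    have "bdist y \<le> bdist x + dist x y"
      by (metis add.commute dist_commute infdist_triangle)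
    then have "bdist x + bdist y \<le> 3 * dist x y" using False by simp
    then have "C * (bdist x + bdist y) \<le> C * (3 * dist x y)" using C(1) by (intro mult_left_mono) auto
    moreover have "\<bar>u x - u y\<bar> \<le> \<bar>u x\<bar> + \<bar>u y\<bar>" by (rule abs_triangle_ineq4)
    ultimately have "\<bar>u x - u y\<bar> \<le> C * (3 * dist x y)"
      using C(2)[OF xy(1)] C(2)[OF xy(2)] by (simp add: distrib_left)
    also have "\<dots> = 3 * C * dist x y" by simp
    also have "\<dots> \<le> L * dist x y" using M by (intro mult_right_mono) (auto simp: L_def)
    finally show ?thesis .
  qed
  moreover have "L > 0" using C M by (simp add: L_def)
  ultimately show ?thesis by blast
qed

end

section \<open>A barrier at a boundary point\<close>

text \<open>\<open>hom\<close> is Euler's identity for a function homogeneous of degree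
  \<open>j\<close> about \<open>p\<close>; it turns the cross term in the Laplacian of the product
  into a multiple of \<open>T\<close>.\<close>

lemma powr_weight_C2:
  fixes T :: "real^'n \<Rightarrow> real"
  assumes T: "has_C2 T G K UNIV" and hom: "\<And>x. (x - p) \<bullet> G x = j * T x"
  shows "\<exists>F H. has_C2 (\<lambda>x. ((dist x p)\<^sup>2) powr m * T x) F H (- {p}) \<and>
    (\<forall>x. x \<noteq> p \<longrightarrow> trace (H x) = ((dist x p)\<^sup>2) powr (m - 1) * T x * (4 * m * (m - 1) + 2 * real CARD('n) * m + 4 * m * j)
       + ((dist x p)\<^sup>2) powr m * trace (K x))"
proof -
  define s where "s x = (2::real) * ((dist x p)\<^sup>2 / 2)" for x :: "real^'n"
  have seq: "s x = (dist x p)\<^sup>2" for x by (simp add: s_def)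
  have o: "open (- {p})" by (rule open_Compl) simp
  have s: "has_C2 s (\<lambda>y. 2 *\<^sub>R (y - p)) (\<lambda>y. 2 *\<^sub>R mat 1) (- {p})"
    unfolding s_def by (intro has_C2_cmult has_C2_quadratic o)
  have pos: "s x > 0" if "x \<in> - {p}" for x using that by (simp add: s_def)
  have sp: "has_C2 (\<lambda>x. s x powr m) (\<lambda>x. (m * s x powr (m - 1)) *\<^sub>R (2 *\<^sub>R (x - p)))
     (\<lambda>x. (m * s x powr (m - 1)) *\<^sub>R (2 *\<^sub>R mat 1)
        + (m * ((m - 1) * s x powr (m - 2))) *\<^sub>R tensor (2 *\<^sub>R (x - p)) (2 *\<^sub>R (x - p))) (- {p})"
  proof (rule has_C2_compose[OF s, where \<phi> = "\<lambda>t. t powr m" and \<phi>' = "\<lambda>t. m * t powr (m - 1)"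
        and \<phi>'' = "\<lambda>t. m * ((m - 1) * t powr (m - 2))"])
    fix x assume x: "x \<in> - {p}"
    show "((\<lambda>t. t powr m) has_real_derivative m * s x powr (m - 1)) (at (s x))"
      by (rule has_real_derivative_powr[OF pos[OF x]])
    show "((\<lambda>t. m * t powr (m - 1)) has_real_derivative m * ((m - 1) * s x powr (m - 2))) (at (s x))"
      using DERIV_cmult[OF has_real_derivative_powr[OF pos[OF x], of "m - 1"], of m] by simp
  next
    show "continuous_on (- {p}) (\<lambda>x. m * ((m - 1) * s x powr (m - 2)))"
      unfolding s_def by (intro continuous_intros) auto
  qed
  let ?F = "\<lambda>x. s x powr m *\<^sub>R G x + T x *\<^sub>R ((m * s x powr (m - 1)) *\<^sub>R (2 *\<^sub>R (x - p)))"
  let ?H = "\<lambda>x. s x powr m *\<^sub>R K x + T x *\<^sub>R ((m * s x powr (m - 1)) *\<^sub>R (2 *\<^sub>R mat 1)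
        + (m * ((m - 1) * s x powr (m - 2))) *\<^sub>R tensor (2 *\<^sub>R (x - p)) (2 *\<^sub>R (x - p)))
        + tensor (G x) ((m * s x powr (m - 1)) *\<^sub>R (2 *\<^sub>R (x - p))) + tensor ((m * s x powr (m - 1)) *\<^sub>R (2 *\<^sub>R (x - p))) (G x)"
  have "has_C2 (\<lambda>x. s x powr m * T x) ?F ?H (- {p})"
    by (intro has_C2_mult sp has_C2_mono[OF T] o) auto
  moreover have "trace (?H x) = s x powr (m - 1) * T x * (4 * m * (m - 1) + 2 * real CARD('n) * m + 4 * m * j)
       + s x powr m * trace (K x)" if x: "x \<noteq> p" for x
  proof -
    have ss: "(x - p) \<bullet> (x - p) = s x" by (simp add: s_def dist_norm power2_norm_eq_inner)
    have sm: "s x powr (m - 2) * s x = s x powr (m - 1)"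
      using pos[of x] x powr_add[of "s x" "m - 2" 1] by simp
    have "trace (?H x) = s x powr m * trace (K x) + T x * (m * s x powr (m - 1) * (2 * real CARD('n))
        + m * ((m - 1) * s x powr (m - 2)) * (4 * ((x - p) \<bullet> (x - p)))) + 4 * m * s x powr (m - 1) * ((x - p) \<bullet> G x)"
      by (simp only: trace_simps trace_tensor inner_scaleR_left inner_scaleR_right inner_commute[of "G x"])
        (simp add: algebra_simps)
    also have "\<dots> = s x powr m * trace (K x) + T x * (m * s x powr (m - 1) * (2 * real CARD('n))
        + m * (m - 1) * 4 * (s x powr (m - 2) * s x)) + 4 * m * s x powr (m - 1) * (j * T x)"
      by (simp only: hom ss) (simp add: algebra_simps)
    also have "\<dots> = s x powr (m - 1) * T x * (4 * m * (m - 1) + 2 * real CARD('n) * m + 4 * m * j)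
       + s x powr m * trace (K x)"
      by (simp only: sm) (simp add: algebra_simps)
    finally show ?thesis .
  qed
  ultimately show ?thesis unfolding seq by blast
qed

text \<open>With \<open>r = |x - p|\<close> and \<open>t = (x - p) \<bullet> n\<close> the barrier is
  \<open>r\<^sup>\<beta> + 20 N r\<^sup>\<beta>\<^sup>-\<^sup>1 t - (N / 2) r\<^sup>\<beta>\<^sup>-\<^sup>2 t\<^sup>2\<close> for \<open>\<beta> = 3/4\<close>. Any exponent in \<open>(1/2, 1)\<close> would do:
  \<open>\<beta> < 1\<close> makes it superharmonic on a set slightly larger than a half space, and
  \<open>\<beta> > 1/2\<close> makes \<open>(d\<^sup>\<beta>\<^sup>-\<^sup>1)\<^sup>2\<close> integrable.\<close>

lemma barrier:
  fixes n p :: "real^'n"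
  assumes n: "norm n = 1"
  shows "\<exists>B F H. continuous_on UNIV B \<and> has_C2 B F H (- {p}) \<and>
    (\<forall>x. \<bar>B x\<bar> \<le> (1 + 21 * real CARD('n)) * dist x p powr (3/4)) \<and>
    (\<forall>x. x \<noteq> p \<and> (x - p) \<bullet> n \<ge> - (dist x p / (28 * real CARD('n))) \<longrightarrow>
       trace (H x) \<le> 0 \<and> B x \<ge> dist x p powr (3/4) / 4)"
proof -
  let ?N = "real CARD('n)"
  have N: "?N \<ge> 1" by (simp add: Suc_leI)
  define s where "s x = (dist x p)\<^sup>2" for x
  define t where "t x = - (p \<bullet> n) + n \<bullet> x" for x
  have t: "t x = (x - p) \<bullet> n" for x by (simp add: t_def inner_diff_left inner_commute[of n])
  have tC: "has_C2 t (\<lambda>x. n) (\<lambda>x. 0) UNIV" unfolding t_def by (intro has_C2_affine) simp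
  have t2C: "has_C2 (\<lambda>x. t x * t x) (\<lambda>x. t x *\<^sub>R n + t x *\<^sub>R n)
      (\<lambda>x. t x *\<^sub>R 0 + t x *\<^sub>R 0 + tensor n n + tensor n n) UNIV"
    by (rule has_C2_mult[OF tC tC])
  have nn: "n \<bullet> n = 1" using n by (simp add: power2_norm_eq_inner[symmetric])
  \<comment> \<open>The weights are powers of the squared distance, so the exponents 3/4, -1/4 and
    -5/4 of the distance appear halved.\<close>
  obtain F0 H0 where 0: "has_C2 (\<lambda>x. s x powr (3/8) * 1) F0 H0 (- {p})"
    "\<And>x. x \<noteq> p \<Longrightarrow> trace (H0 x) = s x powr (3/8 - 1) * 1 * (4 * (3/8) * (3/8 - 1) + 2 * ?N * (3/8) + 4 * (3/8) * 0) + s x powr (3/8) * trace (0::real^'n^'n)"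
    using powr_weight_C2[OF has_C2_const[OF open_UNIV], of p 0 1 "3/8"] unfolding s_def by auto
  obtain F1 H1 where 1: "has_C2 (\<lambda>x. s x powr (-1/8) * t x) F1 H1 (- {p})"
    "\<And>x. x \<noteq> p \<Longrightarrow> trace (H1 x) = s x powr (-1/8 - 1) * t x * (4 * (-1/8) * (-1/8 - 1) + 2 * ?N * (-1/8) + 4 * (-1/8) * 1) + s x powr (-1/8) * trace (0::real^'n^'n)"
    using powr_weight_C2[OF tC, of p 1 "-1/8"] unfolding s_def t by (auto simp: inner_commute)
  obtain F2 H2 where 2: "has_C2 (\<lambda>x. s x powr (-5/8) * (t x * t x)) F2 H2 (- {p})"
    "\<And>x. x \<noteq> p \<Longrightarrow> trace (H2 x) = s x powr (-5/8 - 1) * (t x * t x) * (4 * (-5/8) * (-5/8 - 1) + 2 * ?N * (-5/8) + 4 * (-5/8) * 2)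
       + s x powr (-5/8) * trace (t x *\<^sub>R 0 + t x *\<^sub>R 0 + tensor n n + tensor n n)"
  proof -
    have "(x - p) \<bullet> (t x *\<^sub>R n + t x *\<^sub>R n) = 2 * (t x * t x)" for x
      by (simp only: inner_add_right inner_scaleR_right t)
    from powr_weight_C2[OF t2C this, of "-5/8"] show ?thesis using that unfolding s_def by blast
  qed
  define B where "B x = s x powr (3/8) * 1 + (20 * ?N) * (s x powr (-1/8) * t x) - (?N / 2) * (s x powr (-5/8) * (t x * t x))" for x
  define H where "H x = H0 x + (20 * ?N) *\<^sub>R H1 x - (?N / 2) *\<^sub>R H2 x" for x
  have C2: "has_C2 B (\<lambda>x. F0 x + (20 * ?N) *\<^sub>R F1 x - (?N / 2) *\<^sub>R F2 x) H (- {p})"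
    unfolding B_def H_def[abs_def] by (intro has_C2_add has_C2_diff has_C2_cmult 0 1 2)
  define r where "r x = dist x p" for x
  define \<xi> where "\<xi> x = t x / r x" for x
  have rpos: "r x > 0" if "x \<noteq> p" for x using that by (simp add: r_def)
  have sr: "s x powr m = r x powr (2 * m)" if "x \<noteq> p" for x m
    using rpos[OF that] by (simp add: s_def r_def powr_powr flip: powr_numeral)
  have txi: "t x = r x * \<xi> x" if "x \<noteq> p" for x using rpos[OF that] by (simp add: \<xi>_def)
  have xi1: "\<bar>\<xi> x\<bar> \<le> 1" if "x \<noteq> p" for x
    using Cauchy_Schwarz_ineq2[of "x - p" n] n rpos[OF that]
    by (simp add: \<xi>_def t r_def dist_norm abs_divide divide_le_eq)
  \<comment> \<open>Everything is homogeneous: barrier and Laplacian are powers of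
    \<open>r x\<close> times quadratic polynomials in \<xi> = t / r, and both claims become
    inequalities for numbers \<xi> >= -1 / (28 N).\<close>
  have Beq: "B x = r x powr (3/4) * (1 + 20 * ?N * \<xi> x - ?N / 2 * (\<xi> x)\<^sup>2)" if x: "x \<noteq> p" for x
  proof -
    have a: "r x powr (-1/4) * r x = r x powr (3/4)"
      using rpos[OF x] powr_add[of "r x" "-1/4" 1] by simp
    have b: "r x powr (-5/4) * (r x)\<^sup>2 = r x powr (3/4)"
      using rpos[OF x] powr_add[of "r x" "-5/4" 2] by simp
    have "B x = r x powr (3/4) + (20 * ?N) * \<xi> x * (r x powr (-1/4) * r x) - (?N / 2) * (\<xi> x)\<^sup>2 * (r x powr (-5/4) * (r x)\<^sup>2)"
      unfolding B_def sr[OF x] txi[OF x] by (simp add: power2_eq_square mult_ac)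
    then show ?thesis unfolding a b by (simp add: algebra_simps)
  qed
  have Heq: "trace (H x) = r x powr (-5/4) * ((3 * ?N / 4 - 15/16) + 20 * ?N * \<xi> x * (1/16 - ?N / 4)
      - ?N / 2 * (2 - (\<xi> x)\<^sup>2 * (15/16 + 5 * ?N / 4)))" if x: "x \<noteq> p" for x
  proof -
    have a: "r x powr (-9/4) * r x = r x powr (-5/4)"
      using rpos[OF x] powr_add[of "r x" "-9/4" 1] by simp
    have b: "r x powr (-13/4) * (r x)\<^sup>2 = r x powr (-5/4)"
      using rpos[OF x] powr_add[of "r x" "-13/4" 2] by simp
    have "trace (H x) = r x powr (-5/4) * (3 * ?N / 4 - 15/16) + 20 * ?N * (\<xi> x * (r x powr (-9/4) * r x) * (1/16 - ?N / 4))
        - ?N / 2 * ((\<xi> x)\<^sup>2 * (r x powr (-13/4) * (r x)\<^sup>2) * (- 15/16 - 5 * ?N / 4) + r x powr (-5/4) * 2)"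
      unfolding H_def trace_simps 0(2)[OF x] 1(2)[OF x] 2(2)[OF x] trace_tensor nn sr[OF x] txi[OF x]
      by (simp add: power2_eq_square mult_ac)
    then show ?thesis unfolding a b by (simp add: algebra_simps)
  qed
  have bound: "\<bar>B x\<bar> \<le> (1 + 21 * ?N) * r x powr (3/4)" for x
  proof (cases "x = p")
    case True
    then show ?thesis by (simp add: B_def r_def s_def t)
  next
    case False
    have "\<bar>20 * ?N * \<xi> x\<bar> \<le> 20 * ?N" using xi1[OF False] N by (simp add: abs_mult)
    moreover have "0 \<le> ?N / 2 * (\<xi> x)\<^sup>2" "?N / 2 * (\<xi> x)\<^sup>2 \<le> ?N / 2 * 1"
      using xi1[OF False] by (auto intro!: mult_left_mono simp: abs_square_le_1)
    ultimately have "\<bar>1 + 20 * ?N * \<xi> x - ?N / 2 * (\<xi> x)\<^sup>2\<bar> \<le> 1 + 21 * ?N" by linarith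
    then have "r x powr (3/4) * \<bar>1 + 20 * ?N * \<xi> x - ?N / 2 * (\<xi> x)\<^sup>2\<bar> \<le> r x powr (3/4) * (1 + 21 * ?N)"
      by (intro mult_left_mono) auto
    then show ?thesis unfolding Beq[OF False] by (simp add: abs_mult mult.commute)
  qed
  have cont: "continuous_on UNIV B"
  proof (rule continuous_at_imp_continuous_on, rule ballI)
    fix x
    show "isCont B x"
    proof (cases "x = p")
      case True
      have "((\<lambda>x. (1 + 21 * ?N) * r x powr (3/4)) \<longlongrightarrow> (1 + 21 * ?N) * r p powr (3/4)) (at p)"
        unfolding r_def by (intro tendsto_intros tendsto_powr') auto
      then have "((\<lambda>x. (1 + 21 * ?N) * r x powr (3/4)) \<longlongrightarrow> 0) (at p)" by (simp add: r_def)
      then have "(B \<longlongrightarrow> 0) (at p)"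
        by (rule Lim_null_comparison[rotated]) (intro always_eventually allI, use bound in simp)
      moreover have "B p = 0" using bound[of p] by (simp add: r_def)
      ultimately show ?thesis using True by (simp add: isCont_def)
    next
      case False
      have "open (- {p})" using C2 by (simp add: has_C2_def)
      then show ?thesis using has_C2_continuous[OF C2] False
        by (simp add: continuous_on_eq_continuous_at)
    qed
  qed
  have "trace (H x) \<le> 0 \<and> B x \<ge> r x powr (3/4) / 4" if x: "x \<noteq> p" and low: "t x \<ge> - (r x / (28 * ?N))" for x
  proof -
    define z where "z = \<xi> x"
    have z1: "\<bar>z\<bar> \<le> 1" using xi1[OF x] by (simp add: z_def)
    have zl: "z \<ge> - 1 / (28 * ?N)"
      using low rpos[OF x] N by (simp add: z_def \<xi>_def field_simps)
    have Nz: "?N * z \<ge> - 1 / 28" using zl N by (simp add: field_simps)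
    have A: "(3 * ?N / 4 - 15/16) + 20 * ?N * z * (1/16 - ?N / 4) - ?N / 2 * (2 - z\<^sup>2 * (15/16 + 5 * ?N / 4)) \<le> 0"
      and P: "1 + 20 * ?N * z - ?N / 2 * z\<^sup>2 \<ge> 1 / 4"
    proof -
      \<comment> \<open>The constant part is negative because the quadratic term of the barrier
        contributes -N, more than the 3 N / 4 of the first term.\<close>
      have split: "(3 * ?N / 4 - 15/16) + 20 * ?N * z * (1/16 - ?N / 4) - ?N / 2 * (2 - z\<^sup>2 * (15/16 + 5 * ?N / 4))
        = - ?N / 4 - 15/16 - 5 * ?N * z * (?N - 1/4) + (15/32 * ?N + 5/8 * ?N\<^sup>2) * z\<^sup>2"
        by (simp add: algebra_simps power2_eq_square)
      have NN: "?N \<le> ?N\<^sup>2" using N by (simp add: power2_eq_square)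
      consider "z \<ge> 0" | "z < 0" by linarith
      then have "- ?N / 4 - 15/16 - 5 * ?N * z * (?N - 1/4) + (15/32 * ?N + 5/8 * ?N\<^sup>2) * z\<^sup>2 \<le> 0
          \<and> 1 + 20 * ?N * z - ?N / 2 * z\<^sup>2 \<ge> 1 / 4"
      proof cases
        \<comment> \<open>The linear terms have the favourable sign in both inequalities and absorb
          the quadratic ones, as z^2 <= z.\<close>
        case 1
        have zz: "z\<^sup>2 \<le> z" using 1 z1 by (simp add: power2_eq_square mult_left_le)
        have "(15/32 * ?N + 5/8 * ?N\<^sup>2) * z\<^sup>2 \<le> (15/32 * ?N + 5/8 * ?N\<^sup>2) * z"
          using zz by (intro mult_left_mono) auto
        also have "\<dots> \<le> (5 * ?N\<^sup>2 - 5/4 * ?N) * z"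
          by (intro mult_right_mono) (use NN N 1 in linarith)+
        also have "\<dots> = 5 * ?N * z * (?N - 1/4)" by (simp add: algebra_simps power2_eq_square)
        finally have "(15/32 * ?N + 5/8 * ?N\<^sup>2) * z\<^sup>2 \<le> 5 * ?N * z * (?N - 1/4)" .
        moreover have "?N / 2 * z\<^sup>2 \<le> 20 * ?N * z"
        proof -
          have "?N / 2 * z\<^sup>2 \<le> ?N / 2 * z" using zz by (intro mult_left_mono) auto
          also have "\<dots> \<le> 20 * ?N * z" using 1 by (intro mult_right_mono) auto
          finally show ?thesis .
        qed
        ultimately show ?thesis using N by linarith
      next
        \<comment> \<open>Here the linear terms are adverse, but y = - N z <= 1/28 keeps them below
          5 N / 28 and 20 / 28, less than the available N / 4 and 1.\<close>
        case 2
        define y where "y = - (?N * z)"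
        have y: "0 \<le> y" "y \<le> 1 / 28" using 2 Nz by (auto simp: y_def mult_nonneg_nonpos)
        have yy: "y\<^sup>2 \<le> 1 / 28 * y" using mult_right_mono[OF y(2,1)] by (simp only: power2_eq_square)
        have e1: "- (5 * ?N * z * (?N - 1/4)) = 5 * y * (?N - 1/4)" by (simp add: y_def)
        have e2: "?N\<^sup>2 * z\<^sup>2 = y\<^sup>2" by (simp add: y_def power_mult_distrib)
        have e3: "?N * z\<^sup>2 \<le> y\<^sup>2"
          using mult_right_mono[OF NN, of "z\<^sup>2"] e2 by simp
        have "5 * y * (?N - 1/4) \<le> 5 * (1/28) * (?N - 1/4)"
          by (intro mult_right_mono) (use y N in linarith)+
        also have "\<dots> = 5/28 * ?N - 5/112" by (simp add: field_simps)
        finally have e4: "5 * y * (?N - 1/4) \<le> 5/28 * ?N - 5/112" .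
        have e5: "20 * ?N * z = - 20 * y" by (simp add: y_def)
        have "(15/32 * ?N + 5/8 * ?N\<^sup>2) * z\<^sup>2 = 15/32 * (?N * z\<^sup>2) + 5/8 * (?N\<^sup>2 * z\<^sup>2)"
          by (simp add: algebra_simps)
        also have "\<dots> \<le> 15/32 * y\<^sup>2 + 5/8 * y\<^sup>2" using e2 e3 by simp
        also have "\<dots> \<le> 2 * (1 / 28 * y)" using yy y by linarith
        finally have q: "(15/32 * ?N + 5/8 * ?N\<^sup>2) * z\<^sup>2 \<le> 1/14 * y" by simp
        have fin: "- M / 4 - 15/16 - a + b \<le> 0" if "- a \<le> 5/28 * M - 5/112" "b \<le> 1/14 * y" "1 \<le> M" for a b M :: real
          using that y by linarith
        have P: "1 + 20 * ?N * z - ?N / 2 * z\<^sup>2 \<ge> 1/4"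
          using e3 e5 yy y by linarith
        have "- (5 * ?N * z * (?N - 1/4)) \<le> 5/28 * ?N - 5/112" using e1 e4 by linarith
        from fin[OF this q N] P show ?thesis by (rule conjI)
      qed
      then show "(3 * ?N / 4 - 15/16) + 20 * ?N * z * (1/16 - ?N / 4) - ?N / 2 * (2 - z\<^sup>2 * (15/16 + 5 * ?N / 4)) \<le> 0"
        "1 + 20 * ?N * z - ?N / 2 * z\<^sup>2 \<ge> 1 / 4" using split by simp_all
    qed
    have "trace (H x) \<le> 0"
      unfolding Heq[OF x] z_def[symmetric] using A by (intro mult_nonneg_nonpos) auto
    moreover have "B x \<ge> r x powr (3/4) * (1/4)"
      unfolding Beq[OF x] z_def[symmetric] using P by (intro mult_left_mono) auto
    ultimately show ?thesis by simp
  qed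
  then show ?thesis
    using cont C2 bound unfolding r_def t by (intro exI[of _ B] exI conjI allI impI) auto
qed

text \<open>Tangential vectors have controlled images, and by symmetry so do the tangential
  components of \<open>A *v n\<close>. The one remaining entry, along \<open>n\<close> twice, is the
  trace minus tangential contributions.\<close>

lemma symmetric_trace_bound:
  fixes A :: "real^'n^'n"
  assumes sym: "\<And>a b. (A *v a) \<bullet> b = (A *v b) \<bullet> a" and n: "norm n = 1"
    and E: "\<And>\<tau>. \<tau> \<bullet> n = 0 \<Longrightarrow> norm \<tau> \<le> 1 \<Longrightarrow> norm (A *v \<tau>) \<le> E"
    and tr: "trace A = real CARD('n)"
  shows "norm A \<le> real CARD('n) * ((real CARD('n) + 2) * (E + 1))"
proof -
  let ?N = "real CARD('n)"
  have E0: "E \<ge> 0" using E[of 0] by simp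
  have N: "?N \<ge> 1" by (simp add: Suc_leI)
  let ?e = "\<lambda>i. axis i (1::real) :: real^'n"
  \<comment> \<open>Projections of the coordinate vectors to the hyperplane orthogonal to
    \<open>n\<close>; they need not be independent, so no adapted basis has to be built.\<close>
  define \<tau> where "\<tau> i = ?e i - (n $ i) *\<^sub>R n" for i
  have nn: "n \<bullet> n = 1" using n by (simp add: power2_norm_eq_inner[symmetric])
  have ei: "?e i = \<tau> i + (n $ i) *\<^sub>R n" for i by (simp add: \<tau>_def)
  have t0: "\<tau> i \<bullet> n = 0" for i
    by (simp add: \<tau>_def inner_diff_left nn inner_axis')
  have t1: "norm (\<tau> i) \<le> 1" for i
  proof -
    have "(norm (\<tau> i))\<^sup>2 = 1 - (n $ i)\<^sup>2"
    proof -
      have "\<tau> i \<bullet> \<tau> i = \<tau> i \<bullet> ?e i - (n $ i) * (\<tau> i \<bullet> n)"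
        by (subst (2) \<tau>_def) (simp add: inner_diff_right)
      also have "\<dots> = 1 - n $ i * n $ i" by (simp only: t0 inner_axis) (simp add: \<tau>_def)
      finally show ?thesis by (metis power2_norm_eq_inner power2_eq_square)
    qed
    then show ?thesis by (simp add: power2_le_imp_le[of _ 1])
  qed
  have At: "\<bar>(A *v \<tau> i) \<bullet> b\<bar> \<le> E" if "norm b \<le> 1" for i b
  proof -
    have "\<bar>(A *v \<tau> i) \<bullet> b\<bar> \<le> norm (A *v \<tau> i) * norm b" by (rule Cauchy_Schwarz_ineq2)
    also have "\<dots> \<le> E * 1" using E[OF t0 t1] that E0 by (intro mult_mono) auto
    finally show ?thesis by simp
  qed
  have entry: "A $ i $ j = (A *v ?e j) \<bullet> ?e i" for i j
    by (simp add: inner_axis matrix_vector_mult_basis column_def)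
  have n_i: "\<bar>n $ i\<bar> \<le> 1" for i using component_le_norm_cart[of n i] n by simp
  let ?q = "(A *v n) \<bullet> n"
  have "trace A = (\<Sum>i\<in>UNIV. (A *v \<tau> i) \<bullet> ?e i) + ?q"
  proof -
    have "A $ i $ i = (A *v \<tau> i) \<bullet> ?e i + (n $ i) * (A *v n) $ i" for i
    proof -
      have "A $ i $ i = (A *v (\<tau> i + (n $ i) *\<^sub>R n)) \<bullet> ?e i" by (simp only: entry ei[symmetric])
      also have "\<dots> = (A *v \<tau> i) \<bullet> ?e i + (n $ i) * ((A *v n) \<bullet> ?e i)"
        by (simp add: matrix_vector_right_distrib matrix_vector_mult_scaleR inner_add_left)
      finally show ?thesis by (simp add: inner_axis)
    qed
    then have "trace A = (\<Sum>i\<in>UNIV. (A *v \<tau> i) \<bullet> ?e i) + (\<Sum>i\<in>UNIV. (n $ i) * (A *v n) $ i)"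
      by (simp add: trace_def sum.distrib)
    then show ?thesis by (simp add: inner_vec_def[of "A *v n"] mult.commute)
  qed
  moreover have "\<bar>\<Sum>i\<in>UNIV. (A *v \<tau> i) \<bullet> ?e i\<bar> \<le> (\<Sum>i\<in>(UNIV::'n set). E)"
    by (rule order_trans[OF sum_abs sum_mono]) (use At in simp)
  ultimately have q: "\<bar>?q\<bar> \<le> ?N + ?N * E" using tr by simp
  have An: "\<bar>(A *v n) \<bullet> ?e i\<bar> \<le> E + (?N + ?N * E)" for i
  proof -
    have eq: "(A *v n) \<bullet> ?e i = (A *v \<tau> i) \<bullet> n + (n $ i) * ?q"
      by (subst ei) (simp add: inner_add_right sym[of n "\<tau> i"])
    have "\<bar>(A *v \<tau> i) \<bullet> n\<bar> \<le> E" using At n by simp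
    moreover have "\<bar>(n $ i) * ?q\<bar> \<le> 1 * (?N + ?N * E)"
      unfolding abs_mult using n_i q by (intro mult_mono) auto
    ultimately show ?thesis
      unfolding eq by (intro order_trans[OF abs_triangle_ineq add_mono]) auto
  qed
  have ent: "\<bar>A $ i $ j\<bar> \<le> (?N + 2) * (E + 1)" for i j
  proof -
    have "A $ i $ j = (A *v (\<tau> j + (n $ j) *\<^sub>R n)) \<bullet> ?e i" by (simp only: entry ei[symmetric])
    also have "\<dots> = (A *v \<tau> j) \<bullet> ?e i + (n $ j) * ((A *v n) \<bullet> ?e i)"
      by (simp add: matrix_vector_right_distrib matrix_vector_mult_scaleR inner_add_left)
    finally have eq: "A $ i $ j = (A *v \<tau> j) \<bullet> ?e i + (n $ j) * ((A *v n) \<bullet> ?e i)" .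
    have "\<bar>(n $ j) * ((A *v n) \<bullet> ?e i)\<bar> \<le> 1 * (E + (?N + ?N * E))"
      unfolding abs_mult using n_i An by (intro mult_mono) auto
    moreover have "\<bar>(A *v \<tau> j) \<bullet> ?e i\<bar> \<le> E" using At by simp
    ultimately have "\<bar>A $ i $ j\<bar> \<le> E + (E + (?N + ?N * E))"
      unfolding eq by (intro order_trans[OF abs_triangle_ineq add_mono]) auto
    also have "\<dots> \<le> (?N + 2) * (E + 1)" by (simp add: algebra_simps)
    finally show ?thesis .
  qed
  have "(norm A)\<^sup>2 \<le> (\<Sum>i\<in>(UNIV::'n set). \<Sum>j\<in>(UNIV::'n set). ((?N + 2) * (E + 1))\<^sup>2)"
    unfolding norm_matrix_sq
    by (intro sum_mono) (metis abs_ge_zero ent power2_abs power_mono)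
  also have "\<dots> = (?N * ((?N + 2) * (E + 1)))\<^sup>2"
    by (simp add: power2_eq_square algebra_simps)
  finally show ?thesis by (rule power2_le_imp_le) (use E0 in auto)
qed

section \<open>The Hessian near the boundary\<close>

context torsion
begin

text \<open>Subtracting |y|^2 / 2 makes \<open>u\<close> harmonic, hence also its directional
  derivatives; the correction \<tau> . x that has to be added back is linear.\<close>

lemma harmonic_tangential:
  "\<exists>K. harmonic (\<lambda>x. U x \<bullet> \<tau>) (\<lambda>x. HU x *v \<tau>) K \<Omega>"
proof -
  have "harmonic (\<lambda>y. u y - (dist y 0)\<^sup>2 / 2) (\<lambda>y. U y - (y - 0)) (\<lambda>y. HU y - mat 1) \<Omega>"
    unfolding harmonic_def
  proof (intro conjI ballI)
    show "has_C2 (\<lambda>y. u y - (dist y 0)\<^sup>2 / 2) (\<lambda>y. U y - (y - 0)) (\<lambda>y. HU y - mat 1) \<Omega>"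
      by (rule has_C2_diff[OF has_C2_u has_C2_quadratic[OF open_dom]])
  qed (simp add: trace_u)
  from harmonic_partial[OF this, of \<tau>] obtain K where
    K: "has_C2 (\<lambda>x. (U x - (x - 0)) \<bullet> \<tau>) (\<lambda>x. (HU x - mat 1) *v \<tau>) K \<Omega>" "\<forall>x\<in>\<Omega>. trace (K x) = 0"
    unfolding harmonic_def by blast
  have "has_C2 (\<lambda>x. (U x - (x - 0)) \<bullet> \<tau> + (0 + \<tau> \<bullet> x)) (\<lambda>x. (HU x - mat 1) *v \<tau> + \<tau>) (\<lambda>x. K x + 0) \<Omega>"
    by (intro has_C2_add K has_C2_affine open_dom)
  moreover have "(\<lambda>x. (U x - (x - 0)) \<bullet> \<tau> + (0 + \<tau> \<bullet> x)) = (\<lambda>x. U x \<bullet> \<tau>)"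
    by (simp add: fun_eq_iff inner_diff_left inner_commute[of \<tau>])
  moreover have "(\<lambda>x. (HU x - mat 1) *v \<tau> + \<tau>) = (\<lambda>x. HU x *v \<tau>)"
    by (simp add: fun_eq_iff matrix_vector_mult_diff_rdistrib)
  ultimately have "harmonic (\<lambda>x. U x \<bullet> \<tau>) (\<lambda>x. HU x *v \<tau>) K \<Omega>"
    unfolding harmonic_def using K(2) by simp
  then show ?thesis by blast
qed

text \<open>Going straight down along \<open>e\<close> by the height reaches the frontier, where
  \<open>u\<close> vanishes, and the path has exactly that length.\<close>

lemma height_bound:
  assumes ch: "chart \<Omega> p0 r e g G K" and L: "\<And>x y. x \<in> closure \<Omega> \<Longrightarrow> y \<in> closure \<Omega> \<Longrightarrow> \<bar>u x - u y\<bar> \<le> L * dist x y"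
    and x: "x \<in> closure \<Omega>" "dist p0 x < r / 2" "x \<bullet> e - g x < r / 2"
  shows "\<bar>u x\<bar> \<le> L * (x \<bullet> e - g x)"
proof -
  have c: "r > 0" "norm e = 1" and inv: "\<forall>x t. g (x + t *\<^sub>R e) = g x"
    using ch unfolding chart_def by blast+
  have xb: "x \<in> ball p0 r" using x c by simp
  define t where "t = x \<bullet> e - g x"
  have t: "t \<ge> 0" "t < r / 2" using chart_frontier(2)[OF ch open_dom xb] x by (auto simp: t_def)
  define y where "y = x + (- t) *\<^sub>R e"
  have d: "dist x y = t" using t c by (simp add: y_def dist_norm)
  have yb: "y \<in> ball p0 r" using dist_triangle[of p0 y x] d t x by simp
  have "y \<bullet> e = x \<bullet> e - t" using c(2) by (simp add: y_def inner_diff_left inner_add_left power2_norm_eq_inner[symmetric] dot_square_norm)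
  moreover have "g y = g x" unfolding y_def using inv by blast
  ultimately have "y \<in> frontier \<Omega>" using chart_frontier(3)[OF ch open_dom yb] by (simp add: t_def)
  then have "u y = 0" "y \<in> closure \<Omega>" by (auto simp: boundary_u frontier_def)
  then show ?thesis using L[OF x(1), of y] d by (simp add: t_def)
qed

text \<open>Boundary derivatives of \<open>u\<close> are not known to exist, so finite differences
  are compared with the barrier. The increment of \<open>u\<close> under a shift by
  \<open>s * \<tau>\<close> is harmonic; for \<tau> tangent at \<open>q\<close> it is O(s (|z - q| +
  s)) on the boundary, because such a shift changes heights only to second order. The constant does
  not depend on \<open>s\<close>, so s may tend to 0.\<close>

lemma tangential_bound:
  assumes ch: "chart \<Omega> p0 r e g G K"
  shows "\<exists>\<rho> C. 0 < \<rho> \<and> \<rho> \<le> r / 8 \<and> \<rho> \<le> 1 \<and> C > 0 \<and> (\<forall>q\<in>frontier \<Omega> \<inter> ball p0 (r / 8). \<exists>n. norm n = 1 \<and>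
    (\<forall>\<tau>. \<tau> \<bullet> n = 0 \<and> norm \<tau> \<le> 1 \<longrightarrow> (\<forall>y\<in>\<Omega> \<inter> ball q \<rho>. \<bar>U y \<bullet> \<tau>\<bar> \<le> C * dist y q powr (3/4))))"
proof -
  let ?N = "real CARD('n)"
  have N: "?N \<ge> 1" by (simp add: Suc_leI)
  obtain L where L: "L > 0" "\<And>x y. x \<in> closure \<Omega> \<Longrightarrow> y \<in> closure \<Omega> \<Longrightarrow> \<bar>u x - u y\<bar> \<le> L * dist x y"
    using u_lipschitz by blast
  have c: "r > 0" "K \<ge> 1" "norm e = 1"
    and G: "\<forall>x\<in>ball p0 r. G x \<bullet> e = 0 \<and> norm (G x) \<le> K"
    and GK: "\<forall>x\<in>ball p0 r. \<forall>y\<in>ball p0 r. norm (G x - G y) \<le> K * dist x y"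
    and T: "\<forall>x\<in>ball p0 r. \<forall>y\<in>ball p0 r. \<bar>g y - g x - G x \<bullet> (y - x)\<bar> \<le> K * (dist x y)\<^sup>2"
    using ch unfolding chart_def by blast+
  \<comment> \<open>The bound 1 / (28 N K) makes the quadratic deviation of the domain from its
    tangent half space at most |x - q| / (28 N), which is what \<open>barrier\<close>
    tolerates.\<close>
  define \<rho> where "\<rho> = min (r / 8) (min 1 (1 / (28 * ?N * K)))"
  have rho: "\<rho> > 0" "\<rho> \<le> r / 8" "\<rho> \<le> 1" "\<rho> \<le> 1 / (28 * ?N * K)" using c N by (auto simp: \<rho>_def)
  \<comment> \<open>\<open>L * K\<close> serves boundary points where \<open>z\<close> or its
    translate lies on the frontier, \<open>L / \<rho>\<close> the sphere of radius \<rho> around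
    \<open>q\<close>.\<close>
  define C1 where "C1 = L * K + L / \<rho>"
  have C1: "C1 > 0" "L * K \<le> C1" "L / \<rho> \<le> C1" using L c rho by (auto simp: C1_def add_pos_pos)
  define C where "C = 4 * C1 * (1 + 21 * ?N)"
  have C: "C > 0" using C1 N by (simp add: C_def)
  have "\<exists>n. norm n = 1 \<and> (\<forall>\<tau>. \<tau> \<bullet> n = 0 \<and> norm \<tau> \<le> 1 \<longrightarrow> (\<forall>y\<in>\<Omega> \<inter> ball q \<rho>. \<bar>U y \<bullet> \<tau>\<bar> \<le> C * dist y q powr (3/4)))"
    if q: "q \<in> frontier \<Omega>" "q \<in> ball p0 (r / 8)" for q
  proof -
    have qb: "q \<in> ball p0 r" using q c by auto
    have qe: "q \<bullet> e = g q" using chart_frontier(3)[OF ch open_dom qb] q by simp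
    define a where "a = norm (e - G q)"
    have "(e - G q) \<bullet> e = 1"
      using G[rule_format, OF qb] c by (simp add: inner_diff_left dot_square_norm)
    then have a1: "a \<ge> 1"
      using norm_cauchy_schwarz[of "e - G q" e] c by (simp add: a_def)
    define n where "n = (1 / a) *\<^sub>R (e - G q)"
    have n1: "norm n = 1" using a1 by (auto simp: n_def a_def)
    obtain B F H where B: "continuous_on UNIV B" "has_C2 B F H (- {q})"
      "\<And>x. \<bar>B x\<bar> \<le> (1 + 21 * ?N) * dist x q powr (3/4)"
      "\<And>x. x \<noteq> q \<Longrightarrow> (x - q) \<bullet> n \<ge> - (dist x q / (28 * ?N)) \<Longrightarrow> trace (H x) \<le> 0 \<and> B x \<ge> dist x q powr (3/4) / 4"
      using barrier[OF n1, of q] by blast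
    have inb: "x \<in> ball p0 (r / 4)" if "dist x q \<le> \<rho>" for x
    proof -
      have "dist p0 x \<le> dist p0 q + dist x q" using dist_triangle[of p0 x q] by (simp add: dist_commute)
      then show ?thesis using q that rho by simp
    qed
    have low: "(x - q) \<bullet> n \<ge> - (dist x q / (28 * ?N))" if x: "x \<in> closure \<Omega>" "dist x q \<le> \<rho>" for x
    proof -
      have xb: "x \<in> ball p0 r" using inb[OF x(2)] c by auto
      have xe: "x \<bullet> e \<ge> g x" using chart_frontier(2)[OF ch open_dom xb] x by simp
      have t: "\<bar>g x - g q - G q \<bullet> (x - q)\<bar> \<le> K * (dist q x)\<^sup>2" using T qb xb by blast
      have lo: "(x - q) \<bullet> (e - G q) \<ge> - (K * (dist q x)\<^sup>2)"
        using xe qe t by (simp add: inner_diff_left inner_diff_right inner_commute abs_le_iff)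
      have "(x - q) \<bullet> n = (x - q) \<bullet> (e - G q) / a" by (simp add: n_def)
      also have "\<dots> \<ge> - (K * (dist q x)\<^sup>2) / a"
        using lo a1 by (intro divide_right_mono) auto
      finally have "(x - q) \<bullet> n \<ge> - (K * (dist q x)\<^sup>2) / a" .
      moreover have "K * (dist q x)\<^sup>2 / a \<le> K * (dist q x)\<^sup>2 / 1"
        using a1 c by (intro divide_left_mono) auto
      moreover have "K * (dist q x)\<^sup>2 \<le> dist x q / (28 * ?N)"
      proof -
        have "K * dist x q \<le> K * (1 / (28 * ?N * K))" using x(2) rho c by (intro mult_left_mono) auto
        also have "\<dots> = 1 / (28 * ?N)" using c by simp
        finally have "K * dist x q * dist x q \<le> 1 / (28 * ?N) * dist x q" by (intro mult_right_mono) auto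
        then show ?thesis by (simp add: power2_eq_square dist_commute mult.assoc)
      qed
      ultimately show ?thesis by linarith
    qed
    have "\<bar>U y \<bullet> \<tau>\<bar> \<le> C * dist y q powr (3/4)" if tau: "\<tau> \<bullet> n = 0" "norm \<tau> \<le> 1" and y: "y \<in> \<Omega>" "y \<in> ball q \<rho>" for \<tau> y
    proof -
      \<comment> \<open>Tangency at \<open>q\<close>: the slope of \<open>g\<close> along \<tau>
        matches that of the coordinate \<open>e\<close>. A shift therefore changes the height only
        through the variation of \<open>G\<close> between \<open>q\<close> and \<open>x\<close> and
        the Taylor remainder.\<close>
      have te: "\<tau> \<bullet> e = \<tau> \<bullet> G q"
        using tau a1 by (simp add: n_def inner_diff_right)
      \<comment> \<open>r / 16 keeps shifted points within r / 2 of \<open>p0\<close>; 1 and r / (8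
        K) keep the change of height below r / 2, as \<open>height_bound\<close> requires.\<close>
      define s0 where "s0 = min (r / 16) (min 1 (r / (8 * K)))"
      have s0: "s0 > 0" "s0 \<le> r / 16" "s0 \<le> 1" "s0 \<le> r / (8 * K)" using c by (auto simp: s0_def)
      have hd: "\<bar>(x + s *\<^sub>R \<tau>) \<bullet> e - g (x + s *\<^sub>R \<tau>) - (x \<bullet> e - g x)\<bar> \<le> s * K * (dist x q + s)"
        and xs: "dist p0 (x + s *\<^sub>R \<tau>) < r / 2"
        if s: "0 < s" "s \<le> s0" and x: "dist x q \<le> \<rho>" for s x
      proof -
        have st: "norm (s *\<^sub>R \<tau>) \<le> s" using s tau by (simp add: mult_left_le)
        have "dist p0 (x + s *\<^sub>R \<tau>) \<le> dist p0 x + norm (s *\<^sub>R \<tau>)"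
          using dist_triangle[of p0 "x + s *\<^sub>R \<tau>" x] by (simp add: dist_norm)
        moreover have "dist p0 x < r / 4" using inb[OF x] by simp
        ultimately show xs: "dist p0 (x + s *\<^sub>R \<tau>) < r / 2" using st s s0 c(1) by linarith
        have xb: "x \<in> ball p0 r" "x + s *\<^sub>R \<tau> \<in> ball p0 r" using inb[OF x] xs c by auto
        have t: "\<bar>g (x + s *\<^sub>R \<tau>) - g x - G x \<bullet> (x + s *\<^sub>R \<tau> - x)\<bar> \<le> K * (dist x (x + s *\<^sub>R \<tau>))\<^sup>2"
          using T xb by blast
        have "K * (dist x (x + s *\<^sub>R \<tau>))\<^sup>2 \<le> K * s\<^sup>2"
          using st c by (intro mult_left_mono power_mono) (auto simp: dist_norm)
        then have t': "\<bar>g (x + s *\<^sub>R \<tau>) - g x - s * (G x \<bullet> \<tau>)\<bar> \<le> K * s\<^sup>2" using t by simp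
        have "\<bar>(G q - G x) \<bullet> \<tau>\<bar> \<le> norm (G q - G x) * norm \<tau>" by (rule Cauchy_Schwarz_ineq2)
        also have "\<dots> \<le> (K * dist q x) * 1"
          using GK qb xb tau c by (intro mult_mono) auto
        finally have "s * \<bar>(G q - G x) \<bullet> \<tau>\<bar> \<le> s * (K * dist q x)" using s by (intro mult_left_mono) auto
        then have t'': "\<bar>s * (\<tau> \<bullet> e) - s * (G x \<bullet> \<tau>)\<bar> \<le> s * (K * dist x q)"
          using s unfolding te
          by (simp add: inner_diff_left inner_commute[of \<tau>] abs_mult dist_commute flip: right_diff_distrib)
        have "(x + s *\<^sub>R \<tau>) \<bullet> e - g (x + s *\<^sub>R \<tau>) - (x \<bullet> e - g x)
            = (s * (\<tau> \<bullet> e) - s * (G x \<bullet> \<tau>)) - (g (x + s *\<^sub>R \<tau>) - g x - s * (G x \<bullet> \<tau>))"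
          by (simp add: inner_add_left)
        also have "\<bar>\<dots>\<bar> \<le> s * (K * dist x q) + K * s\<^sup>2"
          using t' t'' by (rule order_trans[OF abs_triangle_ineq4 add_mono, rotated])
        also have "\<dots> = s * K * (dist x q + s)" by (simp add: power2_eq_square algebra_simps)
        finally show "\<bar>(x + s *\<^sub>R \<tau>) \<bullet> e - g (x + s *\<^sub>R \<tau>) - (x \<bullet> e - g x)\<bar> \<le> s * K * (dist x q + s)" .
      qed
      have main: "\<bar>u (x + s *\<^sub>R \<tau>) - u x\<bar> \<le> s * (C * dist x q powr (3/4) + C1 * s)"
        if s: "0 < s" "s \<le> s0" and x: "x \<in> \<Omega>" "x + s *\<^sub>R \<tau> \<in> \<Omega>" "x \<in> ball q \<rho>" for s x
      proof -
        \<comment> \<open>Where both \<open>u\<close> and its translate are defined; there the two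
          constant Laplacians cancel in the difference.\<close>
        define D where "D = (\<Omega> \<inter> (\<lambda>x. x + s *\<^sub>R \<tau>) -` \<Omega>) \<inter> ball q \<rho>"
        have oD: "open D" unfolding D_def
          by (intro open_Int open_dom open_ball open_vimage continuous_intros)
        have DO: "D \<subseteq> \<Omega>" by (auto simp: D_def)
        have clD: "z \<in> closure \<Omega>" "z + s *\<^sub>R \<tau> \<in> closure \<Omega>" "dist z q \<le> \<rho>" if "z \<in> closure D" for z
        proof -
          show "z \<in> closure \<Omega>" using closure_mono[OF DO] that by blast
          have "(\<lambda>x. x + s *\<^sub>R \<tau>) ` closure D \<subseteq> closure \<Omega>"
            by (rule image_closure_subset) (use closure_subset in \<open>auto intro!: continuous_intros simp: D_def\<close>)
          then show "z + s *\<^sub>R \<tau> \<in> closure \<Omega>" using that by blast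
          have "closure D \<subseteq> cball q \<rho>" by (rule closure_minimal) (auto simp: D_def)
          then show "dist z q \<le> \<rho>" using that by (auto simp: dist_commute)
        qed
        have bdry: "\<bar>u (z + s *\<^sub>R \<tau>) - u z\<bar> \<le> s * (4 * C1 * B z + C1 * s)" if z: "z \<in> frontier D" for z
        proof -
          have zc: "z \<in> closure D" "z \<notin> D" using z oD by (auto simp: frontier_def interior_open)
          note zz = clD[OF zc(1)]
          have hdz: "\<bar>(z + s *\<^sub>R \<tau>) \<bullet> e - g (z + s *\<^sub>R \<tau>) - (z \<bullet> e - g z)\<bar> \<le> s * K * (dist z q + s)"
            by (rule hd[OF s zz(3)])
          have small: "s * K * (dist z q + s) < r / 2"
          proof -
            have "s * K \<le> r / (8 * K) * K" using s s0 c by (intro mult_right_mono) auto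
            then have "s * K \<le> r / 8" using c by simp
            then have "s * K * (dist z q + s) \<le> r / 8 * 2"
              using zz(3) rho s s0 c by (intro mult_mono) auto
            then show ?thesis using c by simp
          qed
          have zb: "z \<in> ball p0 r" "z + s *\<^sub>R \<tau> \<in> ball p0 r"
            using inb[OF zz(3)] xs[OF s zz(3)] c by auto
          have zh: "dist p0 z < r / 2" using inb[OF zz(3)] c by simp
          \<comment> \<open>Distances here are at most \<rho> <= 1, so a barrier of order 3/4
            dominates the linear bound on the boundary.\<close>
          have r34: "dist z q \<le> dist z q powr (3/4)"
          proof (cases "z = q")
            case False
            then show ?thesis using powr_mono'[of "3/4" 1 "dist z q"] zz(3) rho by simp
          qed simp
          have dB: "dist z q \<le> 4 * B z"
          proof (cases "z = q")
            case True
            then show ?thesis using B(3)[of q] by simp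
          next
            case False
            then show ?thesis using B(4)[OF False low[OF zz(1,3)]] r34 by simp
          qed
          have lin: "\<bar>u (z + s *\<^sub>R \<tau>) - u z\<bar> \<le> s * (C1 * (dist z q + s))"
          proof -
            \<comment> \<open>In the first two cases one of the two values of \<open>u\<close> is 0
              and the other belongs to a point whose height is at most the change of height; in the
              third the Lipschitz bound suffices because the distance to \<open>q\<close> is
              fixed.\<close>
            consider "z \<in> frontier \<Omega>" | "z + s *\<^sub>R \<tau> \<in> frontier \<Omega>" | "dist z q = \<rho>"
              using zc zz closure_dom_cases[OF zz(1)] closure_dom_cases[OF zz(2)]
              by (auto simp: D_def dist_commute)
            then show ?thesis
            proof cases
              case 1
              then have h0: "z \<bullet> e = g z" using chart_frontier(3)[OF ch open_dom zb(1)] by simp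
              have "\<bar>u (z + s *\<^sub>R \<tau>)\<bar> \<le> L * ((z + s *\<^sub>R \<tau>) \<bullet> e - g (z + s *\<^sub>R \<tau>))"
                using h0 hdz small by (intro height_bound[OF ch L(2) zz(2) xs[OF s zz(3)]]) auto
              also have "\<dots> \<le> L * (s * K * (dist z q + s))"
                using h0 hdz L(1) by (intro mult_left_mono) auto
              also have "\<dots> = (L * K) * (s * (dist z q + s))" by simp
              also have "\<dots> \<le> C1 * (s * (dist z q + s))" using C1 s by (intro mult_right_mono) auto
              finally show ?thesis using boundary_u[OF 1] by (simp add: mult_ac)
            next
              case 2
              then have h0: "(z + s *\<^sub>R \<tau>) \<bullet> e = g (z + s *\<^sub>R \<tau>)" using chart_frontier(3)[OF ch open_dom zb(2)] by simp
              have "\<bar>u z\<bar> \<le> L * (z \<bullet> e - g z)"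
                using h0 hdz small by (intro height_bound[OF ch L(2) zz(1) zh]) auto
              also have "\<dots> \<le> L * (s * K * (dist z q + s))"
                using h0 hdz L(1) by (intro mult_left_mono) auto
              also have "\<dots> = (L * K) * (s * (dist z q + s))" by simp
              also have "\<dots> \<le> C1 * (s * (dist z q + s))" using C1 s by (intro mult_right_mono) auto
              finally show ?thesis using boundary_u[OF 2] by (simp add: mult_ac)
            next
              case 3
              have "\<bar>u (z + s *\<^sub>R \<tau>) - u z\<bar> \<le> L * norm (s *\<^sub>R \<tau>)"
                using L(2)[OF zz(2,1)] by (simp add: dist_norm)
              also have "\<dots> \<le> L * s" using L(1) s tau by (intro mult_left_mono) (auto simp: mult_left_le)
              also have "\<dots> = (L / \<rho>) * (s * dist z q)" using 3 rho by simp
              also have "\<dots> \<le> C1 * (s * (dist z q + s))"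
                using C1 s L rho by (intro mult_mono mult_left_mono) auto
              finally show ?thesis by (simp add: mult_ac)
            qed
          qed
          also have "\<dots> \<le> s * (C1 * (4 * B z + s))"
            using dB C1 s by (intro mult_left_mono) auto
          also have "\<dots> = s * (4 * C1 * B z + C1 * s)" by (simp add: algebra_simps)
          finally show ?thesis .
        qed
        have cu: "continuous_on (closure D) (\<lambda>z. u (z + s *\<^sub>R \<tau>))" "continuous_on (closure D) u"
          by (intro continuous_on_compose2[OF continuous_u] continuous_intros; use clD in auto)+
        have cB: "continuous_on (closure D) B" using B(1) continuous_on_subset by blast
        have qD: "D \<subseteq> - {q}" using frontier_disjoint[OF q(1)] DO by blast
        have C2s: "has_C2 (\<lambda>z. u (z + s *\<^sub>R \<tau>)) (\<lambda>z. U (z + s *\<^sub>R \<tau>)) (\<lambda>z. HU (z + s *\<^sub>R \<tau>)) D"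
          by (rule has_C2_mono[OF has_C2_shift[OF has_C2_u] _ oD]) (auto simp: D_def)
        have C2u': "has_C2 u U HU D" by (rule has_C2_mono[OF has_C2_u DO oD])
        have C2B: "has_C2 B F H D" by (rule has_C2_mono[OF B(2) qD oD])
        have xD: "x \<in> closure D" using x closure_subset by (force simp: D_def)
        have bD: "bounded D" unfolding D_def by (auto intro: bounded_subset[OF bounded_ball])
        have HB: "trace (H z) \<le> 0" if "z \<in> D" for z
        proof -
          have "z \<in> closure D" using that closure_subset by blast
          then show ?thesis using B(4)[of z] low clD[of z] qD that by blast
        qed
        \<comment> \<open>Treats both signs of the difference. The trace of the Hessian of the
          barrier is at most 0 on \<open>D\<close>, so the comparison function is
          subharmonic.\<close>
        have "\<sigma> * (u (x + s *\<^sub>R \<tau>) - u x) - (4 * C1 * s) * B x - C1 * s\<^sup>2 \<le> 0" if sg: "\<sigma> = 1 \<or> \<sigma> = -1" for \<sigma> :: real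
        proof (rule max_principle[OF _ bD _ _ _ xD])
          show "has_C2 (\<lambda>x. \<sigma> * (u (x + s *\<^sub>R \<tau>) - u x) - (4 * C1 * s) * B x - C1 * s\<^sup>2)
              (\<lambda>x. \<sigma> *\<^sub>R (U (x + s *\<^sub>R \<tau>) - U x) - (4 * C1 * s) *\<^sub>R F x - 0)
              (\<lambda>x. \<sigma> *\<^sub>R (HU (x + s *\<^sub>R \<tau>) - HU x) - (4 * C1 * s) *\<^sub>R H x - 0) D"
            by (intro has_C2_diff has_C2_cmult has_C2_const C2s C2u' C2B oD)
          show "0 \<le> trace (\<sigma> *\<^sub>R (HU (z + s *\<^sub>R \<tau>) - HU z) - (4 * C1 * s) *\<^sub>R H z - 0)" if z: "z \<in> D" for z
          proof -
            have "z \<in> \<Omega>" "z + s *\<^sub>R \<tau> \<in> \<Omega>" using z by (auto simp: D_def)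
            then show ?thesis using HB[OF z] C1 s by (simp add: trace_u mult_nonneg_nonpos)
          qed
          show "continuous_on (closure D) (\<lambda>x. \<sigma> * (u (x + s *\<^sub>R \<tau>) - u x) - (4 * C1 * s) * B x - C1 * s\<^sup>2)"
            by (intro continuous_on_diff continuous_on_mult continuous_on_const cu cB)
          show "\<sigma> * (u (z + s *\<^sub>R \<tau>) - u z) - (4 * C1 * s) * B z - C1 * s\<^sup>2 \<le> 0" if z: "z \<in> frontier D" for z
          proof -
            have "\<sigma> * (u (z + s *\<^sub>R \<tau>) - u z) \<le> \<bar>u (z + s *\<^sub>R \<tau>) - u z\<bar>" using sg by auto
            also note bdry[OF z]
            finally show ?thesis by (simp add: power2_eq_square algebra_simps)
          qed
        qed
        from this[of 1] this[of "-1"]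
        have "\<bar>u (x + s *\<^sub>R \<tau>) - u x\<bar> \<le> (4 * C1 * s) * B x + C1 * s\<^sup>2" by (simp add: abs_le_iff)
        also have "\<dots> \<le> (4 * C1 * s) * ((1 + 21 * ?N) * dist x q powr (3/4)) + C1 * s\<^sup>2"
          using B(3)[of x] C1 s by (intro add_mono mult_left_mono) auto
        also have "\<dots> = s * (C * dist x q powr (3/4) + C1 * s)"
          by (simp add: C_def power2_eq_square algebra_simps)
        finally show ?thesis .
      qed
      have "(u has_derivative (\<lambda>v. U y \<bullet> v)) (at (y + 0 *\<^sub>R \<tau>))"
        using has_C2_u y by (simp add: has_C2_def)
      from translate_dilate_derivative(3)[OF this]
      have "((\<lambda>s. u (y + s *\<^sub>R \<tau>)) has_field_derivative U y \<bullet> \<tau>) (at 0)"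
        unfolding has_field_derivative_def by (rule has_derivative_eq_rhs) (simp add: fun_eq_iff)
      then have "((\<lambda>s. (u (y + s *\<^sub>R \<tau>) - u y) / s) \<longlongrightarrow> U y \<bullet> \<tau>) (at 0)"
        by (simp add: DERIV_def)
      then have lim: "((\<lambda>s. \<bar>(u (y + s *\<^sub>R \<tau>) - u y) / s\<bar>) \<longlongrightarrow> \<bar>U y \<bullet> \<tau>\<bar>) (at_right 0)"
        by (intro tendsto_rabs) (simp add: filterlim_at_split)
      have lim2: "((\<lambda>s. C * dist y q powr (3/4) + C1 * s) \<longlongrightarrow> C * dist y q powr (3/4) + C1 * 0) (at_right 0)"
        by (intro tendsto_intros)
      obtain \<delta> where de: "\<delta> > 0" "ball y \<delta> \<subseteq> \<Omega>" using y open_dom open_contains_ball by blast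
      have "eventually (\<lambda>s. s \<in> {0<..<min \<delta> s0}) (at_right (0::real))"
        using de s0 by (intro eventually_at_right_real) auto
      then have ev: "eventually (\<lambda>s. \<bar>(u (y + s *\<^sub>R \<tau>) - u y) / s\<bar> \<le> C * dist y q powr (3/4) + C1 * s) (at_right 0)"
      proof (rule eventually_mono)
        fix s assume s: "s \<in> {0<..<min \<delta> s0}"
        have "norm (s *\<^sub>R \<tau>) \<le> s" using s tau by (simp add: mult_left_le)
        then have "norm (s *\<^sub>R \<tau>) < \<delta>" using s by (meson greaterThanLessThan_iff min_less_iff_conj order_le_less_trans)
        then have "y + s *\<^sub>R \<tau> \<in> ball y \<delta>" by (simp add: dist_norm)
        then have "\<bar>u (y + s *\<^sub>R \<tau>) - u y\<bar> \<le> s * (C * dist y q powr (3/4) + C1 * s)"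
          using de s y by (intro main) auto
        then show "\<bar>(u (y + s *\<^sub>R \<tau>) - u y) / s\<bar> \<le> C * dist y q powr (3/4) + C1 * s"
          using s by (simp add: abs_divide divide_le_eq mult.commute)
      qed
      \<comment> \<open>As \<open>s\<close> tends to 0 the term \<open>C1 * s\<close> disappears and
        the quotient becomes the tangential derivative.\<close>
      show ?thesis using tendsto_le[OF _ lim2 lim ev] by simp
    qed
    then show ?thesis using n1 by blast
  qed
  then show ?thesis using rho C by (intro exI[of _ \<rho>] exI[of _ C]) auto
qed

text \<open>At boundary distance \<open>d\<close> the derivatives tangential at the nearest boundary
  point are O(d^(3/4)) on a ball of radius d / 2, so their gradients are O(d^(-1/4)).
  \<open>symmetric_trace_bound\<close> extends this to the full Hessian, and squaring gives the
  exponent -1/2.\<close>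

lemma hessian_boundary:
  assumes ch: "chart \<Omega> p0 r e g G K" and p0: "p0 \<in> frontier \<Omega>"
  shows "\<exists>\<rho> C. 0 < \<rho> \<and> \<rho> \<le> r / 8 \<and> C > 0 \<and>
     (\<forall>x\<in>\<Omega> \<inter> ball p0 \<rho>. (norm (HU x))\<^sup>2 \<le> C * (x \<bullet> e - g x) powr (-1/2))"
proof -
  let ?N = "real CARD('n)"
  have N: "?N \<ge> 1" by (simp add: Suc_leI)
  obtain \<rho> C where rho: "0 < \<rho>" "\<rho> \<le> r / 8" "\<rho> \<le> 1" and C: "C > 0"
    and tan: "\<And>q. q \<in> frontier \<Omega> \<Longrightarrow> q \<in> ball p0 (r / 8) \<Longrightarrow> \<exists>n. norm n = 1 \<and>
      (\<forall>\<tau>. \<tau> \<bullet> n = 0 \<and> norm \<tau> \<le> 1 \<longrightarrow> (\<forall>y\<in>\<Omega> \<inter> ball q \<rho>. \<bar>U y \<bullet> \<tau>\<bar> \<le> C * dist y q powr (3/4)))"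
    using tangential_bound[OF ch] by blast
  have c: "r > 0" "K \<ge> 1" "norm e = 1"
    and gK: "\<forall>x\<in>ball p0 r. \<forall>y\<in>ball p0 r. \<bar>g x - g y\<bar> \<le> K * dist x y"
    using ch unfolding chart_def by blast+
  define A where "A = 4 * grad_const TYPE('n) * C"
  have A: "A > 0" using C grad_const_pos[where 'n='n] by (simp add: A_def)
  define C' where "C' = (?N * (?N + 2))\<^sup>2 * (2 * (A\<^sup>2 + 1)) * (1 + K) powr (1/2)"
  have C'pos: "C' > 0" using N c A by (simp add: C'_def add_pos_pos)
  have "(norm (HU x))\<^sup>2 \<le> C' * (x \<bullet> e - g x) powr (-1/2)" if x: "x \<in> \<Omega>" "x \<in> ball p0 (\<rho> / 2)" for x
  proof -
    obtain q where q: "q \<in> frontier \<Omega>" "bdist x = dist x q" using bdist_attained[of x] by blast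
    define d where "d = dist x q"
    have d0: "d > 0" using bdist_pos[OF x(1)] q by (simp add: d_def)
    have "d \<le> dist x p0" using infdist_le[OF p0, of x] q by (simp add: d_def)
    then have d1: "d < \<rho> / 2" using x by (simp add: dist_commute)
    have "dist p0 q \<le> dist p0 x + d" unfolding d_def by (rule dist_triangle)
    then have qb: "q \<in> ball p0 (r / 8)" using x d1 rho by simp
    obtain n where n: "norm n = 1" "\<And>\<tau> y. \<tau> \<bullet> n = 0 \<Longrightarrow> norm \<tau> \<le> 1 \<Longrightarrow> y \<in> \<Omega> \<Longrightarrow> y \<in> ball q \<rho> \<Longrightarrow>
        \<bar>U y \<bullet> \<tau>\<bar> \<le> C * dist y q powr (3/4)"
      using tan[OF q(1) qb] by blast
    have sub: "cball x (d / 2) \<subseteq> \<Omega>" using cball_bdist[OF x(1), of "d / 2"] d0 q by (simp add: d_def)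
    define E where "E = A * d powr (-1/4)"
    have E: "norm (HU x *v \<tau>) \<le> E" if tau: "\<tau> \<bullet> n = 0" "norm \<tau> \<le> 1" for \<tau>
    proof -
      obtain K where har: "harmonic (\<lambda>x. U x \<bullet> \<tau>) (\<lambda>x. HU x *v \<tau>) K \<Omega>"
        using harmonic_tangential by blast
      have "norm (HU x *v \<tau>) \<le> grad_const TYPE('n) * (C * (2 * d powr (3/4))) / (d / 2)"
      proof (rule harmonic_gradient_bound[OF har sub])
        fix y assume y: "y \<in> cball x (d / 2)"
        have "dist y q \<le> dist y x + dist x q" by (rule dist_triangle)
        then have yq: "dist y q \<le> (3/2) * d" using y by (simp add: d_def dist_commute)
        then have "y \<in> ball q \<rho>" using d1 rho by (simp add: dist_commute)
        then have "\<bar>U y \<bullet> \<tau>\<bar> \<le> C * dist y q powr (3/4)" using n(2)[OF tau] sub y by blast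
        also have "\<dots> \<le> C * (2 * d powr (3/4))"
        proof -
          have "dist y q powr (3/4) \<le> ((3/2) * d) powr (3/4)" using yq by (intro powr_mono2) auto
          also have "\<dots> = (3/2) powr (3/4) * d powr (3/4)" by (subst powr_mult) (use d0 in auto)
          also have "\<dots> \<le> 2 * d powr (3/4)"
            using powr_mono[of "3/4" 1 "3/2::real"] by (intro mult_right_mono) auto
          finally have "dist y q powr (3/4) \<le> 2 * d powr (3/4)" .
          then show ?thesis using C by (intro mult_left_mono) auto
        qed
        finally show "\<bar>U y \<bullet> \<tau>\<bar> \<le> C * (2 * d powr (3/4))" .
      qed (use d0 in auto)
      also have "\<dots> = A * (d powr (3/4) / d)" by (simp add: A_def)
      also have "d powr (3/4) / d = d powr (-1/4)"
        using d0 powr_diff[of d "3/4" 1] by simp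
      finally show ?thesis by (simp add: E_def)
    qed
    have E0: "E \<ge> 0" using A by (simp add: E_def)
    have "norm (HU x) \<le> ?N * ((?N + 2) * (E + 1))"
      by (rule symmetric_trace_bound[OF has_C2_symmetric[OF has_C2_u x(1)] n(1) E trace_u[OF x(1)]])
    then have "(norm (HU x))\<^sup>2 \<le> (?N * ((?N + 2) * (E + 1)))\<^sup>2" by (intro power_mono) auto
    also have "\<dots> = (?N * (?N + 2))\<^sup>2 * (E + 1)\<^sup>2" by (simp add: power2_eq_square mult_ac)
    also have "(E + 1)\<^sup>2 \<le> 2 * (E\<^sup>2 + 1)"
      using zero_le_power2[of "E - 1"] by (simp add: power2_eq_square algebra_simps)
    also have "2 * (E\<^sup>2 + 1) \<le> 2 * (A\<^sup>2 + 1) * d powr (-1/2)"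
    proof -
      have "E\<^sup>2 = A\<^sup>2 * d powr (-1/2)"
        using d0 powr_add[of d "-1/4" "-1/4"] by (simp add: E_def power_mult_distrib power2_eq_square)
      \<comment> \<open>As \<open>d\<close> is below 1, the additive constant is absorbed into the
        singular term.\<close>
      moreover have "1 \<le> d powr (-1/2)" using powr_mono2'[of "-1/2" d 1] d0 d1 rho by simp
      ultimately show ?thesis by (simp add: algebra_simps)
    qed
    \<comment> \<open>The height has Lipschitz constant 1 + K and vanishes at \<open>q\<close>, so
      it is at most (1 + K) d. It replaces the distance because it can be integrated along
      \<open>e\<close>.\<close>
    also have "d powr (-1/2) \<le> (1 + K) powr (1/2) * (x \<bullet> e - g x) powr (-1/2)"
    proof -
      have xb: "x \<in> ball p0 r" "q \<in> ball p0 r" using x rho qb c by auto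
      have h: "x \<bullet> e - g x > 0" using chart_frontier(1)[OF ch open_dom xb(1)] x by simp
      have qe: "q \<bullet> e = g q" using chart_frontier(3)[OF ch open_dom xb(2)] q by simp
      have "\<bar>g x - g q\<bar> \<le> K * d" using gK xb by (simp add: d_def)
      moreover have "(x - q) \<bullet> e \<le> d"
        using norm_cauchy_schwarz[of "x - q" e] c by (simp add: d_def dist_norm)
      ultimately have "x \<bullet> e - g x \<le> (1 + K) * d"
        using qe by (simp add: inner_diff_left algebra_simps abs_le_iff)
      then have "(x \<bullet> e - g x) / (1 + K) \<le> d" using c by (simp add: divide_le_eq mult.commute)
      then have "d powr (-1/2) \<le> ((x \<bullet> e - g x) / (1 + K)) powr (-1/2)"
        using h c by (intro powr_mono2') auto
      also have "\<dots> = (1 + K) powr (1/2) * (x \<bullet> e - g x) powr (-1/2)"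
        using h c by (simp add: powr_divide powr_minus divide_simps)
      finally show ?thesis .
    qed
    finally have "(norm (HU x))\<^sup>2 \<le> (?N * (?N + 2))\<^sup>2 * (2 * (A\<^sup>2 + 1) * ((1 + K) powr (1/2) * (x \<bullet> e - g x) powr (-1/2)))"
      by (simp add: mult_left_mono)
    then show ?thesis by (simp add: C'_def mult_ac)
  qed
  then show ?thesis using rho C'pos by (intro exI[of _ "\<rho> / 2"] exI[of _ C']) auto
qed

end

section \<open>Square integrability of the Hessian\<close>

lemma nn_integral_translate:
  fixes \<phi> :: "'a::euclidean_space \<Rightarrow> ennreal"
  assumes [measurable]: "\<phi> \<in> borel_measurable borel"
  shows "(\<integral>\<^sup>+x. \<phi> (x + c) \<partial>lborel) = (\<integral>\<^sup>+x. \<phi> x \<partial>lborel)"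
proof -
  have "(\<integral>\<^sup>+x. \<phi> x \<partial>lborel) = (\<integral>\<^sup>+x. \<phi> x \<partial>distr lborel borel ((+) c))"
    by (simp only: lborel_distr_plus)
  also have "\<dots> = (\<integral>\<^sup>+x. \<phi> (c + x) \<partial>lborel)" by (rule nn_integral_distr) auto
  finally show ?thesis by (simp add: add.commute)
qed

text \<open>Tonelli and translation invariance. Integrals along an arbitrary direction are thus
  available without rotating coordinates.\<close>

lemma nn_integral_segment_average:
  fixes \<phi> :: "'a::euclidean_space \<Rightarrow> ennreal"
  assumes [measurable]: "\<phi> \<in> borel_measurable borel" and T: "0 \<le> T"
  shows "(\<integral>\<^sup>+x. (\<integral>\<^sup>+s. \<phi> (x + s *\<^sub>R e) * indicator {0..T} s \<partial>lborel) \<partial>lborel) = ennreal T * (\<integral>\<^sup>+x. \<phi> x \<partial>lborel)"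
proof -
  have "(\<integral>\<^sup>+x. (\<integral>\<^sup>+s. \<phi> (x + s *\<^sub>R e) * indicator {0..T} s \<partial>lborel) \<partial>lborel)
      = (\<integral>\<^sup>+s. (\<integral>\<^sup>+x. \<phi> (x + s *\<^sub>R e) * indicator {0..T} s \<partial>lborel) \<partial>lborel)"
    by (rule lborel_pair.Fubini') (simp add: split_beta')
  also have "\<dots> = (\<integral>\<^sup>+s. (\<integral>\<^sup>+x. \<phi> x \<partial>lborel) * indicator {0..T} s \<partial>lborel)"
    by (simp add: nn_integral_multc nn_integral_translate)
  also have "\<dots> = (\<integral>\<^sup>+x. \<phi> x \<partial>lborel) * ennreal T"
    using T by (simp add: nn_integral_cmult_indicator)
  finally show ?thesis by (simp add: mult.commute)
qed

lemma borel_measurable_ennreal_indicator: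
  fixes f :: "'a::topological_space \<Rightarrow> real"
  assumes "A \<in> sets borel" "continuous_on A f"
  shows "(\<lambda>x. ennreal (f x) * indicator A x) \<in> borel_measurable borel"
proof -
  have "(\<lambda>x. ennreal (indicator A x *\<^sub>R f x)) \<in> borel_measurable borel"
    by (rule measurable_compose[OF borel_measurable_continuous_on_indicator[OF assms] measurable_ennreal])
  moreover have "(\<lambda>x. ennreal (indicator A x *\<^sub>R f x)) = (\<lambda>x. ennreal (f x) * indicator A x)"
    by (auto simp: fun_eq_iff indicator_def)
  ultimately show ?thesis by metis
qed

text \<open>Averaging over segments parallel to \<open>e\<close> reduces the claim to the
  integrability of t^(-1/2) at 0, since the height changes at unit speed along them.\<close>

lemma height_singular_integral:
  fixes \<Omega> :: "(real^'n) set"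
  assumes ch: "chart \<Omega> p r e g G K" and o: "open \<Omega>" and rho: "0 < \<rho>" "\<rho> \<le> r / 8"
  shows "(\<integral>\<^sup>+x. ennreal ((x \<bullet> e - g x) powr (-1/2)) * indicator (\<Omega> \<inter> ball p \<rho>) x \<partial>lborel) < \<infinity>"
proof -
  have c: "r > 0" "K \<ge> 1" "norm e = 1" and inv: "\<forall>x t. g (x + t *\<^sub>R e) = g x"
    and gK: "\<forall>x\<in>ball p r. \<forall>y\<in>ball p r. \<bar>g x - g y\<bar> \<le> K * dist x y"
    using ch unfolding chart_def by blast+
  let ?A = "\<Omega> \<inter> ball p \<rho>"
  have Ar: "?A \<subseteq> ball p r" using rho c by auto
  define \<phi> where "\<phi> x = ennreal ((x \<bullet> e - g x) powr (-1/2)) * indicator ?A x" for x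
  have hpos: "x \<bullet> e - g x > 0" if "x \<in> ?A" for x
    using chart_frontier(1)[OF ch o, of x] that Ar by auto
  have "continuous_on ?A (\<lambda>x. (x \<bullet> e - g x) powr (-1/2))"
    using hpos by (intro continuous_intros continuous_on_subset[OF chart_cont[OF ch] Ar]) force
  then have m: "\<phi> \<in> borel_measurable borel"
    unfolding \<phi>_def using o by (intro borel_measurable_ennreal_indicator) auto
  define b where "b = \<bar>p \<bullet> e - g p\<bar> + (1 + K) * r"
  have b: "x \<bullet> e - g x \<le> b" if x: "x \<in> ball p r" for x
  proof -
    have "(x - p) \<bullet> e \<le> norm (x - p)" using norm_cauchy_schwarz[of "x - p" e] c by simp
    also have "\<dots> \<le> r" using x by (simp add: dist_norm norm_minus_commute)
    finally have 1: "x \<bullet> e - p \<bullet> e \<le> r" by (simp add: inner_diff_left)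
    have "\<bar>g x - g p\<bar> \<le> K * dist x p" using gK x c by simp
    also have "\<dots> \<le> K * r" using x c by (intro mult_left_mono) (auto simp: dist_commute)
    finally show ?thesis using 1 unfolding b_def by (simp add: algebra_simps abs_if split: if_splits)
  qed
  have b0: "b \<ge> 0" using c by (simp add: b_def)
  define \<kappa> where "\<kappa> = b powr (1/2) / (1/2)"
  define \<psi> where "\<psi> t = ennreal (t powr (-1/2)) * indicator {0..b} t" for t :: real
  have psi: "(\<integral>\<^sup>+t. \<psi> t \<partial>lborel) = ennreal \<kappa>"
  proof -
    have "((\<lambda>x. x powr (-1/2)) has_integral \<kappa>) {0..b}"
      using has_integral_powr_from_0[of "-1/2" b] b0 by (simp add: \<kappa>_def)
    from nn_integral_has_integral_lebesgue'[OF _ this] show ?thesis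
      by (simp add: \<psi>_def)
  qed
  have mpsi: "\<psi> \<in> borel_measurable borel" unfolding \<psi>_def by measurable
  \<comment> \<open>Along the segment the height is an affine parameter of slope -1, so the inner
    integral is at most that of t^(-1/2) over [0, b]. A segment of length \<rho> that meets the
    small ball starts within 2 \<rho> of \<open>p\<close>.\<close>
  have inner: "(\<integral>\<^sup>+s. \<phi> (x + s *\<^sub>R (- e)) * indicator {0..\<rho>} s \<partial>lborel) \<le> ennreal \<kappa> * indicator (cball p (2 * \<rho>)) x" for x
  proof (cases "x \<in> cball p (2 * \<rho>)")
    case True
    have "(\<integral>\<^sup>+s. \<phi> (x + s *\<^sub>R (- e)) * indicator {0..\<rho>} s \<partial>lborel) \<le> (\<integral>\<^sup>+s. \<psi> ((x \<bullet> e - g x) + (-1) * s) \<partial>lborel)"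
    proof (rule nn_integral_mono)
      fix s :: real
      show "\<phi> (x + s *\<^sub>R (- e)) * indicator {0..\<rho>} s \<le> \<psi> ((x \<bullet> e - g x) + (-1) * s)"
      proof (cases "x + s *\<^sub>R (- e) \<in> ?A")
        case True
        have "g (x + (- s) *\<^sub>R e) = g x" using inv by blast
        then have "(x + s *\<^sub>R (- e)) \<bullet> e - g (x + s *\<^sub>R (- e)) = (x \<bullet> e - g x) + (-1) * s"
          using c(3) by (simp add: inner_diff_left dot_square_norm)
        then show ?thesis using hpos[OF True] b[of "x + s *\<^sub>R (- e)"] True Ar
          by (auto simp: \<phi>_def \<psi>_def indicator_def)
      qed (simp add: \<phi>_def)
    qed
    also have "\<dots> = (\<integral>\<^sup>+t. \<psi> t \<partial>lborel)"
      using nn_integral_real_affine[OF mpsi, of "-1" "x \<bullet> e - g x"] by simp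
    finally show ?thesis using True psi by simp
  next
    case False
    have "x + s *\<^sub>R (- e) \<notin> ?A" if "s \<in> {0..\<rho>}" for s
    proof
      assume "x + s *\<^sub>R (- e) \<in> ?A"
      then have "dist p (x + s *\<^sub>R (- e)) < \<rho>" by simp
      moreover have "dist (x + s *\<^sub>R (- e)) x \<le> \<rho>" using that c by (simp add: dist_norm)
      ultimately show False using False dist_triangle[of p x "x + s *\<^sub>R (- e)"] by simp
    qed
    then have "\<phi> (x + s *\<^sub>R (- e)) * indicator {0..\<rho>} s = 0" for s
      by (cases "s \<in> {0..\<rho>}") (auto simp: \<phi>_def indicator_def)
    then show ?thesis by (simp only: nn_integral_const mult_zero_left) simp
  qed
  have "ennreal \<rho> * (\<integral>\<^sup>+x. \<phi> x \<partial>lborel) = (\<integral>\<^sup>+x. (\<integral>\<^sup>+s. \<phi> (x + s *\<^sub>R (- e)) * indicator {0..\<rho>} s \<partial>lborel) \<partial>lborel)"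
    using rho by (intro nn_integral_segment_average[OF m, symmetric]) simp
  also have "\<dots> \<le> (\<integral>\<^sup>+x. ennreal \<kappa> * indicator (cball p (2 * \<rho>)) x \<partial>lborel)"
    by (intro nn_integral_mono inner)
  also have "\<dots> = ennreal \<kappa> * emeasure lborel (cball p (2 * \<rho>))"
    by (rule nn_integral_cmult_indicator) simp
  also have "\<dots> < \<infinity>" using emeasure_lborel_cball_finite[of p "2 * \<rho>"] by (simp add: ennreal_mult_less_top)
  finally have "(\<integral>\<^sup>+x. \<phi> x \<partial>lborel) < \<infinity>"
    using rho by (auto simp: ennreal_mult_less_top)
  then show ?thesis by (simp add: \<phi>_def)
qed

lemma set_integrable_bounded_continuous:
  fixes f :: "'a::euclidean_space \<Rightarrow> real"
  assumes "open S" "bounded S" "continuous_on S f" "\<And>x. x \<in> S \<Longrightarrow> \<bar>f x\<bar> \<le> B"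
  shows "set_integrable lborel S f"
  unfolding set_integrable_def
proof (rule integrableI_bounded_set[where A = S and B = B])
  show "(\<lambda>x. indicator S x *\<^sub>R f x) \<in> borel_measurable lborel"
    using borel_measurable_continuous_on_indicator[OF _ assms(3)] assms(1) by simp
  show "emeasure lborel S < \<infinity>" using assms(2) emeasure_bounded_finite by blast
qed (use assms in auto)

context torsion
begin

text \<open>Formulated for a family so that one constant serves every member: it is used with a
  single function for the Hessian and with all competitors of \<open>mu0\<close> at once.\<close>

lemma covering_bound:
  fixes f :: "'i \<Rightarrow> real^'n \<Rightarrow> ennreal" and E :: "'i \<Rightarrow> ennreal"
  assumes m: "\<And>i. i \<in> I \<Longrightarrow> (\<lambda>x. f i x * indicator \<Omega> x) \<in> borel_measurable borel"
    and near: "\<And>p. p \<in> frontier \<Omega> \<Longrightarrow> \<exists>\<rho>>0. \<exists>C. \<forall>i\<in>I. (\<integral>\<^sup>+x. f i x * indicator (\<Omega> \<inter> ball p \<rho>) x \<partial>lborel) \<le> ennreal C * E i"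
    and inside: "\<And>Q. compact Q \<Longrightarrow> Q \<subseteq> \<Omega> \<Longrightarrow> \<exists>C. \<forall>i\<in>I. (\<integral>\<^sup>+x. f i x * indicator Q x \<partial>lborel) \<le> ennreal C * E i"
  shows "\<exists>C\<ge>0. \<forall>i\<in>I. (\<integral>\<^sup>+x. f i x * indicator \<Omega> x \<partial>lborel) \<le> ennreal C * E i"
proof -
  obtain \<rho> C where rC: "\<And>p. p \<in> frontier \<Omega> \<Longrightarrow> \<rho> p > 0 \<and>
      (\<forall>i\<in>I. (\<integral>\<^sup>+x. f i x * indicator (\<Omega> \<inter> ball p (\<rho> p)) x \<partial>lborel) \<le> ennreal (C p) * E i)"
    using near by metis
  have "frontier \<Omega> \<subseteq> (\<Union>p\<in>frontier \<Omega>. ball p (\<rho> p))" using rC by force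
  then obtain D where D: "D \<subseteq> frontier \<Omega>" "finite D" "frontier \<Omega> \<subseteq> (\<Union>p\<in>D. ball p (\<rho> p))"
    using compactE_image[OF compact_frontier_dom, of "frontier \<Omega>" "\<lambda>p. ball p (\<rho> p)"] by auto
  \<comment> \<open>What finitely many boundary balls leave of the closure is compact and lies
    inside the domain.\<close>
  define Q where "Q = closure \<Omega> - (\<Union>p\<in>D. ball p (\<rho> p))"
  have cQ: "compact Q" unfolding Q_def
    using bounded_dom by (intro compact_diff open_UN) auto
  have QO: "Q \<subseteq> \<Omega>" using closure_dom_cases D(3) by (auto simp: Q_def)
  obtain C0 where C0: "\<And>i. i \<in> I \<Longrightarrow> (\<integral>\<^sup>+x. f i x * indicator Q x \<partial>lborel) \<le> ennreal C0 * E i"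
    using inside[OF cQ QO] by blast
  define C' where "C' = max 0 C0 + (\<Sum>p\<in>D. max 0 (C p))"
  have "(\<integral>\<^sup>+x. f i x * indicator \<Omega> x \<partial>lborel) \<le> ennreal C' * E i" if i: "i \<in> I" for i
  proof -
    have mQ: "(\<lambda>x. f i x * indicator B x) \<in> borel_measurable borel" if "B \<subseteq> \<Omega>" "B \<in> sets borel" for B
    proof -
      have [measurable]: "(\<lambda>x. f i x * indicator \<Omega> x) \<in> borel_measurable borel" "B \<in> sets borel"
        using m[OF i] that by auto
      have "(\<lambda>x. (f i x * indicator \<Omega> x) * indicator B x) \<in> borel_measurable borel"
        by measurable
      moreover have "(\<lambda>x. (f i x * indicator \<Omega> x) * indicator B x) = (\<lambda>x. f i x * indicator B x)"
        using that by (auto simp: fun_eq_iff indicator_def)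
      ultimately show ?thesis by simp
    qed
    have mB: "(\<lambda>x. f i x * indicator (\<Omega> \<inter> ball p (\<rho> p)) x) \<in> borel_measurable borel" for p
      using open_dom by (intro mQ) auto
    have mQ': "(\<lambda>x. f i x * indicator Q x) \<in> borel_measurable borel"
      using QO cQ by (intro mQ) (auto simp: borel_compact)
    have "(\<integral>\<^sup>+x. f i x * indicator \<Omega> x \<partial>lborel)
       \<le> (\<integral>\<^sup>+x. f i x * indicator Q x + (\<Sum>p\<in>D. f i x * indicator (\<Omega> \<inter> ball p (\<rho> p)) x) \<partial>lborel)"
    proof (rule nn_integral_mono)
      fix x
      show "f i x * indicator \<Omega> x \<le> f i x * indicator Q x + (\<Sum>p\<in>D. f i x * indicator (\<Omega> \<inter> ball p (\<rho> p)) x)"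
      proof (cases "x \<in> \<Omega>")
        case x: True
        show ?thesis
        proof (cases "x \<in> Q")
          case True
          then show ?thesis using x by simp
        next
          case False
          then obtain p where p: "p \<in> D" "x \<in> ball p (\<rho> p)"
            using x closure_subset by (force simp: Q_def)
          have "f i x * indicator \<Omega> x = f i x * indicator (\<Omega> \<inter> ball p (\<rho> p)) x"
            using x p by simp
          also have "\<dots> \<le> (\<Sum>p\<in>D. f i x * indicator (\<Omega> \<inter> ball p (\<rho> p)) x)"
            by (rule member_le_sum[OF p(1)]) (use D in auto)
          finally show ?thesis by (simp add: add_increasing)
        qed
      qed simp
    qed
    also have "\<dots> = (\<integral>\<^sup>+x. f i x * indicator Q x \<partial>lborel) + (\<Sum>p\<in>D. (\<integral>\<^sup>+x. f i x * indicator (\<Omega> \<inter> ball p (\<rho> p)) x \<partial>lborel))"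
      using mB mQ' by (subst nn_integral_add) (auto simp: nn_integral_sum)
    also have "\<dots> \<le> ennreal (max 0 C0) * E i + (\<Sum>p\<in>D. ennreal (max 0 (C p)) * E i)"
    proof (intro add_mono sum_mono)
      have "ennreal C0 * E i \<le> ennreal (max 0 C0) * E i" by (intro mult_right_mono ennreal_leI) auto
      then show "(\<integral>\<^sup>+x. f i x * indicator Q x \<partial>lborel) \<le> ennreal (max 0 C0) * E i"
        using C0[OF i] by (rule order_trans[rotated])
      fix p assume p: "p \<in> D"
      have "ennreal (C p) * E i \<le> ennreal (max 0 (C p)) * E i" by (intro mult_right_mono ennreal_leI) auto
      moreover have "(\<integral>\<^sup>+x. f i x * indicator (\<Omega> \<inter> ball p (\<rho> p)) x \<partial>lborel) \<le> ennreal (C p) * E i"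
        using rC D(1) p i by blast
      ultimately show "(\<integral>\<^sup>+x. f i x * indicator (\<Omega> \<inter> ball p (\<rho> p)) x \<partial>lborel) \<le> ennreal (max 0 (C p)) * E i"
        by (rule order_trans[rotated])
    qed
    also have "\<dots> = ennreal C' * E i"
      by (simp add: C'_def sum_nonneg ennreal_plus flip: sum_distrib_right distrib_right)
    finally show ?thesis .
  qed
  moreover have "C' \<ge> 0" by (simp add: C'_def sum_nonneg)
  ultimately show ?thesis by blast
qed

lemma emeasure_compact_bound:
  assumes "compact Q" and b: "\<And>x. x \<in> Q \<Longrightarrow> f x \<le> ennreal B"
  shows "(\<integral>\<^sup>+x. f x * indicator Q x \<partial>lborel) \<le> ennreal B * emeasure lborel Q"
proof -
  have "(\<integral>\<^sup>+x. f x * indicator Q x \<partial>lborel) \<le> (\<integral>\<^sup>+x. ennreal B * indicator Q x \<partial>lborel)"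
    by (rule nn_integral_mono) (use b in \<open>auto simp: indicator_def\<close>)
  also have "\<dots> = ennreal B * emeasure lborel Q"
    using assms(1) by (intro nn_integral_cmult_indicator) (auto simp: borel_compact)
  finally show ?thesis .
qed

text \<open>Near the boundary the squared Hessian is at most a constant times height^(-1/2), whose
  integral is finite; on compact subsets it is bounded by continuity.\<close>

lemma hessian_square_integrable: "set_integrable lborel \<Omega> (\<lambda>x. (norm (HU x))\<^sup>2)"
proof -
  have cH: "continuous_on \<Omega> (\<lambda>x. (norm (HU x))\<^sup>2)"
    using has_C2_u unfolding has_C2_def by (auto intro!: continuous_intros)
  have m0: "(\<lambda>x. indicator \<Omega> x *\<^sub>R (norm (HU x))\<^sup>2) \<in> borel_measurable borel"
    using open_dom by (intro borel_measurable_continuous_on_indicator cH) auto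
  have eq: "(\<lambda>x. ennreal (indicator \<Omega> x *\<^sub>R (norm (HU x))\<^sup>2)) = (\<lambda>x. ennreal ((norm (HU x))\<^sup>2) * indicator \<Omega> x)"
    by (auto simp: fun_eq_iff indicator_def)
  have "\<exists>C\<ge>0. \<forall>i\<in>{()}. (\<integral>\<^sup>+x. ennreal ((norm (HU x))\<^sup>2) * indicator \<Omega> x \<partial>lborel) \<le> ennreal C * 1"
  proof (rule covering_bound)
    show "(\<lambda>x. ennreal ((norm (HU x))\<^sup>2) * indicator \<Omega> x) \<in> borel_measurable borel"
      using m0 unfolding eq[symmetric] by simp
  next
    fix p assume p: "p \<in> frontier \<Omega>"
    obtain r e g G K where ch: "chart \<Omega> p r e g G K"
      using C2alpha_boundary_chart[OF boundary p alpha_pos] by blast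
    obtain \<rho> C where r: "0 < \<rho>" "\<rho> \<le> r / 8" "C > 0"
      and b: "\<And>x. x \<in> \<Omega> \<inter> ball p \<rho> \<Longrightarrow> (norm (HU x))\<^sup>2 \<le> C * (x \<bullet> e - g x) powr (-1/2)"
      using hessian_boundary[OF ch p] by blast
    let ?I = "\<integral>\<^sup>+x. ennreal ((x \<bullet> e - g x) powr (-1/2)) * indicator (\<Omega> \<inter> ball p \<rho>) x \<partial>lborel"
    have fin: "?I < \<infinity>" by (rule height_singular_integral[OF ch open_dom r(1,2)])
    have "(\<integral>\<^sup>+x. ennreal ((norm (HU x))\<^sup>2) * indicator (\<Omega> \<inter> ball p \<rho>) x \<partial>lborel)
        \<le> (\<integral>\<^sup>+x. ennreal C * (ennreal ((x \<bullet> e - g x) powr (-1/2)) * indicator (\<Omega> \<inter> ball p \<rho>) x) \<partial>lborel)"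
    proof (rule nn_integral_mono)
      fix x
      show "ennreal ((norm (HU x))\<^sup>2) * indicator (\<Omega> \<inter> ball p \<rho>) x
         \<le> ennreal C * (ennreal ((x \<bullet> e - g x) powr (-1/2)) * indicator (\<Omega> \<inter> ball p \<rho>) x)"
        using b[of x] r by (cases "x \<in> \<Omega> \<inter> ball p \<rho>") (auto simp: ennreal_leI simp flip: ennreal_mult')
    qed
    also have "\<dots> \<le> ennreal C * ?I"
    proof -
      have "continuous_on (\<Omega> \<inter> ball p \<rho>) (\<lambda>x. (x \<bullet> e - g x) powr (-1/2))"
      proof (intro continuous_intros continuous_on_subset[OF chart_cont[OF ch]])
        show "\<Omega> \<inter> ball p \<rho> \<subseteq> ball p r" using r by auto
        then show "\<forall>x\<in>\<Omega> \<inter> ball p \<rho>. x \<bullet> e - g x \<noteq> 0"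
          using chart_frontier(1)[OF ch open_dom] by force
      qed
      then have "(\<lambda>x. ennreal ((x \<bullet> e - g x) powr (-1/2)) * indicator (\<Omega> \<inter> ball p \<rho>) x) \<in> borel_measurable borel"
        using open_dom by (intro borel_measurable_ennreal_indicator) auto
      then show ?thesis by (simp add: nn_integral_cmult)
    qed
    also have "\<dots> = ennreal (C * enn2real ?I)"
      using fin r by (simp add: ennreal_mult ennreal_enn2real)
    finally show "\<exists>\<rho>>0. \<exists>C. \<forall>i\<in>{()}. (\<integral>\<^sup>+x. ennreal ((norm (HU x))\<^sup>2) * indicator (\<Omega> \<inter> ball p \<rho>) x \<partial>lborel) \<le> ennreal C * 1"
      using r by (intro exI[of _ \<rho>] conjI exI[of _ "C * enn2real ?I"]) auto
  next
    fix Q assume Q: "compact Q" "Q \<subseteq> \<Omega>"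
    have "compact ((\<lambda>x. (norm (HU x))\<^sup>2) ` Q)"
      by (rule compact_continuous_image[OF continuous_on_subset[OF cH Q(2)] Q(1)])
    then obtain B where B: "\<And>x. x \<in> Q \<Longrightarrow> (norm (HU x))\<^sup>2 \<le> B" and B0: "B > 0"
      using compact_imp_bounded bounded_pos by (metis (no_types, lifting) abs_le_D1 image_eqI real_norm_def)
    have "(\<integral>\<^sup>+x. ennreal ((norm (HU x))\<^sup>2) * indicator Q x \<partial>lborel) \<le> ennreal B * emeasure lborel Q"
      by (rule emeasure_compact_bound[OF Q(1)]) (use B in \<open>auto intro: ennreal_leI\<close>)
    also have "\<dots> = ennreal (B * measure lborel Q)"
      using emeasure_compact_finite[OF Q(1)] B0 by (simp add: emeasure_eq_ennreal_measure ennreal_mult)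
    finally show "\<exists>C. \<forall>i\<in>{()}. (\<integral>\<^sup>+x. ennreal ((norm (HU x))\<^sup>2) * indicator Q x \<partial>lborel) \<le> ennreal C * 1"
      by auto
  qed
  then obtain C where "(\<integral>\<^sup>+x. ennreal ((norm (HU x))\<^sup>2) * indicator \<Omega> x \<partial>lborel) \<le> ennreal C" by auto
  then have "(\<integral>\<^sup>+x. ennreal (indicator \<Omega> x *\<^sub>R (norm (HU x))\<^sup>2) \<partial>lborel) < \<infinity>"
    unfolding eq by (rule order_le_less_trans) simp
  then show ?thesis unfolding set_integrable_def
    using m0 by (intro integrableI_nonneg) auto
qed

end

section \<open>A Poincare inequality for harmonic functions\<close>

lemma set_integrable_dominated:
  fixes f :: "'a::euclidean_space \<Rightarrow> real"
  assumes "open S" "continuous_on S f" "set_integrable lborel S g" "\<And>x. x \<in> S \<Longrightarrow> \<bar>f x\<bar> \<le> g x"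
  shows "set_integrable lborel S f"
  unfolding set_integrable_def
proof (rule Bochner_Integration.integrable_bound)
  show "integrable lborel (\<lambda>x. indicator S x *\<^sub>R g x)" using assms(3) by (simp add: set_integrable_def)
  show "(\<lambda>x. indicator S x *\<^sub>R f x) \<in> borel_measurable lborel"
    using borel_measurable_continuous_on_indicator[OF _ assms(2)] assms(1) by simp
  show "AE x in lborel. norm (indicator S x *\<^sub>R f x) \<le> norm (indicator S x *\<^sub>R g x)"
    using assms(4) by (intro AE_I2) (force simp: indicator_def)
qed

lemma norm_sq_components: "(norm (x::real^'n))\<^sup>2 = (\<Sum>i\<in>UNIV. (x \<bullet> axis i 1)\<^sup>2)"
  unfolding power2_norm_eq_inner by (subst inner_vec_def) (simp add: inner_axis power2_eq_square)

text \<open>Cauchy-Schwarz, obtained by integrating the square of \<open>f'\<close> minus its mean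
  slope.\<close>

lemma interval_derivative_sq:
  fixes f f' :: "real \<Rightarrow> real"
  assumes t: "t > 0" and d: "\<And>s. s \<in> {0..t} \<Longrightarrow> (f has_vector_derivative f' s) (at s within {0..t})"
    and c: "continuous_on {0..t} f'"
  shows "(f t - f 0)\<^sup>2 \<le> t * integral {0..t} (\<lambda>s. (f' s)\<^sup>2)"
proof -
  have i: "(f' has_integral (f t - f 0)) {0..t}"
    using t d by (intro fundamental_theorem_of_calculus) auto
  define q where "q = (f t - f 0) / t"
  have i2: "(\<lambda>s. (f' s)\<^sup>2) integrable_on {0..t}"
    by (intro integrable_continuous_interval continuous_intros c)
  have "((\<lambda>s. (f' s)\<^sup>2 - (2 * q) * f' s + q\<^sup>2) has_integral
      (integral {0..t} (\<lambda>s. (f' s)\<^sup>2) - (2 * q) * (f t - f 0) + t * q\<^sup>2)) {0..t}"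
    using has_integral_const_real[of "q\<^sup>2" 0 t] t
    by (intro has_integral_add has_integral_diff integrable_integral i2 has_integral_mult_right i) simp
  moreover have "(\<lambda>s. (f' s)\<^sup>2 - (2 * q) * f' s + q\<^sup>2) = (\<lambda>s. (f' s - q)\<^sup>2)"
    by (simp add: fun_eq_iff power2_eq_square algebra_simps)
  ultimately have "0 \<le> integral {0..t} (\<lambda>s. (f' s)\<^sup>2) - (2 * q) * (f t - f 0) + t * q\<^sup>2"
    by (metis (no_types, lifting) has_integral_nonneg zero_le_power2)
  also have "\<dots> = integral {0..t} (\<lambda>s. (f' s)\<^sup>2) - (f t - f 0)\<^sup>2 / t"
    using t by (simp add: q_def power2_eq_square field_simps)
  finally show ?thesis using t by (simp add: field_simps)
qed

context torsion
begin

text \<open>Competitors for \<open>mu0\<close> before normalisation, with gradient and Hessian as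
  witnesses, so that derivatives of \<open>h\<close> fit in directly.\<close>

definition admissible where
  "admissible z v V H \<longleftrightarrow> harmonic v V H \<Omega> \<and> v z = 0 \<and>
     set_integrable lborel \<Omega> (\<lambda>x. (v x)\<^sup>2) \<and> set_integrable lborel \<Omega> (\<lambda>x. (norm (V x))\<^sup>2)"

definition energy where "energy V = (LINT x:\<Omega>|lborel. (norm (V x :: real^'n))\<^sup>2)"

lemma energy_nonneg: "energy V \<ge> 0"
  unfolding energy_def set_lebesgue_integral_def by (intro Bochner_Integration.integral_nonneg) (auto simp: indicator_def)

text \<open>Each component of the gradient is harmonic, so the mean square bound applies to it; the
  components are summed.\<close>

lemma gradient_energy:
  assumes har: "harmonic v V H \<Omega>" and int: "set_integrable lborel \<Omega> (\<lambda>x. (norm (V x))\<^sup>2)"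
    and sub: "cball y r \<subseteq> \<Omega>" and r: "r > 0"
  shows "bump_mass TYPE('n) * r ^ CARD('n) * (norm (V y))\<^sup>2 \<le> energy V"
proof -
  have cV: "continuous_on \<Omega> V" using har has_C2_continuous_grad by (auto simp: harmonic_def)
  have I: "set_integrable lborel \<Omega> (\<lambda>x. (V x \<bullet> axis i 1)\<^sup>2)" for i
  proof (rule set_integrable_dominated[OF open_dom _ int])
    show "continuous_on \<Omega> (\<lambda>x. (V x \<bullet> axis i 1)\<^sup>2)" by (intro continuous_intros cV)
    fix x
    have "(V x \<bullet> axis i 1)\<^sup>2 \<le> (\<Sum>i\<in>UNIV. (V x \<bullet> axis i 1)\<^sup>2)"
      by (rule member_le_sum) auto
    then show "\<bar>(V x \<bullet> axis i 1)\<^sup>2\<bar> \<le> (norm (V x))\<^sup>2" by (simp only: norm_sq_components abs_power2)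
  qed
  have "bump_mass TYPE('n) * r ^ CARD('n) * (V y \<bullet> axis i 1)\<^sup>2 \<le> (LINT x:\<Omega>|lborel. (V x \<bullet> axis i 1)\<^sup>2)" for i
  proof -
    obtain K where "harmonic (\<lambda>x. V x \<bullet> axis i 1) (\<lambda>x. H x *v axis i 1) K \<Omega>"
      using harmonic_partial[OF har] by blast
    from harmonic_mean_square[OF this sub r I] show ?thesis .
  qed
  then have "(\<Sum>i\<in>UNIV. bump_mass TYPE('n) * r ^ CARD('n) * (V y \<bullet> axis i 1)\<^sup>2) \<le> (\<Sum>i\<in>UNIV. LINT x:\<Omega>|lborel. (V x \<bullet> axis i 1)\<^sup>2)"
    by (rule sum_mono)
  also have "\<dots> = (LINT x|lborel. (\<Sum>i\<in>UNIV. indicator \<Omega> x *\<^sub>R (V x \<bullet> axis i 1)\<^sup>2))"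
    using I unfolding set_lebesgue_integral_def set_integrable_def
    by (subst Bochner_Integration.integral_sum) auto
  also have "\<dots> = energy V"
    unfolding energy_def set_lebesgue_integral_def norm_sq_components by (simp add: sum_distrib_left)
  finally show ?thesis unfolding norm_sq_components by (simp only: sum_distrib_left)
qed

text \<open>The gradient is bounded by the square root of the energy, uniformly on a smaller ball.
  Radius and constant depend on the point alone, not on the function.\<close>

lemma admissible_local_oscillation:
  assumes "x \<in> \<Omega>"
  shows "\<exists>\<rho>>0. ball x \<rho> \<subseteq> \<Omega> \<and> (\<exists>C\<ge>0. \<forall>z v V H. admissible z v V H \<longrightarrow>
     (\<forall>y\<in>ball x \<rho>. \<forall>y'\<in>ball x \<rho>. (v y - v y')\<^sup>2 \<le> C * energy V))"
proof -
  obtain r where r: "r > 0" "cball x r \<subseteq> \<Omega>" using assms open_dom open_contains_cball by blast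
  define m where "m = bump_mass TYPE('n) * (r / 2) ^ CARD('n)"
  have m: "m > 0" using r bump_mass_pos[where 'n='n] by (simp add: m_def)
  define \<rho> where "\<rho> = r / 2"
  have sub: "cball y (r / 2) \<subseteq> \<Omega>" if "y \<in> ball x \<rho>" for y
  proof
    fix w assume "w \<in> cball y (r / 2)"
    then have "w \<in> cball x r" using that dist_triangle[of x w y] by (simp add: \<rho>_def)
    then show "w \<in> \<Omega>" using r by blast
  qed
  have "(v y - v y')\<^sup>2 \<le> r\<^sup>2 / m * energy V"
    if adm: "admissible z v V H" and y: "y \<in> ball x \<rho>" "y' \<in> ball x \<rho>" for z v V H y y'
  proof -
    have har: "harmonic v V H \<Omega>" and int: "set_integrable lborel \<Omega> (\<lambda>x. (norm (V x))\<^sup>2)"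
      using adm by (auto simp: admissible_def)
    define S where "S = sqrt (energy V / m)"
    have S: "S \<ge> 0" using energy_nonneg m by (simp add: S_def)
    have Vb: "norm (V w) \<le> S" if "w \<in> ball x \<rho>" for w
    proof -
      have "m * (norm (V w))\<^sup>2 \<le> energy V"
        unfolding m_def using gradient_energy[OF har int sub[OF that]] r by simp
      then have "(norm (V w))\<^sup>2 \<le> energy V / m" using m by (simp add: field_simps)
      then show ?thesis unfolding S_def by (rule real_le_rsqrt)
    qed
    have "\<bar>v y - v y'\<bar> \<le> S * dist y y'"
    proof (rule gradient_bound_on_ball[OF _ Vb y])
      fix w assume "w \<in> ball x \<rho>"
      then have "w \<in> \<Omega>" using sub[of w] r by auto
      then show "(v has_derivative (\<bullet>) (V w)) (at w)" using har by (simp add: harmonic_def has_C2_def)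
    qed
    also have "\<dots> \<le> S * r"
    proof -
      have "dist y y' \<le> dist x y + dist x y'" by (metis dist_commute dist_triangle)
      then have "dist y y' \<le> r" using y by (simp add: \<rho>_def)
      then show ?thesis using S by (intro mult_left_mono)
    qed
    finally have "(v y - v y')\<^sup>2 \<le> (S * r)\<^sup>2" by (metis abs_ge_zero power2_abs power_mono)
    also have "\<dots> = r\<^sup>2 / m * energy V"
      using energy_nonneg[of V] m by (simp add: S_def power_mult_distrib)
    finally show ?thesis .
  qed
  moreover have "r\<^sup>2 / m \<ge> 0" "\<rho> > 0" using m r by (auto simp: \<rho>_def)
  moreover have "ball x \<rho> \<subseteq> \<Omega>" using r by (auto simp: \<rho>_def subset_iff)
  ultimately show ?thesis by blast
qed

text \<open>At \<open>z\<close> the function vanishes; bounded oscillation carries control by the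
  energy from any point of a small ball to all others, and connectedness spreads it over the
  domain.\<close>

lemma admissible_pointwise:
  assumes z: "z \<in> \<Omega>" and x: "x \<in> \<Omega>"
  shows "\<exists>C\<ge>0. \<forall>v V H. admissible z v V H \<longrightarrow> (v x)\<^sup>2 \<le> C * energy V"
proof (rule connected_induction_simple[OF connected_dom z x,
      where P = "\<lambda>x. \<exists>C\<ge>0. \<forall>v V H. admissible z v V H \<longrightarrow> (v x)\<^sup>2 \<le> C * energy V"])
  show "\<exists>C\<ge>0. \<forall>v V H. admissible z v V H \<longrightarrow> (v z)\<^sup>2 \<le> C * energy V"
    by (intro exI[of _ 0]) (auto simp: admissible_def)
  fix a assume a: "a \<in> \<Omega>"
  obtain \<rho> C where rho: "\<rho> > 0" "ball a \<rho> \<subseteq> \<Omega>" "C \<ge> 0"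
    and osc: "\<And>v V H y y'. admissible z v V H \<Longrightarrow> y \<in> ball a \<rho> \<Longrightarrow> y' \<in> ball a \<rho> \<Longrightarrow> (v y - v y')\<^sup>2 \<le> C * energy V"
    using admissible_local_oscillation[OF a] by meson
  show "\<exists>T. openin (top_of_set \<Omega>) T \<and> a \<in> T \<and> (\<forall>x\<in>T. \<forall>y\<in>T.
      (\<exists>C\<ge>0. \<forall>v V H. admissible z v V H \<longrightarrow> (v x)\<^sup>2 \<le> C * energy V) \<longrightarrow>
      (\<exists>C\<ge>0. \<forall>v V H. admissible z v V H \<longrightarrow> (v y)\<^sup>2 \<le> C * energy V))"
  proof (intro exI[of _ "ball a \<rho>"] conjI ballI impI)
    show "openin (top_of_set \<Omega>) (ball a \<rho>)" using rho by (simp add: open_subset)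
    show "a \<in> ball a \<rho>" using rho by simp
    fix x y assume xy: "x \<in> ball a \<rho>" "y \<in> ball a \<rho>"
      and "\<exists>C\<ge>0. \<forall>v V H. admissible z v V H \<longrightarrow> (v x)\<^sup>2 \<le> C * energy V"
    then obtain C' where C': "C' \<ge> 0" "\<And>v V H. admissible z v V H \<Longrightarrow> (v x)\<^sup>2 \<le> C' * energy V" by blast
    have "(v y)\<^sup>2 \<le> (2 * C' + 2 * C) * energy V" if adm: "admissible z v V H" for v V H
    proof -
      have "(v y)\<^sup>2 \<le> 2 * (v x)\<^sup>2 + 2 * (v y - v x)\<^sup>2"
        using zero_le_power2[of "2 * v x - v y"] by (simp add: power2_eq_square algebra_simps)
      also have "\<dots> \<le> 2 * (C' * energy V) + 2 * (C * energy V)"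
        using C'(2)[OF adm] osc[OF adm xy(2,1)] by simp
      finally show ?thesis by (simp add: algebra_simps)
    qed
    then show "\<exists>C\<ge>0. \<forall>v V H. admissible z v V H \<longrightarrow> (v y)\<^sup>2 \<le> C * energy V"
      using C' rho by (intro exI[of _ "2 * C' + 2 * C"]) auto
  qed
qed

text \<open>Finitely many of the oscillation balls cover \<open>Q\<close>. The constant is common to
  all competitors, as the infimum requires.\<close>

lemma admissible_compact:
  assumes z: "z \<in> \<Omega>" and Q: "compact Q" "Q \<subseteq> \<Omega>"
  shows "\<exists>C\<ge>0. \<forall>v V H. admissible z v V H \<longrightarrow> (\<forall>x\<in>Q. (v x)\<^sup>2 \<le> C * energy V)"
proof -
  have "\<exists>\<rho>>0. \<exists>C\<ge>0. \<forall>v V H. admissible z v V H \<longrightarrow> (\<forall>y\<in>ball x \<rho>. (v y)\<^sup>2 \<le> C * energy V)" if x: "x \<in> \<Omega>" for x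
  proof -
    obtain \<rho> C where rho: "\<rho> > 0" "C \<ge> 0"
      and osc: "\<And>v V H y y'. admissible z v V H \<Longrightarrow> y \<in> ball x \<rho> \<Longrightarrow> y' \<in> ball x \<rho> \<Longrightarrow> (v y - v y')\<^sup>2 \<le> C * energy V"
      using admissible_local_oscillation[OF x] by meson
    obtain C' where C': "C' \<ge> 0" "\<And>v V H. admissible z v V H \<Longrightarrow> (v x)\<^sup>2 \<le> C' * energy V"
      using admissible_pointwise[OF z x] by blast
    have "(v y)\<^sup>2 \<le> (2 * C' + 2 * C) * energy V" if adm: "admissible z v V H" and y: "y \<in> ball x \<rho>" for v V H y
    proof -
      have "(v y)\<^sup>2 \<le> 2 * (v x)\<^sup>2 + 2 * (v y - v x)\<^sup>2"
        using zero_le_power2[of "2 * v x - v y"] by (simp add: power2_eq_square algebra_simps)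
      also have "\<dots> \<le> 2 * (C' * energy V) + 2 * (C * energy V)"
        using C'(2)[OF adm] osc[OF adm y, of x] rho(1) by (intro add_mono mult_left_mono) simp_all
      finally show ?thesis by (simp add: algebra_simps)
    qed
    then show ?thesis using C' rho by (intro exI[of _ \<rho>] conjI exI[of _ "2 * C' + 2 * C"]) auto
  qed
  then obtain \<rho> C where rC: "\<And>x. x \<in> \<Omega> \<Longrightarrow> \<rho> x > 0 \<and> C x \<ge> 0 \<and>
      (\<forall>v V H. admissible z v V H \<longrightarrow> (\<forall>y\<in>ball x (\<rho> x). (v y)\<^sup>2 \<le> C x * energy V))"
    by metis
  have "Q \<subseteq> (\<Union>p\<in>Q. ball p (\<rho> p))" using rC Q(2) by force
  then obtain D where D: "D \<subseteq> Q" "finite D" "Q \<subseteq> (\<Union>p\<in>D. ball p (\<rho> p))"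
    using compactE_image[OF Q(1), of Q "\<lambda>p. ball p (\<rho> p)"] by auto
  have pos: "C p \<ge> 0" if "p \<in> D" for p using rC D(1) Q(2) that by blast
  have "(v x)\<^sup>2 \<le> (\<Sum>p\<in>D. C p) * energy V" if adm: "admissible z v V H" and x: "x \<in> Q" for v V H x
  proof -
    obtain p where p: "p \<in> D" "x \<in> ball p (\<rho> p)" using D(3) x by blast
    then have "(v x)\<^sup>2 \<le> C p * energy V" using rC D(1) Q(2) adm by blast
    also have "\<dots> \<le> (\<Sum>p\<in>D. C p) * energy V"
      using p(1) pos D(2) energy_nonneg by (intro mult_right_mono member_le_sum) auto
    finally show ?thesis .
  qed
  then show ?thesis using pos by (intro exI[of _ "\<Sum>p\<in>D. C p"]) (auto intro: sum_nonneg)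
qed

text \<open>Near the boundary a function is controlled by its values at the points moved by a fixed
  amount in the direction of the chart, and by its energy along the way.\<close>

lemma admissible_boundary:
  assumes z: "z \<in> \<Omega>" and p: "p \<in> frontier \<Omega>"
  shows "\<exists>\<rho>>0. \<exists>C. \<forall>v V H. admissible z v V H \<longrightarrow>
    (\<integral>\<^sup>+x. ennreal ((v x)\<^sup>2) * indicator (\<Omega> \<inter> ball p \<rho>) x \<partial>lborel) \<le> ennreal C * ennreal (energy V)"
proof -
  obtain r e g G K where ch: "chart \<Omega> p r e g G K"
    using C2alpha_boundary_chart[OF boundary p alpha_pos] by blast
  have c: "r > 0" "norm e = 1" and inv: "\<And>x t. g (x + t *\<^sub>R e) = g x"
    using ch unfolding chart_def by blast+
  define t where "t = r / 4"
  have t: "t > 0" using c by (simp add: t_def)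
  \<comment> \<open>Points near \<open>p\<close> moved by \<open>t\<close> along \<open>e\<close>
    have height at least \<open>t\<close> and land in this compact subset of the domain, where
    values are already controlled.\<close>
  define Q where "Q = cball p (r / 2) \<inter> {x. x \<bullet> e - g x \<ge> t}"
  have Qb: "cball p (r / 2) \<subseteq> ball p r" using c by auto
  have cQ: "compact Q"
  proof -
    have "continuous_on (cball p (r / 2)) (\<lambda>x. x \<bullet> e - g x)"
      by (intro continuous_intros continuous_on_subset[OF chart_cont[OF ch] Qb])
    then have "closed (cball p (r / 2) \<inter> (\<lambda>x. x \<bullet> e - g x) -` {t..})"
      by (rule continuous_closed_preimage) auto
    moreover have "cball p (r / 2) \<inter> (\<lambda>x. x \<bullet> e - g x) -` {t..} = Q" by (auto simp: Q_def)
    ultimately show ?thesis using bounded_subset[OF bounded_cball, of Q p "r / 2"]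
      by (auto simp: compact_eq_bounded_closed Q_def)
  qed
  have QO: "Q \<subseteq> \<Omega>"
  proof
    fix x assume "x \<in> Q"
    then show "x \<in> \<Omega>" using chart_frontier(1)[OF ch open_dom, of x] Qb t by (auto simp: Q_def)
  qed
  obtain C0 where C0: "C0 \<ge> 0" "\<And>v V H x. admissible z v V H \<Longrightarrow> x \<in> Q \<Longrightarrow> (v x)\<^sup>2 \<le> C0 * energy V"
    using admissible_compact[OF z cQ QO] by blast
  let ?A = "\<Omega> \<inter> ball p (r / 4)"
  define m where "m = measure lborel (ball p (r / 4))"
  have em: "emeasure lborel ?A \<le> ennreal m"
  proof -
    have "emeasure lborel ?A \<le> emeasure lborel (ball p (r / 4))" by (rule emeasure_mono) auto
    also have "\<dots> = ennreal m" unfolding m_def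
      using emeasure_lborel_ball_finite[of p "r / 4"] by (simp add: emeasure_eq_ennreal_measure)
    finally show ?thesis .
  qed
  have "(\<integral>\<^sup>+x. ennreal ((v x)\<^sup>2) * indicator ?A x \<partial>lborel) \<le> ennreal (2 * C0 * m + 2 * t * t) * ennreal (energy V)"
    if adm: "admissible z v V H" for v V H
  proof -
    have har: "harmonic v V H \<Omega>" and int: "set_integrable lborel \<Omega> (\<lambda>x. (norm (V x))\<^sup>2)"
      using adm by (auto simp: admissible_def)
    have cV: "continuous_on \<Omega> V" using har has_C2_continuous_grad by (auto simp: harmonic_def)
    have dv: "(v has_derivative (\<lambda>h. V x \<bullet> h)) (at x)" if "x \<in> \<Omega>" for x
      using har that by (auto simp: harmonic_def has_C2_def)
    define w where "w x = ennreal ((norm (V x))\<^sup>2) * indicator \<Omega> x" for x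
    have mw: "w \<in> borel_measurable borel"
      unfolding w_def using open_dom by (intro borel_measurable_ennreal_indicator continuous_intros cV) auto
    have wint: "(\<integral>\<^sup>+x. w x \<partial>lborel) = ennreal (energy V)"
    proof -
      have "(\<integral>\<^sup>+x. w x \<partial>lborel) = (\<integral>\<^sup>+x. ennreal (indicator \<Omega> x *\<^sub>R (norm (V x))\<^sup>2) \<partial>lborel)"
        by (intro nn_integral_cong) (auto simp: w_def indicator_def)
      also have "\<dots> = ennreal (energy V)"
        unfolding energy_def set_lebesgue_integral_def
        using int unfolding set_integrable_def by (intro nn_integral_eq_integral) auto
      finally show ?thesis .
    qed
    \<comment> \<open>The squared value at \<open>x\<close> is at most twice the squared value at
      the moved point plus twice the squared increment, and the increment is bounded by the energy
      on the segment. Integrated over \<open>x\<close>, the segment energies amount to at most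
      \<open>t\<close> times the total energy.\<close>
    have pt: "ennreal ((v x)\<^sup>2) * indicator ?A x \<le> ennreal (2 * (C0 * energy V)) * indicator ?A x
        + ennreal (2 * t) * (\<integral>\<^sup>+s. w (x + s *\<^sub>R e) * indicator {0..t} s \<partial>lborel)" for x
    proof (cases "x \<in> ?A")
      case True
      have seg: "x + s *\<^sub>R e \<in> \<Omega>" "x + s *\<^sub>R e \<in> cball p (r / 2)" "(x + s *\<^sub>R e) \<bullet> e - g (x + s *\<^sub>R e) = x \<bullet> e - g x + s"
        if s: "s \<in> {0..t}" for s
      proof -
        have "dist p (x + s *\<^sub>R e) \<le> dist p x + dist x (x + s *\<^sub>R e)" by (rule dist_triangle)
        also have "\<dots> \<le> r / 4 + r / 4" using True s c by (intro add_mono) (auto simp: t_def dist_norm)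
        finally show 1: "x + s *\<^sub>R e \<in> cball p (r / 2)" by simp
        show 2: "(x + s *\<^sub>R e) \<bullet> e - g (x + s *\<^sub>R e) = x \<bullet> e - g x + s"
          using c inv by (simp add: inner_add_left dot_square_norm)
        have "x \<in> ball p r" using True c by auto
        then have "x \<bullet> e - g x > 0" using chart_frontier(1)[OF ch open_dom, of x] True by simp
        then show "x + s *\<^sub>R e \<in> \<Omega>"
          using chart_frontier(1)[OF ch open_dom, of "x + s *\<^sub>R e"] 1 2 Qb s by auto
      qed
      have "x \<in> ball p r" using True c by auto
      then have xh: "x \<bullet> e - g x > 0" using chart_frontier(1)[OF ch open_dom, of x] True by simp
      have xt: "x + t *\<^sub>R e \<in> Q" using seg[of t] t xh by (simp add: Q_def)
      have cVs: "continuous_on {0..t} (\<lambda>s. V (x + s *\<^sub>R e))"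
        by (intro continuous_on_compose2[OF cV] continuous_intros) (use seg in auto)
      have "(v (x + t *\<^sub>R e) - v (x + 0 *\<^sub>R e))\<^sup>2 \<le> t * integral {0..t} (\<lambda>s. (V (x + s *\<^sub>R e) \<bullet> e)\<^sup>2)"
      proof (rule interval_derivative_sq[OF t])
        fix s assume s: "s \<in> {0..t}"
        from translate_dilate_derivative(3)[OF dv[OF seg(1)[OF s]]]
        show "((\<lambda>s. v (x + s *\<^sub>R e)) has_vector_derivative V (x + s *\<^sub>R e) \<bullet> e) (at s within {0..t})"
          unfolding has_vector_derivative_def by (auto intro: has_derivative_at_withinI)
      qed (intro continuous_intros cVs)
      also have "\<dots> \<le> t * integral {0..t} (\<lambda>s. (norm (V (x + s *\<^sub>R e)))\<^sup>2)"
      proof (intro mult_left_mono integral_le)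
        show "(\<lambda>s. (V (x + s *\<^sub>R e) \<bullet> e)\<^sup>2) integrable_on {0..t}" "(\<lambda>s. (norm (V (x + s *\<^sub>R e)))\<^sup>2) integrable_on {0..t}"
          by (intro integrable_continuous_interval continuous_intros cVs)+
        fix s
        have "\<bar>V (x + s *\<^sub>R e) \<bullet> e\<bar> \<le> norm (V (x + s *\<^sub>R e))"
          using Cauchy_Schwarz_ineq2[of "V (x + s *\<^sub>R e)" e] c by simp
        then show "(V (x + s *\<^sub>R e) \<bullet> e)\<^sup>2 \<le> (norm (V (x + s *\<^sub>R e)))\<^sup>2"
          by (metis abs_ge_zero power2_abs power_mono)
      qed (use t in auto)
      finally have D: "(v (x + t *\<^sub>R e) - v x)\<^sup>2 \<le> t * integral {0..t} (\<lambda>s. (norm (V (x + s *\<^sub>R e)))\<^sup>2)" by simp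
      define J where "J = integral {0..t} (\<lambda>s. (norm (V (x + s *\<^sub>R e)))\<^sup>2)"
      have "((\<lambda>s. (norm (V (x + s *\<^sub>R e)))\<^sup>2) has_integral J) {0..t}"
        unfolding J_def by (intro integrable_integral integrable_continuous_interval continuous_intros cVs)
      then have J: "(\<integral>\<^sup>+s. ennreal ((norm (V (x + s *\<^sub>R e)))\<^sup>2) * indicator {0..t} s \<partial>lborel) = ennreal J"
        by (intro nn_integral_has_integral_lebesgue') auto
      have Jw: "(\<integral>\<^sup>+s. w (x + s *\<^sub>R e) * indicator {0..t} s \<partial>lborel) = ennreal J"
        unfolding J[symmetric] by (intro nn_integral_cong) (use seg(1) in \<open>auto simp: w_def indicator_def\<close>)
      have J0: "J \<ge> 0" unfolding J_def
        by (intro integral_nonneg integrable_continuous_interval continuous_intros cVs) auto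
      have "(v x)\<^sup>2 \<le> 2 * (v (x + t *\<^sub>R e))\<^sup>2 + 2 * (v (x + t *\<^sub>R e) - v x)\<^sup>2"
        using zero_le_power2[of "2 * v (x + t *\<^sub>R e) - v x"] by (simp add: power2_eq_square algebra_simps)
      also have "\<dots> \<le> 2 * (C0 * energy V) + 2 * t * J"
        using C0(2)[OF adm xt] D by (simp add: J_def)
      finally have "ennreal ((v x)\<^sup>2) \<le> ennreal (2 * (C0 * energy V) + 2 * t * J)" by (rule ennreal_leI)
      also have "\<dots> = ennreal (2 * (C0 * energy V)) + ennreal (2 * t) * ennreal J"
        using C0(1) energy_nonneg[of V] t J0 by (simp add: ennreal_plus ennreal_mult')
      finally show ?thesis using True Jw by simp
    qed simp
    have "(\<integral>\<^sup>+x. ennreal ((v x)\<^sup>2) * indicator ?A x \<partial>lborel)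
      \<le> (\<integral>\<^sup>+x. ennreal (2 * (C0 * energy V)) * indicator ?A x
        + ennreal (2 * t) * (\<integral>\<^sup>+s. w (x + s *\<^sub>R e) * indicator {0..t} s \<partial>lborel) \<partial>lborel)"
      by (intro nn_integral_mono pt)
    also have "\<dots> = (\<integral>\<^sup>+x. ennreal (2 * (C0 * energy V)) * indicator ?A x \<partial>lborel)
        + ennreal (2 * t) * (\<integral>\<^sup>+x. (\<integral>\<^sup>+s. w (x + s *\<^sub>R e) * indicator {0..t} s \<partial>lborel) \<partial>lborel)"
    proof -
      have [measurable]: "?A \<in> sets borel" "w \<in> borel_measurable borel" using open_dom mw by auto
      have "(\<lambda>x. \<integral>\<^sup>+s. w (x + s *\<^sub>R e) * indicator {0..t} s \<partial>lborel) \<in> borel_measurable lborel"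
        by measurable
      then show ?thesis by (subst nn_integral_add) (auto simp: nn_integral_cmult)
    qed
    also have "\<dots> = ennreal (2 * (C0 * energy V)) * emeasure lborel ?A + ennreal (2 * t) * (ennreal t * ennreal (energy V))"
    proof -
      have "?A \<in> sets lborel" using open_dom by auto
      then show ?thesis using nn_integral_segment_average[OF mw, of t e] t wint
        by (simp add: nn_integral_cmult_indicator)
    qed
    also have "\<dots> \<le> ennreal (2 * (C0 * energy V)) * ennreal m + ennreal (2 * t) * (ennreal t * ennreal (energy V))"
      by (intro add_mono mult_left_mono em order_refl) simp
    also have "\<dots> = ennreal (2 * (C0 * energy V) * m + 2 * t * (t * energy V))"
      using C0(1) energy_nonneg[of V] t by (simp add: ennreal_plus ennreal_mult'' m_def)
    also have "2 * (C0 * energy V) * m + 2 * t * (t * energy V) = (2 * C0 * m + 2 * t * t) * energy V"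
      by (simp add: algebra_simps)
    also have "ennreal \<dots> = ennreal (2 * C0 * m + 2 * t * t) * ennreal (energy V)"
      using energy_nonneg[of V] by (simp add: ennreal_mult'')
    finally show ?thesis .
  qed
  then show ?thesis using c by (intro exI[of _ "r / 4"] conjI exI[of _ "2 * C0 * m + 2 * t * t"]) auto
qed

text \<open>The index set of \<open>covering_bound\<close> consists of all admissible triples, which
  makes the constant uniform; no compactness of a function space is invoked.\<close>

lemma harmonic_poincare:
  assumes z: "z \<in> \<Omega>"
  shows "\<exists>C\<ge>0. \<forall>v V H. admissible z v V H \<longrightarrow> (LINT x:\<Omega>|lborel. (v x)\<^sup>2) \<le> C * energy V"
proof -
  let ?I = "{(v, V, H). admissible z v V H}"
  have "\<exists>C\<ge>0. \<forall>i\<in>?I. (\<integral>\<^sup>+x. ennreal ((fst i x)\<^sup>2) * indicator \<Omega> x \<partial>lborel) \<le> ennreal C * ennreal (energy (fst (snd i)))"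
  proof (rule covering_bound)
    fix i assume "i \<in> ?I"
    then have "continuous_on \<Omega> (fst i)"
      using has_C2_continuous by (auto simp: admissible_def harmonic_def)
    then show "(\<lambda>x. ennreal ((fst i x)\<^sup>2) * indicator \<Omega> x) \<in> borel_measurable borel"
      using open_dom by (intro borel_measurable_ennreal_indicator continuous_intros) auto
  next
    fix p assume "p \<in> frontier \<Omega>"
    from admissible_boundary[OF z this]
    show "\<exists>\<rho>>0. \<exists>C. \<forall>i\<in>?I. (\<integral>\<^sup>+x. ennreal ((fst i x)\<^sup>2) * indicator (\<Omega> \<inter> ball p \<rho>) x \<partial>lborel)
        \<le> ennreal C * ennreal (energy (fst (snd i)))" by fastforce
  next
    fix Q assume Q: "compact Q" "Q \<subseteq> \<Omega>"
    obtain C where C: "C \<ge> 0" "\<And>v V H x. admissible z v V H \<Longrightarrow> x \<in> Q \<Longrightarrow> (v x)\<^sup>2 \<le> C * energy V"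
      using admissible_compact[OF z Q] by blast
    have "(\<integral>\<^sup>+x. ennreal ((v x)\<^sup>2) * indicator Q x \<partial>lborel) \<le> ennreal (C * measure lborel Q) * ennreal (energy V)"
      if adm: "admissible z v V H" for v V H
    proof -
      have "(\<integral>\<^sup>+x. ennreal ((v x)\<^sup>2) * indicator Q x \<partial>lborel) \<le> ennreal (C * energy V) * emeasure lborel Q"
        using C(2)[OF adm] by (intro emeasure_compact_bound Q ennreal_leI)
      also have "\<dots> = ennreal (C * measure lborel Q) * ennreal (energy V)"
        using emeasure_compact_finite[OF Q(1)] C(1) energy_nonneg[of V]
        by (simp add: emeasure_eq_ennreal_measure mult_ac flip: ennreal_mult)
      finally show ?thesis .
    qed
    then show "\<exists>C. \<forall>i\<in>?I. (\<integral>\<^sup>+x. ennreal ((fst i x)\<^sup>2) * indicator Q x \<partial>lborel) \<le> ennreal C * ennreal (energy (fst (snd i)))"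
      by (intro exI[of _ "C * measure lborel Q"]) auto
  qed
  then obtain C where C: "C \<ge> 0" "\<And>v V H. admissible z v V H \<Longrightarrow>
      (\<integral>\<^sup>+x. ennreal ((v x)\<^sup>2) * indicator \<Omega> x \<partial>lborel) \<le> ennreal C * ennreal (energy V)"
    by fastforce
  have "(LINT x:\<Omega>|lborel. (v x)\<^sup>2) \<le> C * energy V" if adm: "admissible z v V H" for v V H
  proof -
    have int: "integrable lborel (\<lambda>x. indicator \<Omega> x *\<^sub>R (v x)\<^sup>2)"
      using adm by (simp add: admissible_def set_integrable_def)
    have "ennreal (LINT x:\<Omega>|lborel. (v x)\<^sup>2) = (\<integral>\<^sup>+x. ennreal (indicator \<Omega> x *\<^sub>R (v x)\<^sup>2) \<partial>lborel)"
      unfolding set_lebesgue_integral_def by (rule nn_integral_eq_integral[OF int, symmetric]) auto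
    also have "\<dots> = (\<integral>\<^sup>+x. ennreal ((v x)\<^sup>2) * indicator \<Omega> x \<partial>lborel)"
      by (intro nn_integral_cong) (auto simp: indicator_def)
    also have "\<dots> \<le> ennreal C * ennreal (energy V)" by (rule C(2)[OF adm])
    also have "\<dots> = ennreal (C * energy V)" using C(1) by (simp add: ennreal_mult')
    finally show ?thesis using C(1) energy_nonneg[of V] by (simp add: ennreal_le_iff)
  qed
  then show ?thesis using C(1) by blast
qed

section \<open>Positivity and use of \<open>mu0\<close>\<close>

text \<open>Replaces \<open>grad\<close> and \<open>lap\<close> by the witnesses of
  \<open>harmonic\<close>; on the domain they agree, and the integrals see nothing else.\<close>

lemma mu0_admissible:
  assumes "z \<in> \<Omega>"
  shows "mu0 \<Omega> z = Inf {energy V | v V H. admissible z v V H \<and> (LINT x:\<Omega>|lborel. (v x)\<^sup>2) = 1}"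
proof -
  have en: "(LINT x:\<Omega>|lborel. (norm (grad v x))\<^sup>2) = energy V"
    and si: "set_integrable lborel \<Omega> (\<lambda>x. (norm (grad v x))\<^sup>2) \<longleftrightarrow> set_integrable lborel \<Omega> (\<lambda>x. (norm (V x))\<^sup>2)"
    if "has_C2 v V H \<Omega>" for v V H
  proof -
    have eq: "(\<lambda>x. indicator \<Omega> x *\<^sub>R (norm (grad v x))\<^sup>2) = (\<lambda>x. indicator \<Omega> x *\<^sub>R (norm (V x))\<^sup>2)"
      using has_C2_grad[OF that] by (auto simp: fun_eq_iff indicator_def)
    show "(LINT x:\<Omega>|lborel. (norm (grad v x))\<^sup>2) = energy V"
      unfolding energy_def set_lebesgue_integral_def eq ..
    show "set_integrable lborel \<Omega> (\<lambda>x. (norm (grad v x))\<^sup>2) \<longleftrightarrow> set_integrable lborel \<Omega> (\<lambda>x. (norm (V x))\<^sup>2)"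
      unfolding set_integrable_def eq ..
  qed
  have "{LINT x:\<Omega>|lborel. (norm (grad v x))\<^sup>2 | v.
      C2_on \<Omega> v \<and> (\<forall>x\<in>\<Omega>. lap v x = 0) \<and>
      set_integrable lborel \<Omega> (\<lambda>x. (v x)\<^sup>2) \<and>
      set_integrable lborel \<Omega> (\<lambda>x. (norm (grad v x))\<^sup>2) \<and>
      (LINT x:\<Omega>|lborel. (v x)\<^sup>2) = 1 \<and> v z = 0}
     = {energy V | v V H. admissible z v V H \<and> (LINT x:\<Omega>|lborel. (v x)\<^sup>2) = 1}" (is "?L = ?R")
  proof
    show "?L \<subseteq> ?R"
    proof
      fix E assume "E \<in> ?L"
      then obtain v where v: "E = (LINT x:\<Omega>|lborel. (norm (grad v x))\<^sup>2)" "C2_on \<Omega> v" "\<forall>x\<in>\<Omega>. lap v x = 0"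
        "set_integrable lborel \<Omega> (\<lambda>x. (v x)\<^sup>2)" "set_integrable lborel \<Omega> (\<lambda>x. (norm (grad v x))\<^sup>2)"
        "(LINT x:\<Omega>|lborel. (v x)\<^sup>2) = 1" "v z = 0" by blast
      note C2 = C2_on_has_C2[OF open_dom v(2)]
      have "admissible z v (grad v) (\<lambda>x. \<chi> i j. hess v x $ j $ i)"
        unfolding admissible_def harmonic_def using C2 v has_C2_lap[OF C2] by auto
      then show "E \<in> ?R" using en[OF C2] v by auto
    qed
    show "?R \<subseteq> ?L"
    proof
      fix E assume "E \<in> ?R"
      then obtain v V H where v: "E = energy V" "admissible z v V H" "(LINT x:\<Omega>|lborel. (v x)\<^sup>2) = 1" by blast
      have C2: "has_C2 v V H \<Omega>" using v by (simp add: admissible_def harmonic_def)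
      then show "E \<in> ?L"
        using v en[OF C2] si[OF C2] has_C2_C2_on[OF C2] has_C2_lap[OF C2]
        by (intro CollectI exI[of _ v]) (auto simp: admissible_def harmonic_def)
    qed
  qed
  then show ?thesis unfolding mu0_def by simp
qed

lemma admissible_scale:
  assumes "admissible z v V H"
  shows "admissible z (\<lambda>x. c * v x) (\<lambda>x. c *\<^sub>R V x) (\<lambda>x. c *\<^sub>R H x)"
    "energy (\<lambda>x. c *\<^sub>R V x) = c\<^sup>2 * energy V"
    "(LINT x:\<Omega>|lborel. (c * v x)\<^sup>2) = c\<^sup>2 * (LINT x:\<Omega>|lborel. (v x)\<^sup>2)"
  using assms unfolding admissible_def harmonic_def energy_def
  by (auto intro!: has_C2_cmult simp: power_mult_distrib)

text \<open>The infimum of an empty set would be arbitrary. A rescaled affine function vanishing at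
  \<open>z\<close> is a competitor.\<close>

lemma admissible_normalized_exists:
  assumes z: "z \<in> \<Omega>"
  shows "\<exists>v V H. admissible z v V H \<and> (LINT x:\<Omega>|lborel. (v x)\<^sup>2) = 1"
proof -
  obtain i :: 'n where True by simp
  let ?e = "axis i 1 :: real^'n"
  let ?v = "\<lambda>x. - (?e \<bullet> z) + ?e \<bullet> x"
  obtain B where B: "B > 0" "\<And>x. x \<in> \<Omega> \<Longrightarrow> norm x \<le> B"
    using bounded_dom unfolding bounded_pos by blast
  have har: "harmonic ?v (\<lambda>x. ?e) (\<lambda>x. 0) \<Omega>"
    unfolding harmonic_def by (intro conjI has_C2_affine open_dom) simp
  have int: "set_integrable lborel \<Omega> (\<lambda>x. (?v x)\<^sup>2)"
  proof (rule set_integrable_bounded_continuous[OF open_dom bounded_dom])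
    show "continuous_on \<Omega> (\<lambda>x. (?v x)\<^sup>2)" by (intro continuous_intros)
    fix x assume "x \<in> \<Omega>"
    then have "\<bar>?v x\<bar> \<le> B + B"
      using B(2)[OF z] B(2)[of x] component_le_norm_cart[of z i] component_le_norm_cart[of x i]
      by (simp add: inner_axis')
    then show "\<bar>(?v x)\<^sup>2\<bar> \<le> (B + B)\<^sup>2"
      by (metis abs_ge_zero abs_power2 power2_abs power_mono)
  qed
  have adm: "admissible z ?v (\<lambda>x. ?e) (\<lambda>x. 0)"
    unfolding admissible_def using har int
    by (auto intro!: set_integrable_bounded_continuous[OF open_dom bounded_dom])
  obtain r where r: "r > 0" "cball z r \<subseteq> \<Omega>" using z open_dom open_contains_cball by blast
  \<comment> \<open>Here the affine function has the value r / 2, so the mean square bound makes its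
    L^2 norm positive.\<close>
  let ?y = "z + (r / 2) *\<^sub>R ?e"
  have sub: "cball ?y (r / 2) \<subseteq> \<Omega>"
  proof
    fix x assume "x \<in> cball ?y (r / 2)"
    moreover have "dist z ?y = r / 2" using r by (simp add: dist_norm)
    ultimately have "x \<in> cball z r" using dist_triangle[of z x ?y] by simp
    then show "x \<in> \<Omega>" using r by blast
  qed
  have "0 < bump_mass TYPE('n) * (r / 2) ^ CARD('n) * (?v ?y)\<^sup>2"
    using r bump_mass_pos[where 'n='n] by (simp add: inner_add_right inner_axis')
  also have "\<dots> \<le> (LINT x:\<Omega>|lborel. (?v x)\<^sup>2)"
    using r by (intro harmonic_mean_square[OF har sub _ int]) simp
  finally have pos: "(LINT x:\<Omega>|lborel. (?v x)\<^sup>2) > 0" (is "?I > 0") .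
  have "(1 / sqrt ?I)\<^sup>2 * ?I = 1" using pos by (simp add: power_divide)
  then have "(LINT x:\<Omega>|lborel. (1 / sqrt ?I * ?v x)\<^sup>2) = 1"
    by (simp only: admissible_scale(3)[OF adm])
  with admissible_scale(1)[OF adm, of "1 / sqrt ?I"] show ?thesis by (intro exI conjI)
qed

text \<open>The Poincare inequality bounds every normalised energy from below; \<open>C + 1\<close>
  avoids division by zero.\<close>

lemma mu0_pos:
  assumes z: "z \<in> \<Omega>"
  shows "mu0 \<Omega> z > 0"
proof -
  obtain C where C: "C \<ge> 0" "\<And>v V H. admissible z v V H \<Longrightarrow> (LINT x:\<Omega>|lborel. (v x)\<^sup>2) \<le> C * energy V"
    using harmonic_poincare[OF z] by blast
  have "1 / (C + 1) \<le> mu0 \<Omega> z"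
    unfolding mu0_admissible[OF z]
  proof (rule cInf_greatest)
    show "{energy V | v V H. admissible z v V H \<and> (LINT x:\<Omega>|lborel. (v x)\<^sup>2) = 1} \<noteq> {}"
      using admissible_normalized_exists[OF z] by blast
    fix E assume "E \<in> {energy V | v V H. admissible z v V H \<and> (LINT x:\<Omega>|lborel. (v x)\<^sup>2) = 1}"
    then obtain v V H where E: "E = energy V" "admissible z v V H" "(LINT x:\<Omega>|lborel. (v x)\<^sup>2) = 1" by blast
    then have "1 \<le> C * E" using C(2)[OF E(2)] by simp
    also have "\<dots> \<le> (C + 1) * E" using energy_nonneg E by (intro mult_right_mono) auto
    finally show "1 / (C + 1) \<le> E" using C(1) by (simp add: field_simps)
  qed
  moreover have "1 / (C + 1) > 0" using C(1) by simp
  ultimately show ?thesis by linarith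
qed

text \<open>Both sides are homogeneous of degree 2, so a function of nonzero norm may be normalised;
  for zero norm the left side is 0.\<close>

lemma mu0_inequality:
  assumes z: "z \<in> \<Omega>" and adm: "admissible z v V H"
  shows "mu0 \<Omega> z * (LINT x:\<Omega>|lborel. (v x)\<^sup>2) \<le> energy V"
proof -
  let ?I = "LINT x:\<Omega>|lborel. (v x)\<^sup>2"
  have I0: "?I \<ge> 0"
    unfolding set_lebesgue_integral_def by (intro Bochner_Integration.integral_nonneg) (auto simp: indicator_def)
  show ?thesis
  proof (cases "?I = 0")
    case True
    then show ?thesis using energy_nonneg by simp
  next
    case False
    then have pos: "?I > 0" using I0 by simp
    have one: "(1 / sqrt ?I)\<^sup>2 * ?I = 1" using pos by (simp add: power_divide)
    note sc = admissible_scale[OF adm, of "1 / sqrt ?I"]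
    have "mu0 \<Omega> z \<le> (1 / sqrt ?I)\<^sup>2 * energy V"
      unfolding mu0_admissible[OF z]
    proof (rule cInf_lower)
      show "(1 / sqrt ?I)\<^sup>2 * energy V \<in> {energy V | v V H. admissible z v V H \<and> (LINT x:\<Omega>|lborel. (v x)\<^sup>2) = 1}"
        using sc one by (intro CollectI exI[of _ "\<lambda>x. 1 / sqrt ?I * v x"] exI[of _ "\<lambda>x. (1 / sqrt ?I) *\<^sub>R V x"]
            exI[of _ "\<lambda>x. (1 / sqrt ?I) *\<^sub>R H x"]) auto
      show "bdd_below {energy V | v V H. admissible z v V H \<and> (LINT x:\<Omega>|lborel. (v x)\<^sup>2) = 1}"
        using energy_nonneg by (intro bdd_belowI[of _ 0]) auto
    qed
    then have "mu0 \<Omega> z \<le> energy V / ?I" using pos by (simp add: power_divide)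
    then show ?thesis using pos by (simp add: field_simps)
  qed
qed

end

section \<open>Stability estimates\<close>

text \<open>Constant of the pointwise bound from the mean square at half the admissible radius,
  whence the power of 2.\<close>

definition mean_const :: "'n::finite itself \<Rightarrow> real" where
  "mean_const _ = sqrt (2 ^ CARD('n) / bump_mass TYPE('n))"

lemma mean_const_pos: "mean_const TYPE('n::finite) > 0"
  by (simp add: mean_const_def bump_mass_pos)

lemma sum_norm_columns: "(\<Sum>i\<in>UNIV. (norm ((A::real^'n^'n) *v axis i 1))\<^sup>2) = (norm A)\<^sup>2"
proof -
  have "(norm (A *v axis i 1))\<^sup>2 = (\<Sum>j\<in>UNIV. (A $ j $ i)\<^sup>2)" for i
    unfolding norm_sq_components by (simp add: inner_axis matrix_vector_mult_basis column_def)
  then have "(\<Sum>i\<in>UNIV. (norm (A *v axis i 1))\<^sup>2) = (\<Sum>i\<in>UNIV. \<Sum>j\<in>UNIV. (A $ j $ i)\<^sup>2)" by simp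
  also have "\<dots> = (norm A)\<^sup>2" unfolding norm_matrix_sq by (rule sum.swap)
  finally show ?thesis .
qed

context torsion
begin

text \<open>On the boundary \<open>u\<close> is 0, while it is negative at nearby interior points,
  so no boundary point can be a local minimum.\<close>

lemma local_minimum_interior:
  assumes z: "z \<in> closure \<Omega>" and e: "e > 0" and m: "\<forall>x\<in>closure \<Omega> \<inter> ball z e. u z \<le> u x"
  shows "z \<in> \<Omega>" "U z = 0"
proof -
  show zO: "z \<in> \<Omega>"
  proof (rule ccontr)
    assume "z \<notin> \<Omega>"
    then have "u z = 0" using closure_dom_cases[OF z] boundary_u by blast
    obtain x where x: "x \<in> \<Omega>" "dist x z < e" using z e unfolding closure_approachable by blast
    then have "x \<in> closure \<Omega> \<inter> ball z e" using closure_subset by (auto simp: dist_commute)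
    then have "u z \<le> u x" using m by blast
    then show False using u_neg[OF x(1)] \<open>u z = 0\<close> by simp
  qed
  have d: "(u has_derivative (\<lambda>v. U z \<bullet> v)) (at z)" using has_C2_u zO by (simp add: has_C2_def)
  have "(\<lambda>v. U z \<bullet> v) = (\<lambda>v. 0)"
  proof (rule differential_zero_maxmin[OF _ _ d])
    show "z \<in> \<Omega> \<inter> ball z e" using zO e by simp
    show "open (\<Omega> \<inter> ball z e)" using open_dom by auto
    show "(\<forall>y\<in>\<Omega> \<inter> ball z e. u y \<le> u z) \<or> (\<forall>y\<in>\<Omega> \<inter> ball z e. u z \<le> u y)"
      using m closure_subset by blast
  qed
  from fun_cong[OF this, of "U z"] show "U z = 0" by simp
qed

lemma gradient_le_Sup:
  assumes "x \<in> \<Omega>"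
  shows "norm (U x) \<le> Sup ((\<lambda>x. norm (grad u x)) ` \<Omega>)"
proof -
  obtain M where "\<forall>x\<in>\<Omega>. norm (U x) \<le> M" using gradient_bounded by blast
  then have "bdd_above ((\<lambda>x. norm (grad u x)) ` \<Omega>)" unfolding U_def by (auto intro: bdd_aboveI)
  then show ?thesis using assms unfolding U_def by (intro cSup_upper) auto
qed

text \<open>The gradient bound inside the ball passes to its closure by continuity, and
  \<open>u\<close> vanishes at the boundary point \<open>x\<close>.\<close>

lemma growth_in_ball:
  assumes M: "\<And>x. x \<in> \<Omega> \<Longrightarrow> norm (U x) \<le> M" and b: "ball c r \<subseteq> \<Omega>" "r > 0"
    and y: "y \<in> ball c r" and x: "x \<in> frontier \<Omega>" "dist c x \<le> r"
  shows "- u y \<le> M * dist y x"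
proof -
  have cl: "closure (ball c r) = cball c r" using b by simp
  have sub: "cball c r \<subseteq> closure \<Omega>" using closure_mono[OF b(1)] cl by simp
  have A: "u w - u y - M * dist y w \<le> 0" if w: "w \<in> ball c r" for w
  proof -
    have "\<bar>u w - u y\<bar> \<le> M * dist w y"
    proof (rule gradient_bound_on_ball[OF _ _ w y])
      fix x assume "x \<in> ball c r"
      then have x: "x \<in> \<Omega>" using b by blast
      show "(u has_derivative (\<bullet>) (U x)) (at x)" using has_C2_u x by (simp add: has_C2_def)
      show "norm (U x) \<le> M" by (rule M[OF x])
    qed
    then show ?thesis by (simp add: dist_commute abs_le_iff)
  qed
  have B: "continuous_on (closure (ball c r)) (\<lambda>w. u w - u y - M * dist y w)"
    unfolding cl by (intro continuous_intros continuous_on_subset[OF continuous_u sub])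
  have C: "x \<in> closure (ball c r)" unfolding cl using x(2) by simp
  have "u x - u y - M * dist y x \<le> 0"
    by (rule continuous_le_on_closure[OF B C A])
  then show ?thesis using boundary_u[OF x(1)] by simp
qed

section \<open>Extremal boundary points and volume\<close>

text \<open>Were a point of the domain farther from \<open>z\<close> than every frontier point, the
  ray through it away from \<open>z\<close> would leave the bounded domain at a frontier point
  farther still.\<close>

lemma farthest_frontier_point:
  assumes z: "z \<in> \<Omega>"
  obtains xe where "xe \<in> frontier \<Omega>" "Sup ((\<lambda>x. dist x z) ` frontier \<Omega>) = dist xe z" "\<Omega> \<subseteq> cball z (dist xe z)"
proof -
  have c: "continuous_on (frontier \<Omega>) (\<lambda>x. dist x z)" by (intro continuous_intros)
  obtain xe where xe: "xe \<in> frontier \<Omega>" "\<And>y. y \<in> frontier \<Omega> \<Longrightarrow> dist y z \<le> dist xe z"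
    using continuous_attains_sup[OF compact_frontier_dom frontier_nonempty c] by blast
  have "Sup ((\<lambda>x. dist x z) ` frontier \<Omega>) = dist xe z"
    using xe by (intro cSup_eq_maximum) auto
  moreover have "\<Omega> \<subseteq> cball z (dist xe z)"
  proof (rule ccontr)
    assume "\<not> \<Omega> \<subseteq> cball z (dist xe z)"
    then obtain x where "x \<in> \<Omega>" "x \<notin> cball z (dist xe z)" by blast
    then have x: "x \<in> \<Omega>" "dist x z > dist xe z" by (simp_all add: dist_commute)
    obtain B0 where B0: "B0 > 0" "\<And>x. x \<in> \<Omega> \<Longrightarrow> norm x \<le> B0"
      using bounded_dom unfolding bounded_pos by blast
    define B where "B = B0 + norm z"
    have B: "B > 0" using B0(1) by (simp add: B_def add_pos_nonneg)
    have Bz: "norm (x - z) \<le> B" if "x \<in> \<Omega>" for x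
      unfolding B_def using B0(2)[OF that] norm_triangle_ineq4[of x z] by linarith
    have nx: "norm (x - z) > 0" using x by (metis dist_norm le_less_trans zero_le_dist)
    \<comment> \<open>After this time the ray is farther than \<open>B\<close> from
      \<open>z\<close>, hence outside the domain.\<close>
    define T where "T = B / norm (x - z)"
    have T: "T > 0" using B nx by (simp add: T_def)
    define R where "R = (\<lambda>t. x + t *\<^sub>R (x - z)) ` {0..T}"
    have nR: "dist (x + t *\<^sub>R (x - z)) z = (1 + t) * norm (x - z)" if "t \<ge> 0" for t
    proof -
      have "x + t *\<^sub>R (x - z) - z = (1 + t) *\<^sub>R (x - z)" by (simp add: algebra_simps)
      then show ?thesis using that by (simp add: dist_norm)
    qed
    have "connected R" unfolding R_def
      by (intro connected_continuous_image continuous_intros) auto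
    moreover have "R \<inter> \<Omega> \<noteq> {}" using x(1) T by (force simp: R_def)
    moreover have "R - \<Omega> \<noteq> {}"
    proof -
      let ?y = "x + T *\<^sub>R (x - z)"
      have "norm (?y - z) = norm (x - z) + B" using nR[of T] T nx by (simp add: dist_norm T_def algebra_simps)
      then have "?y \<notin> \<Omega>" using Bz[of ?y] nx by auto
      moreover have "?y \<in> R" using T by (auto simp: R_def)
      ultimately show ?thesis by blast
    qed
    ultimately have "R \<inter> frontier \<Omega> \<noteq> {}" by (intro connected_Int_frontier)
    then obtain t where t: "t \<ge> 0" "x + t *\<^sub>R (x - z) \<in> frontier \<Omega>" by (auto simp: R_def)
    have "dist (x + t *\<^sub>R (x - z)) z \<ge> 1 * norm (x - z)"
      unfolding nR[OF t(1)] using t(1) by (intro mult_right_mono) auto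
    then show False using xe(2)[OF t(2)] x(2) by (simp add: dist_norm)
  qed
  ultimately show ?thesis using that xe by blast
qed

lemma nearest_frontier_point:
  assumes z: "z \<in> \<Omega>"
  obtains xi where "xi \<in> frontier \<Omega>" "Inf ((\<lambda>x. dist x z) ` frontier \<Omega>) = dist xi z" "ball z (dist xi z) \<subseteq> \<Omega>" "dist xi z > 0"
proof -
  obtain xi where xi: "xi \<in> frontier \<Omega>" "bdist z = dist z xi" using bdist_attained by blast
  have "Inf ((\<lambda>x. dist x z) ` frontier \<Omega>) = dist xi z"
    using infdist_notempty[OF frontier_nonempty, of z] xi by (simp add: dist_commute)
  moreover have "ball z (dist xi z) \<subseteq> \<Omega>" using ball_bdist[OF z, of "dist xi z"] xi by (simp add: dist_commute)
  moreover have "dist xi z > 0" using bdist_pos[OF z] xi by (simp add: dist_commute)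
  ultimately show ?thesis using that xi(1) by blast
qed

text \<open>The domain fits into a ball of radius \<rho>. Read as an upper bound for 1 / \<rho>,
  this is how the volume enters the stability constants.\<close>

lemma volume_le_radius:
  assumes sub: "\<Omega> \<subseteq> cball z \<rho>" and r: "\<rho> > 0"
  shows "measure lborel \<Omega> powr (1 / real CARD('n)) \<le> unit_ball_vol (real CARD('n)) powr (1 / real CARD('n)) * \<rho>"
    "measure lborel \<Omega> > 0"
proof -
  let ?N = "real CARD('n)"
  have N: "?N > 0" by simp
  have "measure lborel \<Omega> \<le> measure lborel (cball z \<rho>)"
    using sub open_dom emeasure_lborel_cball_finite[of z \<rho>] by (intro measure_mono_fmeasurable) (auto simp: fmeasurable_def)
  also have "\<dots> = unit_ball_vol ?N * \<rho> ^ CARD('n)"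
    using r content_cball[of \<rho> z] by simp
  finally have "measure lborel \<Omega> powr (1 / ?N) \<le> (unit_ball_vol ?N * \<rho> ^ CARD('n)) powr (1 / ?N)"
    by (intro powr_mono2) auto
  also have "\<dots> = unit_ball_vol ?N powr (1 / ?N) * (\<rho> ^ CARD('n)) powr (1 / ?N)"
    using r by (subst powr_mult) auto
  also have "(\<rho> ^ CARD('n)) powr (1 / ?N) = \<rho>"
    using r N by (simp add: powr_powr flip: powr_realpow)
  finally show "measure lborel \<Omega> powr (1 / ?N) \<le> unit_ball_vol ?N powr (1 / ?N) * \<rho>" .
  obtain x s where x: "x \<in> \<Omega>" "s > 0" "cball x s \<subseteq> \<Omega>"
    using nonempty_dom open_dom open_contains_cball by blast
  have "0 < measure lborel (cball x s)" using x by simp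
  also have "\<dots> \<le> measure lborel \<Omega>"
    using x open_dom bounded_dom emeasure_bounded_finite[OF bounded_dom]
    by (intro measure_mono_fmeasurable) (auto simp: fmeasurable_def)
  finally show "measure lborel \<Omega> > 0" .
qed

end

section \<open>The harmonic function \<open>h\<close> attached to a critical point\<close>

locale torsion_critical = torsion \<Omega> \<alpha> u
  for \<Omega> :: "(real^'n) set" and \<alpha> :: real and u :: "real^'n \<Rightarrow> real" +
  fixes z :: "real^'n" and a :: real
  assumes z_mem: "z \<in> \<Omega>" and critical: "U z = 0"
begin

definition h where "h x = ((dist x z)\<^sup>2 - a) / 2 - u x"
definition hF where "hF x = (x - z) - U x"
definition hH where "hH x = mat 1 - HU x"
definition hess_int where "hess_int = (LINT x:\<Omega>|lborel. (norm (hH x))\<^sup>2)"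

abbreviation \<mu> where "\<mu> \<equiv> mu0 \<Omega> z"

lemma harmonic_h: "harmonic h hF hH \<Omega>"
proof -
  have "has_C2 (\<lambda>x. (dist x z)\<^sup>2 / 2 - a / 2 - u x) (\<lambda>x. (x - z) - 0 - U x) (\<lambda>x. mat 1 - 0 - HU x) \<Omega>"
    by (intro has_C2_diff has_C2_quadratic has_C2_const has_C2_u open_dom)
  then have "has_C2 h hF hH \<Omega>"
    unfolding h_def[abs_def] hF_def[abs_def] hH_def[abs_def] by (simp add: diff_divide_distrib)
  then show ?thesis unfolding harmonic_def by (simp add: hH_def trace_u)
qed

lemma C2_h: "has_C2 h hF hH \<Omega>" using harmonic_h by (simp add: harmonic_def)

lemma continuous_h: "continuous_on (closure \<Omega>) h"
  unfolding h_def by (intro continuous_intros continuous_u) auto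

lemma hess_integrable: "set_integrable lborel \<Omega> (\<lambda>x. (norm (hH x))\<^sup>2)"
proof (rule set_integrable_dominated[OF open_dom])
  show "continuous_on \<Omega> (\<lambda>x. (norm (hH x))\<^sup>2)"
    using C2_h unfolding has_C2_def by (auto intro!: continuous_intros)
  have "set_integrable lborel \<Omega> (\<lambda>x. 2 * (norm (mat 1 :: real^'n^'n))\<^sup>2)"
    by (rule set_integrable_bounded_continuous[OF open_dom bounded_dom]) auto
  moreover have "set_integrable lborel \<Omega> (\<lambda>x. 2 * (norm (HU x))\<^sup>2)"
    using hessian_square_integrable by simp
  ultimately show "set_integrable lborel \<Omega> (\<lambda>x. 2 * (norm (mat 1 :: real^'n^'n))\<^sup>2 + 2 * (norm (HU x))\<^sup>2)"
    by (rule set_integral_add(1))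
  fix x
  have "(norm (hH x))\<^sup>2 \<le> (norm (mat 1 :: real^'n^'n) + norm (HU x))\<^sup>2"
    unfolding hH_def by (intro power_mono norm_triangle_ineq4) simp
  also have "\<dots> \<le> 2 * (norm (mat 1 :: real^'n^'n))\<^sup>2 + 2 * (norm (HU x))\<^sup>2"
    using zero_le_power2[of "norm (mat 1 :: real^'n^'n) - norm (HU x)"] by (simp add: power2_eq_square algebra_simps)
  finally show "\<bar>(norm (hH x))\<^sup>2\<bar> \<le> 2 * (norm (mat 1 :: real^'n^'n))\<^sup>2 + 2 * (norm (HU x))\<^sup>2" by simp
qed

lemma hessL2_h: "hessL2 \<Omega> h = sqrt hess_int"
proof -
  have "(\<lambda>x. indicator \<Omega> x *\<^sub>R hess_sq h x) = (\<lambda>x. indicator \<Omega> x *\<^sub>R (norm (hH x))\<^sup>2)"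
    using has_C2_hess_sq[OF C2_h] by (auto simp: fun_eq_iff indicator_def)
  then show ?thesis unfolding hessL2_def hess_int_def set_lebesgue_integral_def by simp
qed

lemma hess_int_nonneg: "hess_int \<ge> 0"
  unfolding hess_int_def set_lebesgue_integral_def by (intro Bochner_Integration.integral_nonneg) (auto simp: indicator_def)

lemma gradient_h_bounded: "\<exists>B. \<forall>x\<in>\<Omega>. norm (hF x) \<le> B"
proof -
  obtain M where M: "\<And>x. x \<in> \<Omega> \<Longrightarrow> norm (U x) \<le> M" using gradient_bounded by blast
  obtain R where R: "\<And>x. x \<in> \<Omega> \<Longrightarrow> norm x \<le> R" using bounded_dom unfolding bounded_iff by blast
  have "norm (hF x) \<le> (R + norm z) + M" if "x \<in> \<Omega>" for x
    unfolding hF_def using M[OF that] R[OF that] norm_triangle_ineq4[of "x - z" "U x"] norm_triangle_ineq4[of x z] by linarith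
  then show ?thesis by blast
qed

lemma gradient_h_integrable: "set_integrable lborel \<Omega> (\<lambda>x. (norm (hF x))\<^sup>2)"
proof -
  obtain B where B: "\<And>x. x \<in> \<Omega> \<Longrightarrow> norm (hF x) \<le> B" using gradient_h_bounded by blast
  show ?thesis
  proof (rule set_integrable_bounded_continuous[OF open_dom bounded_dom])
    show "continuous_on \<Omega> (\<lambda>x. (norm (hF x))\<^sup>2)"
      by (intro continuous_intros has_C2_continuous_grad[OF C2_h])
    show "\<bar>(norm (hF x))\<^sup>2\<bar> \<le> B\<^sup>2" if "x \<in> \<Omega>" for x
      using B[OF that] by (simp add: power_mono)
  qed
qed

lemma h_bounded: "\<exists>B. \<forall>x\<in>closure \<Omega>. \<bar>h x\<bar> \<le> B"
proof -
  have "compact (h ` closure \<Omega>)"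
    using bounded_dom by (intro compact_continuous_image continuous_h) simp
  then have "bounded (h ` closure \<Omega>)" by (rule compact_imp_bounded)
  then show ?thesis unfolding bounded_iff by auto
qed

lemma h_integrable: "set_integrable lborel \<Omega> (\<lambda>x. (h x - c)\<^sup>2)"
proof -
  obtain B where B: "\<And>x. x \<in> closure \<Omega> \<Longrightarrow> \<bar>h x\<bar> \<le> B" using h_bounded by blast
  show ?thesis
  proof (rule set_integrable_bounded_continuous[OF open_dom bounded_dom])
    show "continuous_on \<Omega> (\<lambda>x. (h x - c)\<^sup>2)"
      by (intro continuous_intros has_C2_continuous[OF C2_h])
    fix x assume "x \<in> \<Omega>"
    then have "\<bar>h x\<bar> \<le> B" using B closure_subset by blast
    then have "\<bar>h x - c\<bar> \<le> B + \<bar>c\<bar>" by linarith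
    then show "\<bar>(h x - c)\<^sup>2\<bar> \<le> (B + \<bar>c\<bar>)\<^sup>2" by (metis abs_ge_zero abs_power2 power2_abs power_mono)
  qed
qed

lemma harmonic_h_shift: "harmonic (\<lambda>x. h x - c) hF hH \<Omega>"
proof -
  have "has_C2 (\<lambda>x. h x - c) (\<lambda>x. hF x - 0) (\<lambda>x. hH x - 0) \<Omega>"
    by (intro has_C2_diff C2_h has_C2_const open_dom)
  then show ?thesis using harmonic_h by (simp add: harmonic_def)
qed

lemma admissible_h: "admissible z (\<lambda>x. h x - h z) hF hH"
  unfolding admissible_def using harmonic_h_shift h_integrable gradient_h_integrable by simp

text \<open>The partial derivatives of \<open>h\<close> are harmonic and vanish at \<open>z\<close>,
  where both the paraboloid and \<open>u\<close> are critical, so each is a competitor for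
  \<open>mu0\<close>. Their energies are the squared columns of the Hessian and add up to its
  squared norm.\<close>

lemma energy_partial_h:
  shows "\<mu> * energy hF \<le> hess_int"
proof -
  let ?v = "\<lambda>i x. hF x \<bullet> axis i 1" and ?V = "\<lambda>i x. hH x *v axis i 1"
  have cH: "continuous_on \<Omega> hH" using C2_h by (simp add: has_C2_def)
  have adm: "\<exists>K. admissible z (?v i) (?V i) K" for i
  proof -
    obtain K where har: "harmonic (?v i) (?V i) K \<Omega>" using harmonic_partial[OF harmonic_h] by blast
    have cV: "continuous_on \<Omega> (?V i)" using har has_C2_continuous_grad by (auto simp: harmonic_def)
    have "set_integrable lborel \<Omega> (\<lambda>x. (?v i x)\<^sup>2)"
    proof (rule set_integrable_dominated[OF open_dom _ gradient_h_integrable])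
      show "continuous_on \<Omega> (\<lambda>x. (?v i x)\<^sup>2)" by (intro continuous_intros has_C2_continuous_grad[OF C2_h])
      fix x
      have "\<bar>?v i x\<bar> \<le> norm (hF x)" using component_le_norm_cart[of "hF x" i] by (simp add: inner_axis)
      then show "\<bar>(?v i x)\<^sup>2\<bar> \<le> (norm (hF x))\<^sup>2" by (metis abs_ge_zero abs_power2 power2_abs power_mono)
    qed
    moreover have "set_integrable lborel \<Omega> (\<lambda>x. (norm (?V i x))\<^sup>2)"
    proof (rule set_integrable_dominated[OF open_dom _ hess_integrable])
      show "continuous_on \<Omega> (\<lambda>x. (norm (?V i x))\<^sup>2)" by (intro continuous_intros cV)
      fix x
      have "norm (?V i x) \<le> norm (hH x)" using norm_matrix_vec_le[of "hH x" "axis i 1"] by simp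
      then show "\<bar>(norm (?V i x))\<^sup>2\<bar> \<le> (norm (hH x))\<^sup>2" by (simp add: power_mono)
    qed
    moreover have "?v i z = 0" by (simp add: hF_def critical)
    ultimately show ?thesis unfolding admissible_def using har by blast
  qed
  have "\<mu> * energy hF = (\<Sum>i\<in>UNIV. \<mu> * (LINT x:\<Omega>|lborel. (?v i x)\<^sup>2))"
  proof -
    have "energy hF = (LINT x|lborel. (\<Sum>i\<in>UNIV. indicator \<Omega> x *\<^sub>R (?v i x)\<^sup>2))"
      unfolding energy_def set_lebesgue_integral_def norm_sq_components by (simp add: sum_distrib_left)
    also have "\<dots> = (\<Sum>i\<in>UNIV. LINT x:\<Omega>|lborel. (?v i x)\<^sup>2)"
      using adm unfolding set_lebesgue_integral_def admissible_def set_integrable_def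
      by (subst Bochner_Integration.integral_sum) auto
    finally show ?thesis by (simp add: sum_distrib_left)
  qed
  also have "\<dots> \<le> (\<Sum>i\<in>UNIV. energy (?V i))"
    using adm mu0_inequality[OF z_mem] by (intro sum_mono) blast
  also have "\<dots> = (LINT x|lborel. (\<Sum>i\<in>UNIV. indicator \<Omega> x *\<^sub>R (norm (?V i x))\<^sup>2))"
    using adm unfolding energy_def set_lebesgue_integral_def admissible_def set_integrable_def
    by (subst Bochner_Integration.integral_sum) auto
  also have "\<dots> = hess_int"
    unfolding hess_int_def set_lebesgue_integral_def sum_norm_columns[symmetric] by (simp add: sum_distrib_left)
  finally show ?thesis .
qed

text \<open>Two successive uses of \<open>mu0\<close>, for \<open>h - h z\<close> and for its
  partial derivatives, hence the square.\<close>

lemma square_integral_h: "\<mu>\<^sup>2 * (LINT x:\<Omega>|lborel. (h x - h z)\<^sup>2) \<le> hess_int"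
proof -
  have "\<mu> * (\<mu> * (LINT x:\<Omega>|lborel. (h x - h z)\<^sup>2)) \<le> \<mu> * energy hF"
    using mu0_inequality[OF z_mem admissible_h] mu0_pos[OF z_mem] by (intro mult_left_mono) auto
  also have "\<dots> \<le> hess_int" by (rule energy_partial_h)
  finally show ?thesis by (simp add: power2_eq_square mult.assoc)
qed

lemma W22_h: "W22 \<Omega> (\<lambda>x. h x - c)"
proof -
  note C2 = harmonic_h_shift[of c, unfolded harmonic_def, THEN conjunct1]
  have "(\<lambda>x. indicator \<Omega> x *\<^sub>R (norm (grad (\<lambda>x. h x - c) x))\<^sup>2) = (\<lambda>x. indicator \<Omega> x *\<^sub>R (norm (hF x))\<^sup>2)"
    "(\<lambda>x. indicator \<Omega> x *\<^sub>R hess_sq (\<lambda>x. h x - c) x) = (\<lambda>x. indicator \<Omega> x *\<^sub>R (norm (hH x))\<^sup>2)"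
    using has_C2_grad[OF C2] has_C2_hess_sq[OF C2] by (auto simp: fun_eq_iff indicator_def)
  then show ?thesis
    unfolding W22_def
    using has_C2_C2_on[OF C2] continuous_h h_integrable gradient_h_integrable hess_integrable
    by (auto simp: set_integrable_def intro!: continuous_intros)
qed

text \<open>The three parts of the squared norm cost 1 / \<mu>^2, 1 / \<mu> and 1, and their sum is
  at most ((1 + \<mu>) / \<mu>)^2.\<close>

lemma W22_norm_h: "W22_norm \<Omega> (\<lambda>x. h x - h z) \<le> (1 + \<mu>) / \<mu> * sqrt hess_int"
proof -
  note C2 = harmonic_h_shift[of "h z", unfolded harmonic_def, THEN conjunct1]
  have mu: "\<mu> > 0" by (rule mu0_pos[OF z_mem])
  let ?I = "LINT x:\<Omega>|lborel. (h x - h z)\<^sup>2"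
  have "(\<lambda>x. indicator \<Omega> x *\<^sub>R ((h x - h z)\<^sup>2 + (norm (grad (\<lambda>x. h x - h z) x))\<^sup>2 + hess_sq (\<lambda>x. h x - h z) x))
     = (\<lambda>x. indicator \<Omega> x *\<^sub>R ((h x - h z)\<^sup>2 + (norm (hF x))\<^sup>2 + (norm (hH x))\<^sup>2))"
    using has_C2_grad[OF C2] has_C2_hess_sq[OF C2] by (auto simp: fun_eq_iff indicator_def)
  then have "(LINT x:\<Omega>|lborel. (h x - h z)\<^sup>2 + (norm (grad (\<lambda>x. h x - h z) x))\<^sup>2 + hess_sq (\<lambda>x. h x - h z) x)
     = (LINT x:\<Omega>|lborel. (h x - h z)\<^sup>2 + (norm (hF x))\<^sup>2 + (norm (hH x))\<^sup>2)"
    unfolding set_lebesgue_integral_def by simp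
  \<comment> \<open>Splitting the integral relies on all three parts being integrable, the Hessian
    included.\<close>
  also have "\<dots> = ?I + energy hF + hess_int"
    using h_integrable gradient_h_integrable hess_integrable unfolding energy_def hess_int_def
    by (simp add: set_integral_add)
  also have "\<dots> \<le> hess_int / \<mu>\<^sup>2 + hess_int / \<mu> + hess_int"
  proof -
    have "?I \<le> hess_int / \<mu>\<^sup>2" using square_integral_h mu by (simp add: field_simps)
    moreover have "energy hF \<le> hess_int / \<mu>" using energy_partial_h mu by (simp add: field_simps)
    ultimately show ?thesis by simp
  qed
  also have "\<dots> \<le> ((1 + \<mu>) / \<mu>)\<^sup>2 * hess_int"
  proof -
    have "((1 + \<mu>) / \<mu>)\<^sup>2 * hess_int = hess_int / \<mu>\<^sup>2 + 2 * (hess_int / \<mu>) + hess_int"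
      using mu by (simp add: power2_eq_square field_simps)
    moreover have "hess_int / \<mu> \<ge> 0" using hess_int_nonneg mu by simp
    ultimately show ?thesis by linarith
  qed
  finally have "W22_norm \<Omega> (\<lambda>x. h x - h z) \<le> sqrt (((1 + \<mu>) / \<mu>)\<^sup>2 * hess_int)"
    unfolding W22_norm_def by (rule real_sqrt_le_mono)
  also have "\<dots> = (1 + \<mu>) / \<mu> * sqrt hess_int"
    using mu by (simp add: real_sqrt_mult)
  finally show ?thesis .
qed

text \<open>The embedding inequality for a nonconstant linear function excludes a negative constant;
  the sign is needed before \<open>c\<close> may multiply upper bounds.\<close>

lemma holder_constant_nonneg:
  assumes c: "\<forall>v. W22 \<Omega> v \<longrightarrow> (\<forall>x\<in>closure \<Omega>. \<forall>y\<in>closure \<Omega>.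
                 \<bar>v x - v y\<bar> \<le> c * W22_norm \<Omega> v * dist x y powr \<gamma>)"
  shows "c \<ge> 0"
proof (rule ccontr)
  assume neg: "\<not> c \<ge> 0"
  obtain i :: 'n where True by simp
  let ?e = "axis i 1 :: real^'n"
  let ?v = "\<lambda>x. 0 + ?e \<bullet> x"
  have C2: "has_C2 ?v (\<lambda>x. ?e) (\<lambda>x. 0) \<Omega>" by (rule has_C2_affine[OF open_dom])
  obtain B where B: "\<And>x. x \<in> \<Omega> \<Longrightarrow> norm x \<le> B" using bounded_dom unfolding bounded_iff by blast
  have "(\<lambda>x. indicator \<Omega> x *\<^sub>R (norm (grad ?v x))\<^sup>2) = (\<lambda>x. indicator \<Omega> x *\<^sub>R 1)"
    "(\<lambda>x. indicator \<Omega> x *\<^sub>R hess_sq ?v x) = (\<lambda>x. indicator \<Omega> x *\<^sub>R 0)"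
    using has_C2_grad[OF C2] has_C2_hess_sq[OF C2] by (auto simp: fun_eq_iff indicator_def)
  moreover have "set_integrable lborel \<Omega> (\<lambda>x. (?v x)\<^sup>2)"
  proof (rule set_integrable_bounded_continuous[OF open_dom bounded_dom])
    show "continuous_on \<Omega> (\<lambda>x. (?v x)\<^sup>2)" by (intro continuous_intros)
    fix x assume "x \<in> \<Omega>"
    then have "\<bar>?v x\<bar> \<le> B" using B[of x] component_le_norm_cart[of x i] by (simp add: inner_axis')
    then show "\<bar>(?v x)\<^sup>2\<bar> \<le> B\<^sup>2" by (metis abs_ge_zero abs_power2 power2_abs power_mono)
  qed
  moreover have "set_integrable lborel \<Omega> (\<lambda>x. 1::real)"
    by (rule set_integrable_bounded_continuous[OF open_dom bounded_dom]) auto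
  ultimately have "W22 \<Omega> ?v"
    unfolding W22_def using has_C2_C2_on[OF C2]
    by (auto simp: set_integrable_def intro!: continuous_intros)
  then have le: "\<bar>?v x - ?v y\<bar> \<le> c * W22_norm \<Omega> ?v * dist x y powr \<gamma>" if "x \<in> closure \<Omega>" "y \<in> closure \<Omega>" for x y
    using c that by blast
  obtain r where r: "r > 0" "cball z r \<subseteq> \<Omega>" using z_mem open_dom open_contains_cball by blast
  let ?y = "z + r *\<^sub>R ?e"
  have "?y \<in> cball z r" using r by (simp add: dist_norm)
  then have "?y \<in> closure \<Omega>" "z \<in> closure \<Omega>"
    using r z_mem closure_subset by blast+
  from le[OF this] have "r \<le> c * W22_norm \<Omega> ?v * dist ?y z powr \<gamma>"
    using r by (simp add: inner_add_right inner_axis')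
  also have "\<dots> \<le> 0"
  proof -
    have "W22_norm \<Omega> ?v \<ge> 0"
      unfolding W22_norm_def set_lebesgue_integral_def hess_sq_def
      by (intro real_sqrt_ge_zero Bochner_Integration.integral_nonneg) (auto simp: indicator_def intro!: add_nonneg_nonneg sum_nonneg)
    then show ?thesis using neg by (simp add: mult_nonpos_nonneg)
  qed
  finally show False using r by simp
qed

section \<open>Dimensions two and three\<close>

lemma boundary_difference:
  assumes "x \<in> frontier \<Omega>" "y \<in> frontier \<Omega>"
  shows "(dist x z)\<^sup>2 - (dist y z)\<^sup>2 = 2 * (h x - h y)"
  using boundary_u[OF assms(1)] boundary_u[OF assms(2)] by (simp add: h_def field_simps)

text \<open>Up to a factor 2, (\<rho>e + \<rho>i) (\<rho>e - \<rho>i) is a difference of boundary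
  values of \<open>h\<close>, which the embedding bounds by the W^(2,2) norm. The factor \<rho>e is
  then divided out and estimated below by the volume.\<close>

lemma stability_low_dimension:
  assumes c: "\<forall>v. W22 \<Omega> v \<longrightarrow> (\<forall>x\<in>closure \<Omega>. \<forall>y\<in>closure \<Omega>.
                 \<bar>v x - v y\<bar> \<le> c * W22_norm \<Omega> v * dist x y powr \<gamma>)" and \<gamma>: "\<gamma> > 0"
  shows "Sup ((\<lambda>x. dist x z) ` frontier \<Omega>) - Inf ((\<lambda>x. dist x z) ` frontier \<Omega>)
     \<le> 2 * unit_ball_vol (real CARD('n)) powr (1 / real CARD('n)) * c
       * (diameter \<Omega> powr \<gamma> / measure lborel \<Omega> powr (1 / real CARD('n))) * ((1 + \<mu>) / \<mu>) * hessL2 \<Omega> h"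
proof -
  obtain xe where xe: "xe \<in> frontier \<Omega>" "Sup ((\<lambda>x. dist x z) ` frontier \<Omega>) = dist xe z" "\<Omega> \<subseteq> cball z (dist xe z)"
    by (rule farthest_frontier_point[OF z_mem])
  obtain xi where xi: "xi \<in> frontier \<Omega>" "Inf ((\<lambda>x. dist x z) ` frontier \<Omega>) = dist xi z" "dist xi z > 0"
    by (rule nearest_frontier_point[OF z_mem])
  define \<rho>e where "\<rho>e = dist xe z"
  define \<rho>i where "\<rho>i = dist xi z"
  have re: "\<rho>e > 0" using frontier_disjoint[OF xe(1)] z_mem by (auto simp: \<rho>e_def)
  let ?N = "real CARD('n)"
  let ?w = "unit_ball_vol ?N powr (1 / ?N)"
  let ?V = "measure lborel \<Omega> powr (1 / ?N)"
  define Z where "Z = c * diameter \<Omega> powr \<gamma> * ((1 + \<mu>) / \<mu> * sqrt hess_int)"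
  have mu: "\<mu> > 0" by (rule mu0_pos[OF z_mem])
  have c0: "c \<ge> 0" by (rule holder_constant_nonneg[OF c])
  have Z0: "Z \<ge> 0" unfolding Z_def using c0 mu hess_int_nonneg by (intro mult_nonneg_nonneg) auto
  have cl: "xe \<in> closure \<Omega>" "xi \<in> closure \<Omega>" using xe xi by (auto simp: frontier_def)
  have "h xe - h xi \<le> \<bar>(h xe - h z) - (h xi - h z)\<bar>" by simp
  also have "\<dots> \<le> c * W22_norm \<Omega> (\<lambda>x. h x - h z) * dist xe xi powr \<gamma>"
    using c W22_h[of "h z"] cl by blast
  also have "\<dots> \<le> c * ((1 + \<mu>) / \<mu> * sqrt hess_int) * diameter \<Omega> powr \<gamma>"
  proof (rule mult_mono[OF mult_left_mono[OF W22_norm_h c0]])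
    have "dist xe xi \<le> diameter (closure \<Omega>)"
      by (rule diameter_bounded_bound[OF bounded_closure[OF bounded_dom] cl])
    then show "dist xe xi powr \<gamma> \<le> diameter \<Omega> powr \<gamma>"
      using \<gamma> by (intro powr_mono2) (auto simp: diameter_closure[OF bounded_dom])
    show "0 \<le> c * ((1 + \<mu>) / \<mu> * sqrt hess_int)" using c0 mu hess_int_nonneg by simp
  qed auto
  also have "\<dots> = Z" by (simp add: Z_def)
  finally have hZ: "h xe - h xi \<le> Z" .
  have V: "?V \<le> ?w * \<rho>e" "measure lborel \<Omega> > 0" using volume_le_radius[OF xe(3)] re by (auto simp: \<rho>e_def)
  have "\<rho>e * (\<rho>e - \<rho>i) \<le> 2 * Z"
  proof (cases "\<rho>e \<ge> \<rho>i")
    case True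
    have "\<rho>e * (\<rho>e - \<rho>i) \<le> (\<rho>e + \<rho>i) * (\<rho>e - \<rho>i)"
      using True by (intro mult_right_mono) (auto simp: \<rho>i_def)
    also have "\<dots> = \<rho>e\<^sup>2 - \<rho>i\<^sup>2" by (simp add: power2_eq_square algebra_simps)
    also have "\<dots> = 2 * (h xe - h xi)" unfolding \<rho>e_def \<rho>i_def by (rule boundary_difference[OF xe(1) xi(1)])
    finally show ?thesis using hZ by simp
  next
    \<comment> \<open>Then the left side is negative and \<open>Z\<close> is not, so the order of
      the two radii need not be proved.\<close>
    case False
    then show ?thesis using re Z0 by (smt (verit) mult_nonneg_nonpos)
  qed
  then have "\<rho>e - \<rho>i \<le> 2 * Z / \<rho>e" using re by (simp add: field_simps)
  also have "\<dots> \<le> 2 * Z * (?w / ?V)"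
  proof -
    have "1 / \<rho>e \<le> ?w / ?V" using V re by (simp add: field_simps)
    then have "2 * Z * (1 / \<rho>e) \<le> 2 * Z * (?w / ?V)" using Z0 by (intro mult_left_mono) auto
    then show ?thesis by simp
  qed
  also have "\<dots> = 2 * ?w * c * (diameter \<Omega> powr \<gamma> / ?V) * ((1 + \<mu>) / \<mu>) * hessL2 \<Omega> h"
    by (simp add: Z_def hessL2_h mult_ac)
  finally show ?thesis unfolding xe(2) xi(2) \<rho>e_def \<rho>i_def .
qed

section \<open>Higher dimensions\<close>

lemma h_pointwise:
  assumes b: "ball y \<sigma> \<subseteq> \<Omega>" and s: "\<sigma> > 0"
  shows "\<bar>h y - h z\<bar> \<le> mean_const TYPE('n) * \<sigma> powr (- (real CARD('n) / 2)) * (sqrt hess_int / \<mu>)"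
proof -
  have mu: "\<mu> > 0" by (rule mu0_pos[OF z_mem])
  let ?m = "bump_mass TYPE('n)"
  have m: "?m > 0" by (rule bump_mass_pos)
  \<comment> \<open>The mean value needs a closed ball inside the domain; halving the radius
    provides it.\<close>
  have sub: "cball y (\<sigma> / 2) \<subseteq> \<Omega>" using b s by (auto simp: subset_iff)
  have "?m * (\<sigma> / 2) ^ CARD('n) * (h y - h z)\<^sup>2 \<le> (LINT x:\<Omega>|lborel. (h x - h z)\<^sup>2)"
    using s by (intro harmonic_mean_square[OF harmonic_h_shift sub _ h_integrable]) simp
  also have "\<dots> \<le> hess_int / \<mu>\<^sup>2" using square_integral_h mu by (simp add: field_simps)
  finally have le: "?m * (\<sigma> / 2) ^ CARD('n) * (h y - h z)\<^sup>2 \<le> hess_int / \<mu>\<^sup>2" .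
  have "?m * (\<sigma> / 2) ^ CARD('n) > 0" using m s by simp
  then have "(h y - h z)\<^sup>2 \<le> hess_int / \<mu>\<^sup>2 / (?m * (\<sigma> / 2) ^ CARD('n))"
    using le by (simp only: pos_le_divide_eq mult.commute[of "(h y - h z)\<^sup>2"])
  also have "\<dots> = (mean_const TYPE('n) * \<sigma> powr (- (real CARD('n) / 2)) * (sqrt hess_int / \<mu>))\<^sup>2"
  proof -
    have "(\<sigma> powr (- (real CARD('n) / 2)))\<^sup>2 = 1 / \<sigma> ^ CARD('n)"
      using s by (simp add: power2_eq_square powr_minus field_simps powr_realpow flip: powr_add)
    moreover have "(mean_const TYPE('n))\<^sup>2 = 2 ^ CARD('n) / ?m" using m by (simp add: mean_const_def)
    ultimately show ?thesis
      using hess_int_nonneg by (simp add: power_mult_distrib power_divide mult_ac)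
  qed
  finally show ?thesis
    using mean_const_pos[where 'n='n] hess_int_nonneg mu
    by (intro power2_le_imp_le[of "\<bar>h y - h z\<bar>", simplified power2_abs] mult_nonneg_nonneg) auto
qed

text \<open>\<open>h\<close> is controlled only at depth \<sigma>, so both extremal points are moved
  inwards: the farthest along the radius of its interior sphere, the nearest towards
  \<open>z\<close>. At the first point the sign of \<open>u\<close> helps, since
  \<open>- u ye\<close> only enlarges \<open>h ye\<close>; at the second the gradient bound gives
  \<open>- u yi <= M * \<sigma>\<close>. What remains compares the squares of \<rho>e - \<sigma> and
  \<rho>i - \<sigma>.\<close>

lemma interior_point_estimate:
  assumes r: "interior_sphere_radius \<Omega> r" and s: "0 < \<sigma>" "\<sigma> \<le> r / 4"
    and xe: "xe \<in> frontier \<Omega>" "\<Omega> \<subseteq> cball z (dist xe z)"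
    and xi: "xi \<in> frontier \<Omega>" "ball z (dist xi z) \<subseteq> \<Omega>" "dist xi z > 0" "dist xi z \<le> dist xe z"
    and M: "\<And>x. x \<in> \<Omega> \<Longrightarrow> norm (U x) \<le> M" and M0: "M \<ge> 0"
    and \<delta>: "\<And>y. ball y \<sigma> \<subseteq> \<Omega> \<Longrightarrow> \<bar>h y - h z\<bar> \<le> \<delta>" and \<delta>0: "\<delta> \<ge> 0"
  shows "dist xe z * (dist xe z - dist xi z) \<le> 4 * (2 * \<delta> + M * \<sigma>)"
proof -
  define \<rho>e where "\<rho>e = dist xe z"
  define \<rho>i where "\<rho>i = dist xi z"
  have rpos: "r > 0" using r by (simp add: interior_sphere_radius_def)
  obtain c where c: "ball c r \<subseteq> \<Omega>" "cball c r \<inter> frontier \<Omega> = {xe}"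
    using r xe(1) unfolding interior_sphere_radius_def by blast
  \<comment> \<open>The interior sphere lies in the ball of radius \<rho>e about \<open>z\<close>.
    Hence \<sigma> <= r / 4 also gives \<sigma> <= \<rho>e / 4, which absorbs the inward
    shifts.\<close>
  have rre: "r \<le> \<rho>e"
  proof -
    have "ball c r \<subseteq> cball z \<rho>e" using c(1) xe(2) by (auto simp: \<rho>e_def)
    then have "closure (ball c r) \<subseteq> cball z \<rho>e" by (intro closure_minimal) auto
    then have "cball c r \<subseteq> cball z \<rho>e" using rpos by simp
    then have "dist c z + r \<le> \<rho>e" using rpos by (simp add: cball_subset_cball_iff)
    then show ?thesis using zero_le_dist[of c z] by linarith
  qed
  have dc: "dist c xe = r"
  proof -
    have "dist c xe \<le> r" using c(2) by auto
    moreover have "xe \<notin> ball c r" using c(1) frontier_disjoint[OF xe(1)] by blast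
    ultimately show ?thesis by simp
  qed
  define ye where "ye = xe + (\<sigma> / r) *\<^sub>R (c - xe)"
  have dye: "dist ye xe = \<sigma>" using dc rpos s by (simp add: ye_def dist_norm)
  have dyc: "dist ye c = r - \<sigma>"
  proof -
    have "ye - c = (1 - \<sigma> / r) *\<^sub>R (xe - c)" by (simp add: ye_def algebra_simps)
    then have "dist ye c = (1 - \<sigma> / r) * r" using dc rpos s by (simp add: dist_norm norm_minus_commute)
    then show ?thesis using rpos by (simp add: algebra_simps)
  qed
  have bye: "ball ye \<sigma> \<subseteq> \<Omega>"
  proof
    fix x assume "x \<in> ball ye \<sigma>"
    then have "x \<in> ball c r" using dyc dist_triangle[of c x ye] by (simp add: dist_commute)
    then show "x \<in> \<Omega>" using c(1) by blast
  qed
  have yeO: "ye \<in> \<Omega>" using bye s by auto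
  have yez: "dist ye z \<ge> \<rho>e - \<sigma>" using dye dist_triangle[of xe z ye] by (simp add: \<rho>e_def dist_commute)
  have sre: "\<sigma> \<le> \<rho>e / 4" using s rre by simp
  have yez2: "(dist ye z)\<^sup>2 \<ge> (\<rho>e - \<sigma>)\<^sup>2" using yez sre s by (intro power_mono) auto
  have hye: "h ye - h z \<le> \<delta>" using \<delta>[OF bye] by simp
  have uye: "u ye \<le> 0" using u_nonpos closure_subset yeO by blast
  have re0: "\<rho>e > 0" using rre rpos by simp
  show ?thesis
  proof (cases "\<sigma> \<le> \<rho>i")
    case True
    define yi where "yi = xi + (\<sigma> / \<rho>i) *\<^sub>R (z - xi)"
    have ri: "\<rho>i > 0" using xi by (simp add: \<rho>i_def)
    have dyi: "dist yi xi = \<sigma>" using ri s by (simp add: yi_def dist_norm \<rho>i_def norm_minus_commute)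
    have dyz: "dist yi z = \<rho>i - \<sigma>"
    proof -
      have "yi - z = (1 - \<sigma> / \<rho>i) *\<^sub>R (xi - z)" by (simp add: yi_def algebra_simps)
      then have "dist yi z = (1 - \<sigma> / \<rho>i) * \<rho>i" using ri True s by (simp add: dist_norm \<rho>i_def)
      then show ?thesis using ri by (simp add: algebra_simps)
    qed
    have byi: "ball yi \<sigma> \<subseteq> \<Omega>"
    proof
      fix x assume "x \<in> ball yi \<sigma>"
      then have "x \<in> ball z \<rho>i" using dyz dist_triangle[of z x yi] by (simp add: dist_commute)
      then show "x \<in> \<Omega>" using xi(2) by (auto simp: \<rho>i_def)
    qed
    have "- u yi \<le> M * dist yi xi"
      using dyz s ri by (intro growth_in_ball[OF M xi(2,3) _ xi(1)]) (auto simp: \<rho>i_def dist_commute)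
    then have uyi: "- u yi \<le> M * \<sigma>" by (simp add: dyi)
    have "\<bar>h yi - h z\<bar> \<le> \<delta>" by (rule \<delta>[OF byi])
    then have "h ye - h yi \<le> 2 * \<delta>" using hye by linarith
    moreover have "h ye - h yi = ((dist ye z)\<^sup>2 - (\<rho>i - \<sigma>)\<^sup>2) / 2 - u ye + u yi"
      by (simp add: h_def dyz diff_divide_distrib)
    ultimately have "((\<rho>e - \<sigma>)\<^sup>2 - (\<rho>i - \<sigma>)\<^sup>2) / 2 \<le> 2 * \<delta> + M * \<sigma>"
      using yez2 uye uyi unfolding diff_divide_distrib by linarith
    moreover have "(\<rho>e - \<sigma>)\<^sup>2 - (\<rho>i - \<sigma>)\<^sup>2 = (\<rho>e + \<rho>i - 2 * \<sigma>) * (\<rho>e - \<rho>i)"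
      by (simp add: power2_eq_square algebra_simps)
    \<comment> \<open>Half of \<rho>e pays for the 2 \<sigma> lost in the sum of the shifted
      radii.\<close>
    moreover have "(\<rho>e / 2) * (\<rho>e - \<rho>i) \<le> (\<rho>e + \<rho>i - 2 * \<sigma>) * (\<rho>e - \<rho>i)"
    proof (rule mult_right_mono)
      show "\<rho>e / 2 \<le> \<rho>e + \<rho>i - 2 * \<sigma>" using sre ri by linarith
      show "0 \<le> \<rho>e - \<rho>i" using xi(4) by (simp add: \<rho>e_def \<rho>i_def)
    qed
    ultimately show ?thesis by (simp add: \<rho>e_def[symmetric] \<rho>i_def[symmetric])
  next
    \<comment> \<open>The nearest boundary point is too close to \<open>z\<close> for a move by
      \<sigma>, so \<open>z\<close> itself serves as inner point; its distance to the boundary is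
      below \<sigma>, and \<rho>e^2 itself is bounded as required.\<close>
    case False
    have "- u z \<le> M * dist z xi"
      using xi(3) by (intro growth_in_ball[OF M xi(2,3) _ xi(1)]) (auto simp: dist_commute)
    also have "\<dots> \<le> M * \<sigma>" using False M0 by (intro mult_left_mono) (auto simp: \<rho>i_def dist_commute)
    finally have uz: "- u z \<le> M * \<sigma>" .
    have "h ye - h z = (dist ye z)\<^sup>2 / 2 - u ye + u z"
      by (simp add: h_def diff_divide_distrib)
    then have le: "(\<rho>e - \<sigma>)\<^sup>2 / 2 \<le> \<delta> + M * \<sigma>" using yez2 uye uz hye by simp
    have "(3 / 4 * \<rho>e)\<^sup>2 \<le> (\<rho>e - \<sigma>)\<^sup>2" using sre re0 by (intro power_mono) auto
    then have "9 / 16 * \<rho>e\<^sup>2 \<le> 2 * (\<delta> + M * \<sigma>)" using le by (simp add: power_mult_distrib power_divide)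
    then have "9 * \<rho>e\<^sup>2 \<le> 32 * \<delta> + 32 * (M * \<sigma>)" by simp
    moreover have "M * \<sigma> \<ge> 0" using M0 s by simp
    ultimately have "\<rho>e\<^sup>2 \<le> 8 * \<delta> + 4 * (M * \<sigma>)" using \<delta>0 by linarith
    then have "\<rho>e\<^sup>2 \<le> 4 * (2 * \<delta> + M * \<sigma>)" by simp
    moreover have "\<rho>e * (\<rho>e - \<rho>i) \<le> \<rho>e * \<rho>e"
      using re0 xi(3) by (intro mult_left_mono) (auto simp: \<rho>i_def)
    ultimately show ?thesis by (simp add: \<rho>e_def[symmetric] \<rho>i_def[symmetric] power2_eq_square)
  qed
qed

text \<open>The depth is chosen so that the two errors of \<open>interior_point_estimate\<close>
  have the same size; the smallness assumption says precisely that this depth is available inside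
  the interior spheres.\<close>

lemma stability_high_dimension:
  defines "N \<equiv> real CARD('n)"
  defines "M \<equiv> Sup ((\<lambda>x. norm (grad u x)) ` \<Omega>)"
  assumes r: "interior_sphere_radius \<Omega> r"
    and small: "hessL2 \<Omega> h < (1/4) powr ((N + 2) / 2) * M * \<mu> * r powr ((N + 2) / 2)"
  shows "Sup ((\<lambda>x. dist x z) ` frontier \<Omega>) - Inf ((\<lambda>x. dist x z) ` frontier \<Omega>)
    \<le> 4 * (2 * mean_const TYPE('n) + 1) * unit_ball_vol N powr (1 / N) * M powr (N / (N + 2))
      / (\<mu> powr (2 / (N + 2)) * measure lborel \<Omega> powr (1 / N)) * hessL2 \<Omega> h powr (2 / (N + 2))"
proof -
  obtain xe where xe: "xe \<in> frontier \<Omega>" "Sup ((\<lambda>x. dist x z) ` frontier \<Omega>) = dist xe z" "\<Omega> \<subseteq> cball z (dist xe z)"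
    by (rule farthest_frontier_point[OF z_mem])
  obtain xi where xi: "xi \<in> frontier \<Omega>" "Inf ((\<lambda>x. dist x z) ` frontier \<Omega>) = dist xi z" "ball z (dist xi z) \<subseteq> \<Omega>" "dist xi z > 0"
    by (rule nearest_frontier_point[OF z_mem])
  define \<rho>e where "\<rho>e = dist xe z"
  define \<rho>i where "\<rho>i = dist xi z"
  have re: "\<rho>e > 0" using frontier_disjoint[OF xe(1)] z_mem by (auto simp: \<rho>e_def)
  have rie: "dist xi z \<le> dist xe z"
  proof -
    have "xi \<in> closure \<Omega>" using xi by (simp add: frontier_def)
    moreover have "closure \<Omega> \<subseteq> cball z (dist xe z)" using xe(3) by (intro closure_minimal) auto
    ultimately show ?thesis by (auto simp: dist_commute)
  qed
  have N: "N > 0" by (simp add: N_def)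
  have mu: "\<mu> > 0" by (rule mu0_pos[OF z_mem])
  have rpos: "r > 0" using r by (simp add: interior_sphere_radius_def)
  define Hs where "Hs = sqrt hess_int"
  have H0: "Hs \<ge> 0" using hess_int_nonneg by (simp add: Hs_def)
  have Mb: "norm (U x) \<le> M" if "x \<in> \<Omega>" for x unfolding M_def by (rule gradient_le_Sup[OF that])
  have M0: "M \<ge> 0" using Mb[OF z_mem] by (rule order_trans[rotated]) simp
  \<comment> \<open>The strict smallness hypothesis would read 0 < 0 or worse if \<open>M\<close>
    were zero.\<close>
  have M: "M > 0"
  proof (rule ccontr)
    assume "\<not> M > 0"
    then have "M = 0" using M0 by simp
    then show False using small H0 by (simp add: hessL2_h Hs_def)
  qed
  let ?w = "unit_ball_vol N powr (1 / N)"
  let ?V = "measure lborel \<Omega> powr (1 / N)"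
  have V: "?V \<le> ?w * \<rho>e" "measure lborel \<Omega> > 0" using volume_le_radius[OF xe(3)] re by (auto simp: \<rho>e_def N_def)
  \<comment> \<open>Solves \<sigma>^(-N/2) Hs / \<mu> = M \<sigma>, that is, \<sigma>^((N+2)/2) = Hs
    / (M \<mu>).\<close>
  define \<tau> where "\<tau> = Hs / (M * \<mu>)"
  define \<sigma> where "\<sigma> = \<tau> powr (2 / (N + 2))"
  have exponents: "(N + 2) / 2 * (2 / (N + 2)) = 1" "2 / (N + 2) * ((N + 2) / 2) = 1" using N by simp_all
  have t0: "\<tau> \<ge> 0" using H0 M mu by (simp add: \<tau>_def)
  \<comment> \<open>The factor (1/4)^((N+2)/2) in the threshold is what becomes the 1/4 in \<sigma>
    <= r / 4.\<close>
  have "\<tau> < (1/4) powr ((N + 2) / 2) * r powr ((N + 2) / 2)"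
    using small M mu unfolding \<tau>_def hessL2_h Hs_def by (simp add: divide_less_eq mult_ac)
  also have "\<dots> = (r / 4) powr ((N + 2) / 2)" using rpos by (simp add: powr_divide)
  finally have "\<sigma> \<le> ((r / 4) powr ((N + 2) / 2)) powr (2 / (N + 2))"
    unfolding \<sigma>_def using t0 N by (intro powr_mono2) auto
  also have "\<dots> = r / 4" by (simp only: powr_powr exponents) (use rpos in simp)
  finally have sr: "\<sigma> \<le> r / 4" .
  have est: "\<rho>e * (\<rho>e - \<rho>i) \<le> 4 * (2 * (mean_const TYPE('n) * s powr (- (N / 2)) * (Hs / \<mu>)) + M * s)"
    if s: "0 < s" "s \<le> r / 4" for s
    unfolding \<rho>e_def \<rho>i_def
  proof (rule interior_point_estimate[OF r s xe(1,3) xi(1,3,4) rie Mb M0])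
    show "\<bar>h y - h z\<bar> \<le> mean_const TYPE('n) * s powr (- (N / 2)) * (Hs / \<mu>)" if "ball y s \<subseteq> \<Omega>" for y
      using h_pointwise[OF that s(1)] by (simp add: N_def Hs_def)
    show "0 \<le> mean_const TYPE('n) * s powr (- (N / 2)) * (Hs / \<mu>)" using mean_const_pos[where 'n='n] H0 mu by simp
  qed
  have main: "\<rho>e * (\<rho>e - \<rho>i) \<le> 4 * (2 * mean_const TYPE('n) + 1) * (M * \<sigma>)"
  proof (cases "Hs = 0")
    \<comment> \<open>The balanced \<sigma> is 0, which is not a positive depth; instead the depth
      tends to 0 in \<open>est\<close>, where only the term \<open>M * s\<close> is left.\<close>
    case True
    have "\<rho>e * (\<rho>e - \<rho>i) \<le> 0"
    proof (rule field_le_epsilon)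
      fix e :: real assume e: "e > 0"
      define s where "s = min (r / 4) (e / (4 * M))"
      have s: "0 < s" "s \<le> r / 4" "s \<le> e / (4 * M)" using rpos e M by (auto simp: s_def)
      have "4 * M * s \<le> e" using s(3) M by (simp add: field_simps)
      then show "\<rho>e * (\<rho>e - \<rho>i) \<le> 0 + e" using est[OF s(1,2)] True by simp
    qed
    also have "0 \<le> 4 * (2 * mean_const TYPE('n) + 1) * (M * \<sigma>)" using mean_const_pos[where 'n='n] M by (simp add: \<sigma>_def)
    finally show ?thesis .
  next
    case False
    then have tp: "\<tau> > 0" using H0 M mu by (simp add: \<tau>_def)
    then have sp: "\<sigma> > 0" by (simp add: \<sigma>_def)
    have "\<sigma> powr ((N + 2) / 2) = \<tau>" unfolding \<sigma>_def by (simp only: powr_powr exponents) (use tp in simp)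
    then have "Hs / \<mu> = M * \<sigma> powr ((N + 2) / 2)" using M mu by (simp add: \<tau>_def field_simps)
    then have "\<sigma> powr (- (N / 2)) * (Hs / \<mu>) = M * (\<sigma> powr (- (N / 2)) * \<sigma> powr ((N + 2) / 2))"
      by simp
    also have "\<sigma> powr (- (N / 2)) * \<sigma> powr ((N + 2) / 2) = \<sigma>"
      using sp by (simp add: add_divide_distrib flip: powr_add)
    finally have "mean_const TYPE('n) * \<sigma> powr (- (N / 2)) * (Hs / \<mu>) = mean_const TYPE('n) * (M * \<sigma>)" by (simp only: mult.assoc)
    then show ?thesis using est[OF sp sr] by (simp add: algebra_simps)
  qed
  have Ms: "M * \<sigma> = M powr (N / (N + 2)) / \<mu> powr (2 / (N + 2)) * Hs powr (2 / (N + 2))"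
  proof -
    define P where "P = M powr (2 / (N + 2))"
    define Q where "Q = M powr (N / (N + 2))"
    define X where "X = Hs powr (2 / (N + 2))"
    define Y where "Y = \<mu> powr (2 / (N + 2))"
    have P: "P > 0" using M by (simp add: P_def)
    have "\<sigma> = X / (P * Y)"
      unfolding \<sigma>_def \<tau>_def P_def X_def Y_def using H0 M mu by (simp add: powr_divide powr_mult)
    moreover have "M = Q * P"
      unfolding P_def Q_def using M N by (simp flip: powr_add add_divide_distrib)
    ultimately have "M * \<sigma> = Q * P * (X / (P * Y))" by metis
    also have "\<dots> = Q / Y * X" using P by simp
    finally show ?thesis by (simp only: Q_def X_def Y_def)
  qed
  define k where "k = 4 * (2 * mean_const TYPE('n) + 1)"
  have k: "k > 0" using mean_const_pos[where 'n='n] by (simp add: k_def)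
  have Ms0: "M * \<sigma> \<ge> 0" using M by (simp add: \<sigma>_def)
  have "\<rho>e - \<rho>i \<le> k * (M * \<sigma>) / \<rho>e" using main re by (simp add: k_def field_simps)
  also have "\<dots> \<le> k * (M * \<sigma>) * (?w / ?V)"
  proof -
    have "1 / \<rho>e \<le> ?w / ?V" using V re by (simp add: field_simps)
    then have "k * (M * \<sigma>) * (1 / \<rho>e) \<le> k * (M * \<sigma>) * (?w / ?V)"
      using k Ms0 by (intro mult_left_mono) auto
    then show ?thesis by simp
  qed
  also have "\<dots> = k * ?w * M powr (N / (N + 2)) / (\<mu> powr (2 / (N + 2)) * ?V) * Hs powr (2 / (N + 2))"
    by (simp add: Ms)
  finally show ?thesis unfolding xe(2) xi(2) \<rho>e_def \<rho>i_def k_def hessL2_h Hs_def .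
qed

end

section \<open>Choice of the constants\<close>

theorem theorem3p4:
  fixes dummy :: "real^'n"
  assumes "CARD('n) \<ge> 2"
  shows "\<exists>k\<^sub>N \<alpha>\<^sub>N. k\<^sub>N > 0 \<and> \<alpha>\<^sub>N > 0 \<and>
    (\<forall>(\<Omega> :: (real^'n) set) \<alpha> u z a.
      open \<Omega> \<and> connected \<Omega> \<and> bounded \<Omega> \<and> \<Omega> \<noteq> {} \<and>
      0 < \<alpha> \<and> \<alpha> < 1 \<and> C2alpha_boundary \<alpha> \<Omega> \<and>
      C2_on \<Omega> u \<and> continuous_on (closure \<Omega>) u \<and>
      (\<forall>x\<in>\<Omega>. lap u x = real CARD('n)) \<and> (\<forall>x\<in>frontier \<Omega>. u x = 0) \<and>
      z \<in> closure \<Omega> \<and> (\<exists>e>0. \<forall>x\<in>closure \<Omega> \<inter> ball z e. u z \<le> u x)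
      \<longrightarrow>
      (let M = Sup ((\<lambda>x. norm (grad u x)) ` \<Omega>);
           h = (\<lambda>x. ((dist x z)\<^sup>2 - a) / 2 - u x);
           \<rho>i = Inf ((\<lambda>x. dist x z) ` frontier \<Omega>);
           \<rho>e = Sup ((\<lambda>x. dist x z) ` frontier \<Omega>);
           \<mu> = mu0 \<Omega> z;
           N = real CARD('n)
       in
       ((CARD('n) = 2 \<or> CARD('n) = 3) \<longrightarrow>
          (\<forall>\<gamma> c. (if CARD('n) = 2 then 0 < \<gamma> \<and> \<gamma> < 1 else \<gamma> = 1/2) \<and>
             (\<forall>v. W22 \<Omega> v \<longrightarrow> (\<forall>x\<in>closure \<Omega>. \<forall>y\<in>closure \<Omega>.
                 \<bar>v x - v y\<bar> \<le> c * W22_norm \<Omega> v * dist x y powr \<gamma>))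
             \<longrightarrow> \<rho>e - \<rho>i \<le> k\<^sub>N * c * (diameter \<Omega> powr \<gamma> / measure lborel \<Omega> powr (1/N))
                                * ((1 + \<mu>) / \<mu>) * hessL2 \<Omega> h)) \<and>
       (CARD('n) \<ge> 4 \<longrightarrow>
          (\<forall>r\<^sub>i. interior_sphere_radius \<Omega> r\<^sub>i \<and>
             hessL2 \<Omega> h < \<alpha>\<^sub>N * M * \<mu> * r\<^sub>i powr ((N + 2) / 2)
             \<longrightarrow> \<rho>e - \<rho>i \<le> k\<^sub>N * M powr (N / (N + 2))
                     / (\<mu> powr (2 / (N + 2)) * measure lborel \<Omega> powr (1/N))
                     * hessL2 \<Omega> h powr (2 / (N + 2))))))"
proof -
  let ?N = "real CARD('n)"
  let ?w = "unit_ball_vol ?N powr (1 / ?N)"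
  define k1 where "k1 = 2 * ?w"
  define k2 where "k2 = 4 * (2 * mean_const TYPE('n) + 1) * ?w"
  have "unit_ball_vol ?N > 0" by (rule unit_ball_vol_pos) simp
  then have w: "?w > 0" by (metis powr_gt_zero less_irrefl)
  have k: "k1 > 0" "k2 > 0" using w mean_const_pos[where 'n='n] by (auto simp: k1_def k2_def)
  show ?thesis
    unfolding Let_def
  \<comment> \<open>One constant has to serve both estimates, so the sum of the two is taken; the
    remaining factors are nonnegative in either case. The second witness is the threshold that turns
    smallness of the Hessian into an admissible depth.\<close>
  proof (rule exI[of _ "k1 + k2"], rule exI[of _ "(1/4) powr ((?N + 2) / 2)"], intro conjI allI impI)
    show "k1 + k2 > 0" using k by simp
    show "(1/4) powr ((?N + 2) / 2) > (0::real)" by simp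
    fix \<Omega> :: "(real^'n) set" and \<alpha> u z a
    assume A: "open \<Omega> \<and> connected \<Omega> \<and> bounded \<Omega> \<and> \<Omega> \<noteq> {} \<and>
      0 < \<alpha> \<and> \<alpha> < 1 \<and> C2alpha_boundary \<alpha> \<Omega> \<and>
      C2_on \<Omega> u \<and> continuous_on (closure \<Omega>) u \<and>
      (\<forall>x\<in>\<Omega>. lap u x = ?N) \<and> (\<forall>x\<in>frontier \<Omega>. u x = 0) \<and>
      z \<in> closure \<Omega> \<and> (\<exists>e>0. \<forall>x\<in>closure \<Omega> \<inter> ball z e. u z \<le> u x)"
    interpret torsion \<Omega> \<alpha> u by unfold_locales (use A in auto)
    obtain e where "z \<in> closure \<Omega>" "e > 0" "\<forall>x\<in>closure \<Omega> \<inter> ball z e. u z \<le> u x" using A by blast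
    note min = local_minimum_interior[OF this]
    interpret torsion_critical \<Omega> \<alpha> u z a by unfold_locales (use min in auto)
    have h: "h = (\<lambda>x. ((dist x z)\<^sup>2 - a) / 2 - u x)" by (simp add: h_def fun_eq_iff)
    have mu: "mu0 \<Omega> z > 0" by (rule mu0_pos[OF z_mem])
    have H0: "hessL2 \<Omega> h \<ge> 0" unfolding hessL2_h using hess_int_nonneg by simp
    {
      fix \<gamma> c :: real
      assume c: "(if CARD('n) = 2 then 0 < \<gamma> \<and> \<gamma> < 1 else \<gamma> = 1/2) \<and>
         (\<forall>v. W22 \<Omega> v \<longrightarrow> (\<forall>x\<in>closure \<Omega>. \<forall>y\<in>closure \<Omega>.
             \<bar>v x - v y\<bar> \<le> c * W22_norm \<Omega> v * dist x y powr \<gamma>))"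
      then have "\<gamma> > 0" by (auto split: if_splits)
      note le = stability_low_dimension[OF conjunct2[OF c] this]
      define R where "R = c * (diameter \<Omega> powr \<gamma> / measure lborel \<Omega> powr (1 / ?N)) * ((1 + mu0 \<Omega> z) / mu0 \<Omega> z) * hessL2 \<Omega> h"
      have "R \<ge> 0" unfolding R_def
        using holder_constant_nonneg[OF conjunct2[OF c]] mu H0 by (intro mult_nonneg_nonneg) auto
      then have "k1 * R \<le> (k1 + k2) * R" using k by (intro mult_right_mono) auto
      then show "Sup ((\<lambda>x. dist x z) ` frontier \<Omega>) - Inf ((\<lambda>x. dist x z) ` frontier \<Omega>)
          \<le> (k1 + k2) * c * (diameter \<Omega> powr \<gamma> / measure lborel \<Omega> powr (1 / ?N))
            * ((1 + mu0 \<Omega> z) / mu0 \<Omega> z) * hessL2 \<Omega> (\<lambda>x. ((dist x z)\<^sup>2 - a) / 2 - u x)"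
        using le unfolding R_def k1_def h by (simp only: mult.assoc)
    }
    {
      fix r
      assume r: "interior_sphere_radius \<Omega> r \<and>
         hessL2 \<Omega> (\<lambda>x. ((dist x z)\<^sup>2 - a) / 2 - u x)
           < (1/4) powr ((?N + 2) / 2) * Sup ((\<lambda>x. norm (grad u x)) ` \<Omega>) * mu0 \<Omega> z * r powr ((?N + 2) / 2)"
      define R where "R = Sup ((\<lambda>x. norm (grad u x)) ` \<Omega>) powr (?N / (?N + 2))
          / (mu0 \<Omega> z powr (2 / (?N + 2)) * measure lborel \<Omega> powr (1 / ?N)) * hessL2 \<Omega> h powr (2 / (?N + 2))"
      have "R \<ge> 0" unfolding R_def by (intro mult_nonneg_nonneg divide_nonneg_nonneg) auto
      then have "k2 * R \<le> (k1 + k2) * R" using k by (intro mult_right_mono) auto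
      then show "Sup ((\<lambda>x. dist x z) ` frontier \<Omega>) - Inf ((\<lambda>x. dist x z) ` frontier \<Omega>)
          \<le> (k1 + k2) * Sup ((\<lambda>x. norm (grad u x)) ` \<Omega>) powr (?N / (?N + 2))
            / (mu0 \<Omega> z powr (2 / (?N + 2)) * measure lborel \<Omega> powr (1 / ?N))
            * hessL2 \<Omega> (\<lambda>x. ((dist x z)\<^sup>2 - a) / 2 - u x) powr (2 / (?N + 2))"
        using stability_high_dimension[of r, unfolded h] r unfolding R_def k2_def h
        by (simp add: mult.assoc)
    }
  qed
qed

end
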